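(* Let $n\ge1$ and let $L=(L_d)_{d\ge1}$ be a sequence of primitive triangulations of the simplices $(\mathrm P^n_d)_{d\ge1}$. The triangulations $L_d$ are $\rho$-uniform for all $d\ge1$ if and only if the triangulations $IV_d(L)$ of $\mathrm P^{n+1}_d$ are $\rho$-uniform for all $d\ge1$.
   Context: Simplices and triangulations. $\mathrm P^m_d\subset\mathbb R^m$ is the convex hull of $\{0,de_1,\dots,de_m\}$, with $(e_i)$ the canonical basis of $M=\mathbb Z^m$ and $e_0:=0$; $\mathbb R^n$ is identified with $\{x_{n+1}=0\}\subset\mathbb R^{n+1}$. $[a_0,\dots,a_k]$ denotes a convex hull, $*$ a join. A triangulation is primitive if it consists of lattice simplices and its maximal simplices have minimal volume $1/(\text{dimension})!$. Given triangulations $K$ of $\mathrm P^{n+1}_d$ and $L'$ of $\mathrm P^n_{d+1}$: - $K+L'$ is the unique triangulation of $\mathrm P^{n+1}_{d+1}$ whose restriction to $\{x_{n+1}\ge1\}$ is the translate $K+e_{n+1}$ and such that, for all $0\le i\le n$, its restriction to $[e_{n+1},e_{n+1}+de_1,\dots,e_{n+1}+de_i]*[(d+1)e_i,\dots,(d+1)e_n]$ is the join of the restriction of $K+e_{n+1}$ to the first simplex with the restriction of $L'$ to the second; - $K+(-1)L'$ is the unique triangulation of $\mathrm P^{n+1}_{d+1}$ whose restriction to $\{x_{n+1}\ge1\}$ is $K+e_{n+1}$ and such that, for all $0\le i\le n$, its restriction to $[e_{n+1}+de_i,\dots,e_{n+1}+de_n]*[0,(d+1)e_1,\dots,(d+1)e_i]$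 is the join of the restriction of $K+e_{n+1}$ to the first simplex with the restriction of $L'$ to the second. The sequence $IV_d(L)$ is defined by $IV_1(L)=\mathrm P^{n+1}_1$ (a single maximal simplex) and $IV_{d+1}(L)=IV_d(L)+(-1)^dL_{d+1}$ for $d\ge1$. Complexes. Let $K$ be a primitive triangulation of a full-dimensional lattice polytope $P\subset M\otimes\mathbb R$, $N$ the dual lattice of $M$, $N_2=N\otimes\mathbb F_2$. A simplex is interior if not contained in $\partial P$. For $\sigma\le\tau$ in $K$, $[\sigma,\tau]$ is the union of the simplices of the barycentric subdivision given by flags between $\sigma$ and $\tau$; for $\sigma$ contained in a face $Q$ of $P$, $[\sigma,Q]=\bigcup_{\sigma\le\tau\subset Q}[\sigma,\tau]$ is a ball of dimension $\dim Q-\dim\sigma$. These are the closed cells of a regular CW structure $Y$ on $P$, with $[\sigma',Q']\le[\sigma,Q]$ iff $\sigma'\ge\sigma$, $Q'\subset Q$. $X\le Y$ is the subcomplex of cells with $\dim\sigma\ge1$. Put $\sigma^*=[\sigma,P]$ and $X_0=X\cap\bigcup_{v\text{ interior vertex}}v^*$. Waves and Hessian. A cellular sheaf $\mathcal G$ has functorial maps $\mathcal G(e')\to\mathcal G(e)$ for $e'\le e$, and $H^q(-;\mathcal G)$ is its cellular cohomology. $\mathcal W_1$ is the sheaf on $X$ with $\mathcal W_1(\sigma,Q)=((T\sigma)^\perp\cap N)\otimes\mathbb F_2\subset N_2$ ($T\sigma$ the linear tangent space) and inclusions as transition maps. $\mathcal Z^1$ is the sheaf $[\sigma,Q]\mapsto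 Z^1(\sigma;\mathbb F_2)$ (simplicial 1-cocycles, restrictions). There is a short exact sequence $0\to\mathcal W_1\to N_2\xrightarrow{z}\mathcal Z^1|_X\to0$ with $N_2$ constant and $z(u)(\sigma^1)=\langle v_0-v_1,u\rangle$ for an edge $\sigma^1$ with endpoints $v_0,v_1$. For $\varepsilon\in C^0(K;\mathbb F_2)$, $\nabla^2\varepsilon\in H^1(X;\mathcal W_1)$ is the image under the connecting morphism $H^0(X;\mathcal Z^1)\to H^1(X;\mathcal W_1)$ of the section $[\sigma,Q]\mapsto\mathrm d\varepsilon|_\sigma$. $K$ is $\rho$-uniform if there is a (necessarily unique) $\rho\in H^1(X_0;\mathcal W_1)$ with $\rho|_{\partial v^*}=\nabla^2\chi_v|_{\partial v^*}$ for every interior vertex $v$ of $K$, where $\chi_v\in C^0(K;\mathbb F_2)$ is $1$ on $v$ and $0$ elsewhere. *)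

theory Defs
  imports
    "HOL-Analysis.Analysis"
    "HOL-Library.Function_Algebras"
    "HOL-Library.Z2"
begin

text \<open>
  The space \<open>M \<otimes> \<real>\<close> is a Euclidean space \<open>'a\<close> whose \<^term>\<open>Basis\<close> is the canonical basis of
  the lattice \<open>M\<close>.  Vector spaces over \<open>\<bbbF>\<^sub>2\<close> are spaces of functions with values in
  \<^typ>\<open>bit\<close>, with the pointwise operations of \<^theory>\<open>HOL-Library.Function_Algebras\<close>.
\<close>

section \<open>Lattices\<close>

definition lattice_M :: "'a::euclidean_space set" where
  "lattice_M = {x. \<forall>b\<in>Basis. x \<bullet> b \<in> \<int>}"

text \<open>The dual of \<open>M \<otimes> \<real>\<close> is identified with \<open>'a\<close> by means of the inner product.\<close>

definition lattice_N :: "'a::euclidean_space set" where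
  "lattice_N = {u. \<forall>x\<in>lattice_M. x \<bullet> u \<in> \<int>}"

text \<open>Elements of \<open>N \<otimes> \<bbbF>\<^sub>2\<close> are given by their coordinates in the basis dual to \<^term>\<open>Basis\<close>;
  \<open>mod2\<close> is the reduction \<open>N \<rightarrow> N \<otimes> \<bbbF>\<^sub>2\<close>.\<close>

definition mod2 :: "'a::euclidean_space \<Rightarrow> 'a \<Rightarrow> bit" where
  "mod2 u = (\<lambda>b. if b \<in> Basis then of_int \<lfloor>u \<bullet> b\<rfloor> else 0)"

definition N2 :: "('a::euclidean_space \<Rightarrow> bit) set" where
  "N2 = mod2 ` lattice_N"

definition pairing :: "'a::euclidean_space \<Rightarrow> ('a \<Rightarrow> bit) \<Rightarrow> bit" where
  "pairing x u = (\<Sum>b\<in>Basis. mod2 x b * u b)"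


section \<open>Triangulations\<close>

text \<open>Simplicial complexes are those of the library: finite sets of geometric simplices, closed
  under passing to faces; in particular the empty simplex belongs to every nonempty complex.\<close>

definition vertices :: "'a::euclidean_space set \<Rightarrow> 'a set" where
  "vertices \<sigma> = {v. v extreme_point_of \<sigma>}"

definition triangulates :: "'a::euclidean_space set set \<Rightarrow> 'a set \<Rightarrow> bool" where
  "triangulates K P \<longleftrightarrow> simplicial_complex K \<and> \<Union>K = P"

text \<open>For full-dimensional \<open>P\<close>, the dimension of the maximal simplices is that of the ambient
  space, and their volume is their Lebesgue measure.\<close>

definition primitive_triangulation :: "'a::euclidean_space set set \<Rightarrow> 'a set \<Rightarrow> bool" where
  "primitive_triangulation K P \<longleftrightarrow>
     triangulates K P \<and>
     (\<forall>\<sigma>\<in>K. vertices \<sigma> \<subseteq> lattice_M) \<and>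
     (\<forall>\<sigma>\<in>K. (\<forall>\<tau>\<in>K. \<sigma> \<subseteq> \<tau> \<longrightarrow> \<tau> = \<sigma>) \<longrightarrow>
        measure lebesgue \<sigma> = 1 / fact DIM('a))"

definition std_simplex :: "nat \<Rightarrow> 'a::euclidean_space set" where
  "std_simplex d = convex hull (insert 0 ((\<lambda>b. real d *\<^sub>R b) ` Basis))"

definition restriction :: "'a::euclidean_space set set \<Rightarrow> 'a set \<Rightarrow> 'a set set" where
  "restriction K Q = {\<sigma>\<in>K. \<sigma> \<subseteq> Q}"

text \<open>Since the empty simplex belongs to both factors, the join contains both of them.\<close>

definition join :: "'a::euclidean_space set set \<Rightarrow> 'a set set \<Rightarrow> 'a set set" where
  "join A B = {convex hull (\<sigma> \<union> \<tau>) | \<sigma> \<tau>. \<sigma> \<in> A \<and> \<tau> \<in> B}"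


section \<open>The operations \<open>K + L'\<close> and \<open>K + (-1)L'\<close>\<close>

text \<open>If \<open>'a\<close> is \<open>\<real>\<^sup>n\<close>, then \<open>'a \<times> real\<close> is \<open>\<real>\<^sup>n\<^sup>+\<^sup>1\<close>, with last coordinate \<^const>\<open>snd\<close> and last
  basis vector \<open>(0, 1)\<close>.  The parameter \<open>e\<close> is the sequence \<open>e\<^sub>0 = 0, e\<^sub>1, \<dots>, e\<^sub>n\<close>, where
  \<open>e\<^sub>1, \<dots>, e\<^sub>n\<close> is an enumeration of the canonical basis.\<close>

definition basis_enum :: "(nat \<Rightarrow> 'a::euclidean_space) \<Rightarrow> bool" where
  "basis_enum e \<longleftrightarrow> e 0 = 0 \<and> bij_betw e {1..DIM('a)} Basis"

definition shift_up :: "('a::euclidean_space \<times> real) set set \<Rightarrow> ('a \<times> real) set set" where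
  "shift_up K = (\<lambda>\<sigma>. (\<lambda>x. x + (0, 1)) ` \<sigma>) ` K"

definition embed :: "'a::euclidean_space set set \<Rightarrow> ('a \<times> real) set set" where
  "embed L = (\<lambda>\<sigma>. (\<lambda>x. (x, 0)) ` \<sigma>) ` L"

definition top_face :: "(nat \<Rightarrow> 'a::euclidean_space) \<Rightarrow> nat \<Rightarrow> nat set \<Rightarrow> ('a \<times> real) set" where
  "top_face e d I = convex hull ((\<lambda>j. (real d *\<^sub>R e j, 1)) ` I)"

definition bottom_face :: "(nat \<Rightarrow> 'a::euclidean_space) \<Rightarrow> nat \<Rightarrow> nat set \<Rightarrow> ('a \<times> real) set" where
  "bottom_face e d I = convex hull ((\<lambda>j. (real (d + 1) *\<^sub>R e j, 0)) ` I)"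

definition is_layered ::
  "(nat \<Rightarrow> 'a::euclidean_space) \<Rightarrow> nat \<Rightarrow> (nat \<Rightarrow> nat set) \<Rightarrow> (nat \<Rightarrow> nat set) \<Rightarrow>
   ('a \<times> real) set set \<Rightarrow> 'a set set \<Rightarrow> ('a \<times> real) set set \<Rightarrow> bool" where
  "is_layered e d I J K L' T \<longleftrightarrow>
     triangulates T (std_simplex (d + 1)) \<and>
     restriction T {x. snd x \<ge> 1} = shift_up K \<and>
     (\<forall>i\<le>DIM('a).
        restriction T (convex hull (top_face e d (I i) \<union> bottom_face e d (J i))) =
        join (restriction (shift_up K) (top_face e d (I i)))
             (restriction (embed L') (bottom_face e d (J i))))"

definition plus_triang ::
  "(nat \<Rightarrow> 'a::euclidean_space) \<Rightarrow> nat \<Rightarrow>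
   ('a \<times> real) set set \<Rightarrow> 'a set set \<Rightarrow> ('a \<times> real) set set" where
  "plus_triang e d K L' = (THE T. is_layered e d (\<lambda>i. {0..i}) (\<lambda>i. {i..DIM('a)}) K L' T)"

definition minus_triang ::
  "(nat \<Rightarrow> 'a::euclidean_space) \<Rightarrow> nat \<Rightarrow>
   ('a \<times> real) set set \<Rightarrow> 'a set set \<Rightarrow> ('a \<times> real) set set" where
  "minus_triang e d K L' = (THE T. is_layered e d (\<lambda>i. {i..DIM('a)}) (\<lambda>i. {0..i}) K L' T)"

text \<open>The value at \<open>d = 0\<close> is irrelevant.\<close>

fun IV :: "(nat \<Rightarrow> 'a::euclidean_space) \<Rightarrow> (nat \<Rightarrow> 'a set set) \<Rightarrow> nat \<Rightarrow> ('a \<times> real) set set" where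
  "IV e L 0 = {}"
| "IV e L (Suc 0) = {F. F face_of std_simplex 1}"
| "IV e L (Suc (Suc k)) =
     (if even (Suc k) then plus_triang e (Suc k) (IV e L (Suc k)) (L (Suc (Suc k)))
      else minus_triang e (Suc k) (IV e L (Suc k)) (L (Suc (Suc k))))"


section \<open>The cell complexes\<close>

text \<open>The closed cell \<open>[\<sigma>, Q]\<close> is represented by the pair \<open>(\<sigma>, Q)\<close>.  A subcomplex is represented
  by its set of cells, and only the face relation and the dimensions of the cells are used.\<close>

type_synonym 'a cell = "'a set \<times> 'a set"

definition cells_Y :: "'a::euclidean_space set \<Rightarrow> 'a set set \<Rightarrow> 'a cell set" where
  "cells_Y P K = {(\<sigma>, Q). \<sigma> \<in> K \<and> \<sigma> \<noteq> {} \<and> Q face_of P \<and> \<sigma> \<subseteq> Q}"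

definition cell_le :: "'a::euclidean_space cell \<Rightarrow> 'a cell \<Rightarrow> bool" where
  "cell_le c' c \<longleftrightarrow> fst c face_of fst c' \<and> snd c' \<subseteq> snd c"

definition cell_dim :: "'a::euclidean_space cell \<Rightarrow> nat" where
  "cell_dim c = nat (aff_dim (snd c) - aff_dim (fst c))"

definition cells_X :: "'a::euclidean_space set \<Rightarrow> 'a set set \<Rightarrow> 'a cell set" where
  "cells_X P K = {c \<in> cells_Y P K. aff_dim (fst c) \<ge> 1}"

definition interior_vertex :: "'a::euclidean_space set \<Rightarrow> 'a set set \<Rightarrow> 'a \<Rightarrow> bool" where
  "interior_vertex P K v \<longleftrightarrow> {v} \<in> K \<and> \<not> {v} \<subseteq> frontier P"

definition dual_cell :: "'a::euclidean_space set \<Rightarrow> 'a set set \<Rightarrow> 'a set \<Rightarrow> 'a cell set" where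
  "dual_cell P K \<sigma> = {c \<in> cells_Y P K. cell_le c (\<sigma>, P)}"

definition boundary_dual_cell :: "'a::euclidean_space set \<Rightarrow> 'a set set \<Rightarrow> 'a set \<Rightarrow> 'a cell set" where
  "boundary_dual_cell P K \<sigma> = dual_cell P K \<sigma> - {(\<sigma>, P)}"

definition cells_X0 :: "'a::euclidean_space set \<Rightarrow> 'a set set \<Rightarrow> 'a cell set" where
  "cells_X0 P K = cells_X P K \<inter> (\<Union>v\<in>{v. interior_vertex P K v}. dual_cell P K {v})"


section \<open>Cellular sheaves and their cohomology\<close>

text \<open>\<open>transition G c' c\<close> is the map \<open>G(c') \<rightarrow> G(c)\<close> for \<open>c' \<le> c\<close>.  The complexes are regular and the
  coefficients have characteristic two, so all incidence numbers are equal to one.  Cochains are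
  extended by zero outside of the cells of the given subcomplex and dimension.\<close>

record ('c, 'v) sheaf =
  stalk :: "'c \<Rightarrow> 'v set"
  transition :: "'c \<Rightarrow> 'c \<Rightarrow> 'v \<Rightarrow> 'v"

definition cochains ::
  "'a::euclidean_space cell set \<Rightarrow> ('a cell, 'v::ab_group_add) sheaf \<Rightarrow> nat \<Rightarrow> ('a cell \<Rightarrow> 'v) set" where
  "cochains X G q = {s. \<forall>c. if c \<in> X \<and> cell_dim c = q then s c \<in> stalk G c else s c = 0}"

definition coboundary ::
  "'a::euclidean_space cell set \<Rightarrow> ('a cell, 'v::ab_group_add) sheaf \<Rightarrow> nat \<Rightarrow>
   ('a cell \<Rightarrow> 'v) \<Rightarrow> 'a cell \<Rightarrow> 'v" where
  "coboundary X G q s =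
     (\<lambda>c. if c \<in> X \<and> cell_dim c = Suc q
          then \<Sum>c'\<in>{c'\<in>X. cell_dim c' = q \<and> cell_le c' c}. transition G c' c (s c')
          else 0)"

definition cocycles ::
  "'a::euclidean_space cell set \<Rightarrow> ('a cell, 'v::ab_group_add) sheaf \<Rightarrow> nat \<Rightarrow> ('a cell \<Rightarrow> 'v) set" where
  "cocycles X G q = {s \<in> cochains X G q. coboundary X G q s = 0}"

definition coboundaries ::
  "'a::euclidean_space cell set \<Rightarrow> ('a cell, 'v::ab_group_add) sheaf \<Rightarrow> nat \<Rightarrow> ('a cell \<Rightarrow> 'v) set" where
  "coboundaries X G q =
     (case q of 0 \<Rightarrow> {0} | Suc p \<Rightarrow> coboundary X G p ` cochains X G p)"

definition cohomologous ::
  "'a::euclidean_space cell set \<Rightarrow> ('a cell, 'v::ab_group_add) sheaf \<Rightarrow> nat \<Rightarrow>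
   (('a cell \<Rightarrow> 'v) \<times> ('a cell \<Rightarrow> 'v)) set" where
  "cohomologous X G q =
     {(s, t). s \<in> cocycles X G q \<and> t \<in> cocycles X G q \<and> s - t \<in> coboundaries X G q}"

definition cohomology ::
  "'a::euclidean_space cell set \<Rightarrow> ('a cell, 'v::ab_group_add) sheaf \<Rightarrow> nat \<Rightarrow>
   ('a cell \<Rightarrow> 'v) set set" where
  "cohomology X G q = cocycles X G q // cohomologous X G q"

definition cohomology_class ::
  "'a::euclidean_space cell set \<Rightarrow> ('a cell, 'v::ab_group_add) sheaf \<Rightarrow> nat \<Rightarrow>
   ('a cell \<Rightarrow> 'v) \<Rightarrow> ('a cell \<Rightarrow> 'v) set" where
  "cohomology_class X G q s = cohomologous X G q `` {s}"

definition restrict_cochain ::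
  "'a::euclidean_space cell set \<Rightarrow> ('a cell \<Rightarrow> 'v::ab_group_add) \<Rightarrow> 'a cell \<Rightarrow> 'v" where
  "restrict_cochain A s = (\<lambda>c. if c \<in> A then s c else 0)"

text \<open>In the next two definitions, the sets over which the unions are taken consist of the possible
  choices of representatives and liftings; the class in the union does not depend on them.\<close>

definition restrict_class ::
  "'a::euclidean_space cell set \<Rightarrow> ('a cell, 'v::ab_group_add) sheaf \<Rightarrow> nat \<Rightarrow>
   ('a cell \<Rightarrow> 'v) set \<Rightarrow> ('a cell \<Rightarrow> 'v) set" where
  "restrict_class A G q h = (\<Union>s\<in>h. cohomology_class A G q (restrict_cochain A s))"

text \<open>The connecting morphism \<open>H\<^sup>q(X; H) \<rightarrow> H\<^sup>q\<^sup>+\<^sup>1(X; F)\<close> of a short exact sequence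
  \<open>0 \<rightarrow> F \<rightarrow> G \<rightarrow> H \<rightarrow> 0\<close>, where \<open>F\<close> is a subsheaf of \<open>G\<close> and \<open>p\<close> is the morphism \<open>G \<rightarrow> H\<close>.\<close>

definition connecting ::
  "'a::euclidean_space cell set \<Rightarrow> ('a cell, 'v::ab_group_add) sheaf \<Rightarrow> ('a cell, 'v) sheaf \<Rightarrow>
   ('a cell \<Rightarrow> 'v \<Rightarrow> 'w::ab_group_add) \<Rightarrow> nat \<Rightarrow>
   ('a cell \<Rightarrow> 'w) set \<Rightarrow> ('a cell \<Rightarrow> 'v) set" where
  "connecting X F G p q h =
     (\<Union>s\<in>h. \<Union>t\<in>{t \<in> cochains X G q. \<forall>c\<in>X. cell_dim c = q \<longrightarrow> p c (t c) = s c}.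
        cohomology_class X F (Suc q) (coboundary X G q t))"


section \<open>Waves, Hessian and uniformity\<close>

definition edges :: "'a::euclidean_space set \<Rightarrow> 'a set set" where
  "edges \<sigma> = {E. E face_of \<sigma> \<and> aff_dim E = 1}"

definition tangent :: "'a::euclidean_space set \<Rightarrow> 'a set" where
  "tangent \<sigma> = span {x - y | x y. x \<in> \<sigma> \<and> y \<in> \<sigma>}"

text \<open>As \<open>(T\<sigma>)\<^sup>\<bottom> \<inter> N\<close> is saturated in \<open>N\<close>, its tensor product with \<open>\<bbbF>\<^sub>2\<close> is its image in
  \<open>N \<otimes> \<bbbF>\<^sub>2\<close>.\<close>

definition W1 :: "('a::euclidean_space cell, 'a \<Rightarrow> bit) sheaf" where
  "W1 = \<lparr>stalk = (\<lambda>c. mod2 ` {u \<in> lattice_N. \<forall>t\<in>tangent (fst c). t \<bullet> u = 0}),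
         transition = (\<lambda>c' c u. u)\<rparr>"

definition N2_sheaf :: "('a::euclidean_space cell, 'a \<Rightarrow> bit) sheaf" where
  "N2_sheaf = \<lparr>stalk = (\<lambda>c. N2), transition = (\<lambda>c' c u. u)\<rparr>"

text \<open>Simplicial \<open>1\<close>-cochains of a simplex are functions on its edges, extended by zero to all
  sets.\<close>

definition restrict_to_edges ::
  "'a::euclidean_space set \<Rightarrow> ('a set \<Rightarrow> bit) \<Rightarrow> 'a set \<Rightarrow> bit" where
  "restrict_to_edges \<sigma> f = (\<lambda>E. if E \<in> edges \<sigma> then f E else 0)"

definition simplicial_Z1 :: "'a::euclidean_space set \<Rightarrow> ('a set \<Rightarrow> bit) set" where
  "simplicial_Z1 \<sigma> =
     {f. (\<forall>E. E \<notin> edges \<sigma> \<longrightarrow> f E = 0) \<and>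
         (\<forall>T. T face_of \<sigma> \<and> aff_dim T = 2 \<longrightarrow> (\<Sum>E\<in>edges T. f E) = 0)}"

definition Z1_sheaf :: "('a::euclidean_space cell, 'a set \<Rightarrow> bit) sheaf" where
  "Z1_sheaf = \<lparr>stalk = (\<lambda>c. simplicial_Z1 (fst c)),
               transition = (\<lambda>c' c. restrict_to_edges (fst c))\<rparr>"

text \<open>For an edge with endpoints \<open>v\<^sub>0, v\<^sub>1\<close>, this is \<open>\<epsilon>(v\<^sub>0) - \<epsilon>(v\<^sub>1)\<close>, which equals
  \<open>\<epsilon>(v\<^sub>0) + \<epsilon>(v\<^sub>1)\<close> in \<open>\<bbbF>\<^sub>2\<close>.\<close>

definition simplicial_d :: "('a::euclidean_space \<Rightarrow> bit) \<Rightarrow> 'a set \<Rightarrow> bit" where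
  "simplicial_d \<epsilon> E = (\<Sum>v\<in>vertices E. \<epsilon> v)"

text \<open>For an edge with endpoints \<open>v\<^sub>0, v\<^sub>1 \<in> M\<close> this map takes the value
  \<open>\<langle>v\<^sub>0, u\<rangle> - \<langle>v\<^sub>1, u\<rangle> = \<langle>v\<^sub>0 - v\<^sub>1, u\<rangle>\<close>.\<close>

definition z_map :: "'a::euclidean_space cell \<Rightarrow> ('a \<Rightarrow> bit) \<Rightarrow> 'a set \<Rightarrow> bit" where
  "z_map c u = restrict_to_edges (fst c) (simplicial_d (\<lambda>v. pairing v u))"

text \<open>A \<open>0\<close>-cochain of \<open>K\<close> is given by a function on the ambient space, of which only the values at
  the vertices of \<open>K\<close> matter.  A section of a cellular sheaf is determined by its values on the
  \<open>0\<close>-cells.\<close>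

definition d_section ::
  "'a::euclidean_space set \<Rightarrow> 'a set set \<Rightarrow> ('a \<Rightarrow> bit) \<Rightarrow> 'a cell \<Rightarrow> 'a set \<Rightarrow> bit" where
  "d_section P K \<epsilon> = (\<lambda>c. if c \<in> cells_X P K \<and> cell_dim c = 0
                          then restrict_to_edges (fst c) (simplicial_d \<epsilon>) else 0)"

definition hessian ::
  "'a::euclidean_space set \<Rightarrow> 'a set set \<Rightarrow> ('a \<Rightarrow> bit) \<Rightarrow> ('a cell \<Rightarrow> 'a \<Rightarrow> bit) set" where
  "hessian P K \<epsilon> =
     connecting (cells_X P K) W1 N2_sheaf z_map 0
       (cohomology_class (cells_X P K) Z1_sheaf 0 (d_section P K \<epsilon>))"

definition vertex_indicator :: "'a::euclidean_space \<Rightarrow> 'a \<Rightarrow> bit" where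
  "vertex_indicator v = (\<lambda>w. if w = v then 1 else 0)"

definition rho_uniform :: "'a::euclidean_space set \<Rightarrow> 'a set set \<Rightarrow> bool" where
  "rho_uniform P K \<longleftrightarrow>
     (\<exists>\<rho>\<in>cohomology (cells_X0 P K) W1 1. \<forall>v. interior_vertex P K v \<longrightarrow>
        restrict_class (boundary_dual_cell P K {v}) W1 1 \<rho> =
        restrict_class (boundary_dual_cell P K {v}) W1 1 (hessian P K (vertex_indicator v)))"

end

theory Submission
  imports Defs
begin

text \<open>
  Near an interior vertex all cells have the form \<open>(\<sigma>, P)\<close>, and waves vanish on simplices of full
  dimension.  So there are no coboundaries there, and a class in \<open>H\<^sup>1\<close> is just a function on the
  codimension one simplices \<open>F\<close> with an interior vertex.  If \<open>a\<close> and \<open>b\<close> are the vertices opposite to \<open>F\<close> in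
  the two facets around it, then \<open>a + b\<close> is an integral combination of the vertices of \<open>F\<close>, and the value
  of \<open>\<nabla>\<^sup>2\<chi>\<^sub>v\<close> at \<open>F\<close> is the parity of the coefficient of \<open>v\<close>.  Hence a unimodular triangulation is
  \<open>\<rho>\<close>-uniform if and only if, for every \<open>F\<close>, the coefficients of all interior vertices of \<open>F\<close> have the same
  parity (\<open>rho_uniform_iff\<close>); the cocycle condition is inherited from the Hessians.  That the Hessian exists
  at all rests on two facts on the cell structure: there are two \<open>0\<close>-cells below every \<open>1\<close>-cell
  (\<open>card_0_cells\<close>, from the geometry around \<open>F\<close>) and two \<open>1\<close>-cells between incident \<open>0\<close>- and \<open>2\<close>-cells
  (\<open>card_1_cells_between\<close>).  Primitive triangulations are unimodular because a lattice simplex of minimal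
  volume is a fundamental simplex of the lattice (\<open>primitive_triangulation_unimodular\<close>).

  The triangulation \<open>IV\<^sub>d(L)\<close> consists of slabs between copies of \<open>L\<^sub>c\<close> and \<open>L\<^sub>c\<^sub>+\<^sub>1\<close>.  A slab is divided into the
  cells of a staircase, which are joins of faces of its two simplices, and each cell is triangulated by
  joins (\<open>layered_triangulates\<close>, \<open>the_layered\<close>).  A vertex interior to the upper simplex of a slab only occurs
  in the cell that joins the whole upper simplex with one lower vertex, and conversely.  So a codimension one
  simplex \<open>F\<close> with an interior vertex is of one of two kinds.  Either \<open>F\<close> is a cone over a codimension one
  simplex of some \<open>L\<^sub>c\<close>, with the same coefficients.  Or \<open>F\<close> is a simplex of full dimension of some \<open>L\<^sub>c\<close>, on the
  interface of two slabs.  Then the alternation of signs matters: the opposite vertices above and below are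
  \<open>(c - 1) e\<^sub>i\<close> and \<open>(c + 1) e\<^sub>i\<close> with the same \<open>i\<close>, their sum is twice a lattice point of the
  interface, and all coefficients are even.  So the parity condition for \<open>IV\<^sub>d(L)\<close> is the one for the
  triangulations \<open>L\<^sub>c\<close> with \<open>c < d\<close>.
\<close>

text \<open>The default simplification rules for \<^typ>\<open>bit\<close> turn sums into Boolean expressions, which is
  unhelpful for linear algebra over \<open>\<bbbF>\<^sub>2\<close>.\<close>

declare add_bit_eq_xor [simp del] mult_bit_eq_and [simp del]
  bit_not_one_iff [simp del] bit_not_zero_iff [simp del]


section \<open>Lattice points and reduction modulo two\<close>

lemma inner_Ints_lattice:
  assumes "x \<in> lattice_M" "u \<in> lattice_M"
  shows "x \<bullet> u \<in> \<int>"
proof -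
  have "x \<bullet> u = (\<Sum>b\<in>Basis. (x \<bullet> b) * (u \<bullet> b))" by (rule euclidean_inner)
  also have "\<dots> \<in> \<int>" using assms by (intro Ints_sum Ints_mult) (simp_all add: lattice_M_def)
  finally show ?thesis .
qed

lemma lattice_N_eq: "lattice_N = lattice_M"
proof (intro subset_antisym subsetI)
  fix u :: 'a assume u: "u \<in> lattice_N"
  have "u \<bullet> b \<in> \<int>" if "b \<in> Basis" for b
  proof -
    have "b \<in> lattice_M" using that by (auto simp: lattice_M_def inner_Basis)
    then show ?thesis using u by (auto simp: lattice_N_def inner_commute)
  qed
  then show "u \<in> lattice_M" by (simp add: lattice_M_def)
next
  fix u :: 'a assume "u \<in> lattice_M"
  then show "u \<in> lattice_N" by (simp add: lattice_N_def inner_Ints_lattice)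
qed

lemma lattice_N_iff: "u \<in> lattice_N \<longleftrightarrow> (\<forall>b\<in>Basis. u \<bullet> b \<in> \<int>)"
  by (simp add: lattice_N_eq lattice_M_def)

lemma inner_lattice: "x \<in> lattice_M \<Longrightarrow> u \<in> lattice_N \<Longrightarrow> x \<bullet> u \<in> \<int>"
  by (simp add: lattice_N_def)

lemma lattice_M_0 [simp]: "0 \<in> lattice_M"
  by (simp add: lattice_M_def)

lemma lattice_M_Basis: "b \<in> Basis \<Longrightarrow> b \<in> lattice_M"
  by (auto simp: lattice_M_def inner_Basis)

lemma lattice_M_add: "x \<in> lattice_M \<Longrightarrow> y \<in> lattice_M \<Longrightarrow> x + y \<in> lattice_M"
  by (simp add: lattice_M_def inner_add_left)

lemma lattice_M_diff: "x \<in> lattice_M \<Longrightarrow> y \<in> lattice_M \<Longrightarrow> x - y \<in> lattice_M"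
  by (simp add: lattice_M_def inner_diff_left)

lemma lattice_M_scale: "x \<in> lattice_M \<Longrightarrow> r \<in> \<int> \<Longrightarrow> r *\<^sub>R x \<in> lattice_M"
  by (simp add: lattice_M_def Ints_mult)

lemma lattice_M_sum: "(\<And>i. i \<in> I \<Longrightarrow> f i \<in> lattice_M) \<Longrightarrow> sum f I \<in> lattice_M"
  by (auto simp: lattice_M_def inner_sum_left intro!: Ints_sum)

lemmas lattice_N_0 = lattice_M_0[folded lattice_N_eq]
  and lattice_N_add = lattice_M_add[folded lattice_N_eq]
  and lattice_N_scale = lattice_M_scale[folded lattice_N_eq]
  and lattice_N_sum = lattice_M_sum[folded lattice_N_eq]

definition parity :: "real \<Rightarrow> bit" where
  "parity r = of_int \<lfloor>r\<rfloor>"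

lemma parity_add: "r \<in> \<int> \<Longrightarrow> s \<in> \<int> \<Longrightarrow> parity (r + s) = parity r + parity s"
  by (auto simp: parity_def elim!: Ints_cases)

lemma parity_of_int: "parity (of_int m) = of_int m"
  by (simp add: parity_def)

lemma parity_mult: "r \<in> \<int> \<Longrightarrow> s \<in> \<int> \<Longrightarrow> parity (r * s) = parity r * parity s"
proof (elim Ints_cases)
  fix m n assume "r = of_int m" "s = of_int n"
  then have "parity (r * s) = parity (of_int (m * n))" by (simp only: of_int_mult)
  also have "\<dots> = of_int m * of_int n" by (simp only: parity_of_int) simp
  finally show ?thesis by (simp only: \<open>r = of_int m\<close> \<open>s = of_int n\<close> parity_of_int)
qed

lemma parity_0 [simp]: "parity 0 = 0" and parity_1 [simp]: "parity 1 = 1"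
  by (simp_all add: parity_def)

lemma bit_add_self [simp]: "(a::bit) + a = 0"
  by (cases a) auto

lemma bit_add_eq_0_iff: "(a::bit) + b = 0 \<longleftrightarrow> a = b"
  by (cases a; cases b) auto

lemma fun_bit_add_self [simp]: "(f::'c \<Rightarrow> bit) + f = 0"
  by (simp add: fun_eq_iff)

lemma fun_bit_add_eq_0_iff: "(f::'c \<Rightarrow> bit) + g = 0 \<longleftrightarrow> f = g"
  by (simp add: fun_eq_iff bit_add_eq_0_iff)

lemma sum_fun_apply: "sum f A x = (\<Sum>a\<in>A. f a x)"
  by (induction A rule: infinite_finite_induct) auto

lemma bit_of_int_eq_0_iff: "(of_int m :: bit) = 0 \<longleftrightarrow> even m"
proof -
  have "(of_int (2 * j) :: bit) = 0" "(of_int (2 * j + 1) :: bit) = 1" for j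
    by (simp_all)
  then show ?thesis by (metis evenE oddE zero_neq_one)
qed

lemma parity_eq_0_iff: "r \<in> \<int> \<Longrightarrow> parity r = 0 \<longleftrightarrow> r / 2 \<in> \<int>"
proof (elim Ints_cases)
  fix m assume r: "r = of_int m"
  have "(of_int m / 2 :: real) \<in> \<int> \<longleftrightarrow> even m"
  proof
    assume "(of_int m / 2 :: real) \<in> \<int>"
    then obtain j where "of_int m / 2 = (of_int j :: real)" by (elim Ints_cases)
    then have "of_int m = (of_int (2 * j) :: real)" by simp
    then show "even m" by (metis dvd_triv_left of_int_eq_iff)
  next
    assume "even m"
    then show "(of_int m / 2 :: real) \<in> \<int>" by (elim evenE) simp
  qed
  then show ?thesis by (simp add: r parity_def bit_of_int_eq_0_iff)
qed

lemma parity_sum: "(\<And>i. i \<in> I \<Longrightarrow> f i \<in> \<int>) \<Longrightarrow> parity (sum f I) = (\<Sum>i\<in>I. parity (f i))"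
  by (induction I rule: infinite_finite_induct) (simp_all add: parity_add Ints_sum)

lemma mod2_eq: "mod2 u = (\<lambda>b. if b \<in> Basis then parity (u \<bullet> b) else 0)"
  by (auto simp: mod2_def parity_def fun_eq_iff)

lemma pairing_mod2:
  assumes "x \<in> lattice_M" "u \<in> lattice_N"
  shows "pairing x (mod2 u) = parity (x \<bullet> u)"
proof -
  have "parity (x \<bullet> u) = (\<Sum>b\<in>Basis. parity ((x \<bullet> b) * (u \<bullet> b)))"
    unfolding euclidean_inner[of x u] using assms
    by (intro parity_sum Ints_mult) (simp_all add: lattice_M_def lattice_N_iff)
  also have "\<dots> = pairing x (mod2 u)"
    using assms by (auto simp: pairing_def mod2_eq parity_mult lattice_M_def lattice_N_iff
        intro!: sum.cong)
  finally show ?thesis by simp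
qed

lemma mod2_add: "u \<in> lattice_N \<Longrightarrow> v \<in> lattice_N \<Longrightarrow> mod2 (u + v) = mod2 u + mod2 v"
  by (auto simp: mod2_eq fun_eq_iff lattice_N_iff inner_add_left parity_add)

lemma mod2_0 [simp]: "mod2 0 = 0"
  by (auto simp: mod2_eq)

lemma N2_0 [simp]: "0 \<in> N2"
  unfolding N2_def by (rule image_eqI[of _ _ 0]) (simp_all add: lattice_N_0)

lemma N2_add: "u \<in> N2 \<Longrightarrow> v \<in> N2 \<Longrightarrow> u + v \<in> N2"
  unfolding N2_def by (auto simp: mod2_add[symmetric] lattice_N_add)

lemma N2_sum: "(\<And>i. i \<in> I \<Longrightarrow> f i \<in> N2) \<Longrightarrow> sum f I \<in> N2"
  by (induction I rule: infinite_finite_induct) (auto simp: N2_add)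

lemma pairing_add_left:
  "x \<in> lattice_M \<Longrightarrow> y \<in> lattice_M \<Longrightarrow> pairing (x + y) u = pairing x u + pairing y u"
  by (auto simp: pairing_def mod2_eq lattice_M_def inner_add_left parity_add
      distrib_right sum.distrib)

lemma pairing_add_right: "pairing x (u + v) = pairing x u + pairing x v"
  by (simp add: pairing_def distrib_left sum.distrib)

lemma pairing_0_right [simp]: "pairing x 0 = 0"
  by (simp add: pairing_def)

lemma pairing_sum_right: "pairing x (sum f I) = (\<Sum>i\<in>I. pairing x (f i))"
  by (induction I rule: infinite_finite_induct)
    (simp_all only: sum.infinite sum.empty sum.insert pairing_add_right pairing_0_right not_False_eq_True)

lemma pairing_Basis: "b \<in> Basis \<Longrightarrow> pairing b u = u b"
proof -
  assume "b \<in> Basis"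
  then have "pairing b u = (\<Sum>c\<in>Basis. if c = b then u b else 0)"
    unfolding pairing_def mod2_eq by (intro sum.cong) (auto simp: inner_Basis)
  then show ?thesis using \<open>b \<in> Basis\<close> by simp
qed

lemma N2_eqI:
  assumes "u \<in> N2" "v \<in> N2" "\<And>x. x \<in> lattice_M \<Longrightarrow> pairing x u = pairing x v"
  shows "u = v"
proof
  fix b
  show "u b = v b"
  proof (cases "b \<in> Basis")
    case True
    then show ?thesis using assms(3)[of b] by (simp add: lattice_M_Basis pairing_Basis)
  next
    case False
    then show ?thesis using assms(1,2) by (auto simp: N2_def mod2_def)
  qed
qed


section \<open>Simplices and their vertices\<close>

lemma vertices_convex_hull: "\<not> affine_dependent C \<Longrightarrow> vertices (convex hull C) = C"
  by (simp add: vertices_def extreme_point_of_convex_hull_affine_independent)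

lemma vertices_empty [simp]: "vertices {} = {}"
  by (simp add: vertices_def extreme_point_of_def)

lemma vertices_subset: "vertices \<sigma> \<subseteq> \<sigma>"
  by (auto simp: vertices_def extreme_point_of_def)

lemma vertices_face_eq: "F face_of \<sigma> \<Longrightarrow> vertices F = vertices \<sigma> \<inter> F"
  by (auto simp: vertices_def extreme_point_of_face)

lemma simplex_vertices:
  assumes "k simplex \<sigma>"
  shows "\<not> affine_dependent (vertices \<sigma>)" "finite (vertices \<sigma>)"
    "convex hull (vertices \<sigma>) = \<sigma>" "int (card (vertices \<sigma>)) = k + 1" "aff_dim \<sigma> = k"
proof -
  obtain C where C: "\<not> affine_dependent C" "int (card C) = k + 1" "\<sigma> = convex hull C"
    using assms by (auto simp: simplex_def)
  then have "vertices \<sigma> = C" by (simp add: vertices_convex_hull)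
  with C show "\<not> affine_dependent (vertices \<sigma>)" "finite (vertices \<sigma>)"
    "convex hull (vertices \<sigma>) = \<sigma>" "int (card (vertices \<sigma>)) = k + 1"
    by (auto simp: aff_independent_finite)
  show "aff_dim \<sigma> = k" using assms by (rule aff_dim_simplex)
qed

lemma simplex_face_iff:
  assumes "k simplex \<sigma>"
  shows "F face_of \<sigma> \<longleftrightarrow> (\<exists>c\<subseteq>vertices \<sigma>. F = convex hull c)"
  using simplex_vertices(1,3)[OF assms] face_of_convex_hull_affine_independent by metis

lemma vertices_hull_subset:
  "k simplex \<sigma> \<Longrightarrow> c \<subseteq> vertices \<sigma> \<Longrightarrow> vertices (convex hull c) = c"
  by (meson affine_independent_subset simplex_vertices(1) vertices_convex_hull)

text \<open>Faces of a fixed simplex are determined by their vertices, and conversely.\<close>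

lemma simplex_face_iff_vertices:
  assumes "k simplex \<sigma>" "l simplex \<tau>"
  shows "\<tau> face_of \<sigma> \<longleftrightarrow> vertices \<tau> \<subseteq> vertices \<sigma>"
proof
  assume "\<tau> face_of \<sigma>"
  then show "vertices \<tau> \<subseteq> vertices \<sigma>" by (simp add: vertices_face_eq)
next
  assume "vertices \<tau> \<subseteq> vertices \<sigma>"
  then show "\<tau> face_of \<sigma>"
    using simplex_vertices(3)[OF assms(2)] simplex_face_iff[OF assms(1)] by metis
qed

lemma simplex_face:
  assumes "k simplex \<sigma>" "F face_of \<sigma>"
  shows "\<exists>l. l simplex F"
proof -
  obtain c where c: "c \<subseteq> vertices \<sigma>" "F = convex hull c"
    using assms simplex_face_iff by blast
  then have "\<not> affine_dependent c"
    using affine_independent_subset simplex_vertices(1)[OF assms(1)] by blast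
  then have "(int (card c) - 1) simplex F"
    using c by (auto simp: simplex_def)
  then show ?thesis by blast
qed

lemma simplex_card: "k simplex \<sigma> \<Longrightarrow> aff_dim \<sigma> = int (card (vertices \<sigma>)) - 1"
  using simplex_vertices(4,5) by fastforce

lemma finite_simplex_faces: "k simplex \<sigma> \<Longrightarrow> finite {F. F face_of \<sigma>}"
  by (simp add: finite_polytope_faces simplex_imp_polytope)

lemma triangulates_simplex: "triangulates K P \<Longrightarrow> \<sigma> \<in> K \<Longrightarrow> \<exists>k. k simplex \<sigma>"
  by (auto simp: triangulates_def simplicial_complex_def)

lemma triangulates_face: "triangulates K P \<Longrightarrow> \<sigma> \<in> K \<Longrightarrow> F face_of \<sigma> \<Longrightarrow> F \<in> K"
  by (auto simp: triangulates_def simplicial_complex_def)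

lemma triangulates_Int:
  assumes "triangulates K P" "\<sigma> \<in> K" "\<tau> \<in> K"
  shows "\<sigma> \<inter> \<tau> face_of \<sigma>" "\<sigma> \<inter> \<tau> face_of \<tau>" "\<sigma> \<inter> \<tau> \<in> K"
proof -
  show face: "\<sigma> \<inter> \<tau> face_of \<sigma>"
    using assms by (auto simp: triangulates_def simplicial_complex_def)
  have "\<tau> \<inter> \<sigma> face_of \<tau>" using assms by (auto simp: triangulates_def simplicial_complex_def)
  then show "\<sigma> \<inter> \<tau> face_of \<tau>" by (simp add: Int_commute)
  from face show "\<sigma> \<inter> \<tau> \<in> K" using assms triangulates_face by blast
qed

lemma triangulates_finite: "triangulates K P \<Longrightarrow> finite K"
  by (auto simp: triangulates_def simplicial_complex_def)

lemma triangulates_subset: "triangulates K P \<Longrightarrow> \<sigma> \<in> K \<Longrightarrow> \<sigma> \<subseteq> P"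
  by (auto simp: triangulates_def)

lemma triangulates_vertices_Int:
  assumes "triangulates K P" "\<sigma> \<in> K" "\<tau> \<in> K"
  shows "vertices (\<sigma> \<inter> \<tau>) = vertices \<sigma> \<inter> vertices \<tau>"
  using vertices_face_eq[OF triangulates_Int(1)[OF assms]]
    vertices_face_eq[OF triangulates_Int(2)[OF assms]] vertices_subset[of \<sigma>] vertices_subset[of \<tau>]
  by blast

lemma triangulates_face_iff:
  assumes "triangulates K P" "\<sigma> \<in> K" "\<tau> \<in> K"
  shows "\<sigma> face_of \<tau> \<longleftrightarrow> \<sigma> \<subseteq> \<tau>"
  using triangulates_Int(2)[OF assms] by (metis face_of_imp_subset inf.absorb1)

lemma triangulates_vertex_face:
  assumes "triangulates K P" "\<sigma> \<in> K" "v \<in> vertices \<sigma>"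
  shows "{v} face_of \<sigma>" "{v} \<in> K"
proof -
  show "{v} face_of \<sigma>" using assms(3) by (simp add: vertices_def face_of_singleton)
  then show "{v} \<in> K" by (rule triangulates_face[OF assms(1,2)])
qed

lemma triangulates_eqI:
  assumes "triangulates K P" "\<sigma> \<in> K" "\<tau> \<in> K" "vertices \<sigma> = vertices \<tau>"
  shows "\<sigma> = \<tau>"
  using assms triangulates_simplex[OF assms(1)] simplex_vertices(3) by metis

lemma triangulates_Int_face:
  assumes K: "triangulates K P" and Q: "Q face_of P" and \<sigma>: "\<sigma> \<in> K"
  shows "\<sigma> \<inter> Q \<in> K"
proof -
  have "convex \<sigma>" using triangulates_simplex[OF K \<sigma>] convex_simplex by blast
  then have "Q \<inter> \<sigma> face_of P \<inter> \<sigma>" by (rule face_of_slice[OF Q])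
  then have "\<sigma> \<inter> Q face_of \<sigma>"
    using triangulates_subset[OF K \<sigma>] by (simp add: Int_absorb1 Int_commute)
  then show ?thesis by (rule triangulates_face[OF K \<sigma>])
qed

lemma triangulates_face_cover:
  assumes K: "triangulates K P" and Q: "Q face_of P" and x: "x \<in> Q"
  shows "\<exists>\<sigma>\<in>K. x \<in> \<sigma> \<and> \<sigma> \<subseteq> Q"
proof -
  have "x \<in> \<Union>K" using x K face_of_imp_subset[OF Q] by (auto simp: triangulates_def)
  then obtain \<sigma> where "\<sigma> \<in> K" "x \<in> \<sigma>" by blast
  then show ?thesis using triangulates_Int_face[OF K Q] x by blast
qed

text \<open>A triangulation is determined by any subset that covers: a simplex has a relative interior point
  in some simplex of the subset, and is then a face of it.\<close>

lemma triangulation_eq_of_cover: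
  assumes T: "triangulates T P" and S: "triangulates S P" and sub: "S \<subseteq> T" "P \<noteq> {}"
  shows "T = S"
proof (intro subset_antisym subsetI)
  fix \<omega> assume \<omega>: "\<omega> \<in> T"
  show "\<omega> \<in> S"
  proof (cases "\<omega> = {}")
    case True
    have "S \<noteq> {}" using S sub(2) by (auto simp: triangulates_def)
    then show ?thesis using True triangulates_face[OF S] empty_face_of by blast
  next
    case False
    have "convex \<omega>" using triangulates_simplex[OF T \<omega>] convex_simplex by blast
    then obtain x where x: "x \<in> rel_interior \<omega>" using False rel_interior_eq_empty by blast
    then have "x \<in> \<omega>" using rel_interior_subset by blast
    then have "x \<in> \<Union>S" using triangulates_subset[OF T \<omega>] S by (auto simp: triangulates_def)
    then obtain s where s: "s \<in> S" "x \<in> s" by blast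
    then have sT: "s \<in> T" using sub(1) by blast
    have "\<omega> \<subseteq> \<omega> \<inter> s"
      using subset_of_face_of[OF triangulates_Int(1)[OF T \<omega> sT] subset_refl] x \<open>x \<in> \<omega>\<close> s(2) by blast
    then have "\<omega> \<inter> s = \<omega>" by blast
    then have "\<omega> face_of s" using triangulates_Int(2)[OF T \<omega> sT] by simp
    then show ?thesis by (rule triangulates_face[OF S s(1)])
  qed
qed (use sub in auto)


section \<open>Unimodular simplices\<close>

text \<open>The vertices of a lattice simplex are part of an affine basis of the lattice if and only if every
  integral function on them is the restriction of an integral affine function.  In this form the
  property makes sense in every dimension, passes to faces, and can be glued along joins.\<close>

definition extends_int :: "'a::euclidean_space set \<Rightarrow> bool" where
  "extends_int V \<longleftrightarrow> (\<forall>\<epsilon>. (\<forall>a\<in>V. \<epsilon> a \<in> \<int>) \<longrightarrow> (\<exists>u\<in>lattice_N. \<exists>k\<in>\<int>. \<forall>a\<in>V. a \<bullet> u + k = \<epsilon> a))"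

definition unimodular :: "'a::euclidean_space set \<Rightarrow> bool" where
  "unimodular \<sigma> \<longleftrightarrow> vertices \<sigma> \<subseteq> lattice_M \<and> extends_int (vertices \<sigma>)"

lemma extends_intE:
  assumes "extends_int V" "\<And>a. a \<in> V \<Longrightarrow> \<epsilon> a \<in> \<int>"
  obtains u k where "u \<in> lattice_N" "k \<in> \<int>" "\<And>a. a \<in> V \<Longrightarrow> a \<bullet> u + k = \<epsilon> a"
  using assms unfolding extends_int_def by metis

lemma extends_int_subset:
  assumes "extends_int V" "W \<subseteq> V"
  shows "extends_int W"
  unfolding extends_int_def
proof (intro allI impI)
  fix \<epsilon> :: "'a \<Rightarrow> real" assume e: "\<forall>a\<in>W. \<epsilon> a \<in> \<int>"
  obtain u k where "u \<in> lattice_N" "k \<in> \<int>"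
    "\<And>a. a \<in> V \<Longrightarrow> a \<bullet> u + k = (if a \<in> W then \<epsilon> a else 0)"
    by (rule extends_intE[OF assms(1), of "\<lambda>a. if a \<in> W then \<epsilon> a else 0"]) (use e in auto)
  then show "\<exists>u\<in>lattice_N. \<exists>k\<in>\<int>. \<forall>a\<in>W. a \<bullet> u + k = \<epsilon> a"
    using assms(2) by (intro bexI[of _ u] bexI[of _ k]) auto
qed

lemma unimodular_face: "unimodular \<sigma> \<Longrightarrow> F face_of \<sigma> \<Longrightarrow> unimodular F"
  unfolding unimodular_def using extends_int_subset[of "vertices \<sigma>" "vertices F"]
  by (auto simp: vertices_face_eq)

lemma extends_int_affine_independent:
  assumes "finite V" "extends_int V"
  shows "\<not> affine_dependent V"
proof
  assume "affine_dependent V"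
  then obtain c v where c: "sum c V = 0" "v \<in> V" "c v \<noteq> 0" "(\<Sum>a\<in>V. c a *\<^sub>R a) = 0"
    using affine_dependent_explicit_finite[OF assms(1)] by blast
  obtain u k where u: "\<And>a. a \<in> V \<Longrightarrow> a \<bullet> u + k = (if a = v then 1 else 0)"
    by (rule extends_intE[OF assms(2), of "\<lambda>a. if a = v then 1 else 0"]) auto
  have "0 = (\<Sum>a\<in>V. c a *\<^sub>R a) \<bullet> u + sum c V * k" using c by simp
  also have "\<dots> = (\<Sum>a\<in>V. c a * (a \<bullet> u + k))"
    by (simp add: inner_sum_left sum_distrib_right distrib_left sum.distrib)
  also have "\<dots> = (\<Sum>a\<in>V. if a = v then c v else 0)"
    by (intro sum.cong) (auto simp: u)
  also have "\<dots> = c v" using c(2) assms(1) by simp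
  finally show False using c(3) by simp
qed


section \<open>Facets of a triangulation around a codimension one simplex\<close>

lemma affine_ray_mem:
  assumes "affine A" "x \<in> A" "x + t *\<^sub>R u \<in> A" "t \<noteq> 0"
  shows "x + s *\<^sub>R u \<in> A"
proof -
  have "(1 - s / t) *\<^sub>R x + (s / t) *\<^sub>R (x + t *\<^sub>R u) \<in> A"
    using assms by (intro mem_affine) auto
  also have "(1 - s / t) *\<^sub>R x + (s / t) *\<^sub>R (x + t *\<^sub>R u) = x + s *\<^sub>R u"
    using assms(4) by (simp add: algebra_simps)
  finally show ?thesis .
qed

lemma affine_hull_insert_ray:
  fixes x :: "'a::euclidean_space"
  assumes "x \<in> F" "w \<in> affine hull (insert (x + u) F)"
  shows "\<exists>k. w - k *\<^sub>R u \<in> affine hull F"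
proof -
  let ?D = "(\<lambda>y. - x + y) ` F"
  have "affine hull (insert (x + u) F) = (\<lambda>y. x + y) ` span ((\<lambda>y. - x + y) ` insert (x + u) F)"
    using assms(1) by (intro affine_hull_span_gen) (simp add: hull_inc)
  also have "(\<lambda>y. - x + y) ` insert (x + u) F = insert u ?D" by simp
  finally obtain y where y: "w = x + y" "y \<in> span (insert u ?D)" using assms(2) by auto
  then obtain k where k: "y - k *\<^sub>R u \<in> span ?D" by (auto simp: span_breakdown_eq)
  have "affine hull F = (\<lambda>y. x + y) ` span ?D"
    using assms(1) by (intro affine_hull_span_gen) (simp add: hull_inc)
  with k have "x + (y - k *\<^sub>R u) \<in> affine hull F" by blast
  then show ?thesis using y(1) by (intro exI[of _ k]) (simp add: algebra_simps)
qed

lemma aff_dim_ge_Suc: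
  fixes F :: "'a::euclidean_space set"
  assumes "F \<subseteq> \<tau>" "y \<in> \<tau>" "y \<notin> affine hull F"
  shows "aff_dim \<tau> \<ge> aff_dim F + 1"
  using aff_dim_subset[of "insert y F" \<tau>] assms by (simp add: aff_dim_insert)

text \<open>Only the finitely many simplices through \<open>x\<close> matter near \<open>x\<close>, so a short segment from \<open>x\<close>
  into \<open>Q\<close> runs inside one simplex that contains \<open>F\<close>.\<close>

lemma ex_facet_in_direction:
  fixes K :: "'a::euclidean_space set set"
  assumes K: "triangulates K P" and Q: "Q face_of P" "convex P"
    and F: "F \<in> K" "F \<subseteq> Q" "x \<in> rel_interior F" "aff_dim Q = aff_dim F + 1"
    and u: "t0 > 0" "x + t0 *\<^sub>R u \<in> Q" "x + u \<notin> affine hull F"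
  shows "\<exists>\<tau>\<in>K. F \<subseteq> \<tau> \<and> \<tau> \<subseteq> Q \<and> aff_dim \<tau> = aff_dim Q \<and> (\<exists>t>0. x + t *\<^sub>R u \<in> \<tau>)"
proof -
  define U where "U = - \<Union>{\<rho>\<in>K. x \<notin> \<rho>}"
  have "closed \<rho>" if "\<rho> \<in> K" for \<rho>
    using triangulates_simplex[OF K that] closed_simplex by blast
  then have "open U"
    unfolding U_def using triangulates_finite[OF K] by (intro open_Compl closed_Union) auto
  moreover have "x \<in> U" by (auto simp: U_def)
  ultimately obtain \<delta> where \<delta>: "\<delta> > 0" "ball x \<delta> \<subseteq> U" by (meson openE)
  define t where "t = min t0 (\<delta> / (2 * (norm u + 1)))"
  have "norm u + 1 > 0" by (rule add_nonneg_pos) auto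
  then have t: "t > 0" "t \<le> t0" using u(1) \<delta>(1) by (auto simp: t_def)
  have "t * norm u < t * (2 * (norm u + 1))"
    using t(1) \<open>norm u + 1 > 0\<close> by (intro mult_strict_left_mono) auto
  also have "t \<le> \<delta> / (2 * (norm u + 1))" by (simp add: t_def)
  then have "t * (2 * (norm u + 1)) \<le> \<delta>"
    using \<open>norm u + 1 > 0\<close> by (subst (asm) pos_le_divide_eq) auto
  finally have "x + t *\<^sub>R u \<in> U" using \<delta>(2) t(1) by (auto simp: dist_norm subset_iff)
  have xF: "x \<in> F" using F(3) rel_interior_subset by blast
  have "convex Q" using Q by (simp add: face_of_imp_convex)
  then have "(1 - t / t0) *\<^sub>R x + (t / t0) *\<^sub>R (x + t0 *\<^sub>R u) \<in> Q"
    using xF F(2) u t by (intro convexD_alt[of Q]) (auto simp: subset_iff)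
  then have yQ: "x + t *\<^sub>R u \<in> Q" using u(1) by (simp add: algebra_simps)
  then have "x + t *\<^sub>R u \<in> \<Union>K" using Q(1) K face_of_imp_subset by (auto simp: triangulates_def)
  then obtain \<sigma> where \<sigma>: "\<sigma> \<in> K" "x + t *\<^sub>R u \<in> \<sigma>" by blast
  with \<open>x + t *\<^sub>R u \<in> U\<close> have "x \<in> \<sigma>" by (auto simp: U_def)
  have \<tau>: "\<sigma> \<inter> Q \<in> K" by (rule triangulates_Int_face[OF K Q(1) \<sigma>(1)])
  have "F \<subseteq> (\<sigma> \<inter> Q) \<inter> F"
    using subset_of_face_of[OF triangulates_Int(2)[OF K \<tau> F(1)] subset_refl] \<open>x \<in> \<sigma>\<close> xF F(2,3)
    by blast
  then have "F \<subseteq> \<sigma> \<inter> Q" by blast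
  have "x + t *\<^sub>R u \<notin> affine hull F"
    using affine_ray_mem[of "affine hull F" x t u 1] u(3) t(1) xF by (auto simp: hull_inc)
  then have "aff_dim (\<sigma> \<inter> Q) \<ge> aff_dim F + 1"
    using \<open>F \<subseteq> \<sigma> \<inter> Q\<close> \<sigma>(2) yQ by (intro aff_dim_ge_Suc) auto
  moreover have "aff_dim (\<sigma> \<inter> Q) \<le> aff_dim Q" by (simp add: aff_dim_subset)
  ultimately show ?thesis
    using \<tau> \<open>F \<subseteq> \<sigma> \<inter> Q\<close> \<sigma>(2) yQ t(1) F(4) by (intro bexI[of _ "\<sigma> \<inter> Q"]) auto
qed

lemma facet_in_direction_unique:
  assumes K: "triangulates K P" and \<tau>: "\<tau>1 \<in> K" "\<tau>2 \<in> K" "F \<subseteq> \<tau>1" "F \<subseteq> \<tau>2" "x \<in> F"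
    and dim: "aff_dim \<tau>1 = aff_dim F + 1" "aff_dim \<tau>2 = aff_dim F + 1"
    and u: "x + u \<notin> affine hull F"
    and t: "t1 > 0" "x + t1 *\<^sub>R u \<in> \<tau>1" "t2 > 0" "x + t2 *\<^sub>R u \<in> \<tau>2"
  shows "\<tau>1 = \<tau>2"
proof -
  define t where "t = min t1 t2"
  have conv: "convex \<tau>1" "convex \<tau>2" using triangulates_simplex[OF K] \<tau> convex_simplex by blast+
  have "x + t *\<^sub>R u \<in> \<tau>" if "convex \<tau>" "x \<in> \<tau>" "x + s *\<^sub>R u \<in> \<tau>" "s > 0" "t \<le> s" for \<tau> s
  proof -
    have "(1 - t / s) *\<^sub>R x + (t / s) *\<^sub>R (x + s *\<^sub>R u) \<in> \<tau>"
      using that t by (intro convexD_alt[of \<tau>]) (auto simp: t_def)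
    then show ?thesis using that(4) by (simp add: algebra_simps)
  qed
  from this[of \<tau>1 t1] this[of \<tau>2 t2] conv \<tau> t
  have y: "x + t *\<^sub>R u \<in> \<tau>1 \<inter> \<tau>2" by (auto simp: t_def)
  have "t > 0" using t by (auto simp: t_def)
  then have "x + t *\<^sub>R u \<notin> affine hull F"
    using affine_ray_mem[of "affine hull F" x t u 1] u \<tau>(5) by (auto simp: hull_inc)
  then have "aff_dim (\<tau>1 \<inter> \<tau>2) \<ge> aff_dim F + 1"
    using \<tau> y by (intro aff_dim_ge_Suc) auto
  then have "\<tau>1 \<inter> \<tau>2 = \<tau>1" "\<tau>1 \<inter> \<tau>2 = \<tau>2"
    using face_of_aff_dim_lt[OF conv(1) triangulates_Int(1)[OF K \<tau>(1,2)]]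
      face_of_aff_dim_lt[OF conv(2) triangulates_Int(2)[OF K \<tau>(1,2)]] dim by force+
  then show ?thesis by simp
qed

text \<open>A simplex lies on exactly one side of each of its facets.\<close>

lemma facet_direction_exclusive:
  fixes \<tau> :: "'a::euclidean_space set"
  assumes "convex \<tau>" "F face_of \<tau>" "x \<in> rel_interior F" "aff_dim \<tau> = aff_dim F + 1"
    and u: "x + u \<in> affine hull \<tau>" "x + u \<notin> affine hull F"
  shows "(\<exists>t>0. x + t *\<^sub>R u \<in> \<tau>) \<longleftrightarrow> \<not> (\<exists>t>0. x + t *\<^sub>R (- u) \<in> \<tau>)"
proof -
  have xF: "x \<in> F" using assms(3) rel_interior_subset by blast
  have F\<tau>: "F \<subseteq> \<tau>" using assms(2) by (rule face_of_imp_subset)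
  have "affine hull (insert (x + u) F) = affine hull \<tau>"
  proof (rule affine_dim_equal)
    show "affine hull (insert (x + u) F) \<subseteq> affine hull \<tau>"
      using F\<tau> u(1) by (meson hull_minimal affine_affine_hull hull_subset insert_subset subset_trans)
    show "aff_dim (affine hull insert (x + u) F) = aff_dim (affine hull \<tau>)"
      using u(2) assms(4) by (simp add: aff_dim_insert)
  qed auto
  moreover obtain w where w: "w \<in> \<tau>" "w \<notin> affine hull F"
  proof -
    have "\<not> \<tau> \<subseteq> affine hull F"
      using aff_dim_subset[of \<tau> "affine hull F"] assms(4) by auto
    then show ?thesis using that by blast
  qed
  ultimately obtain k where k: "w - k *\<^sub>R u \<in> affine hull F"
    using affine_hull_insert_ray[OF xF, of w u] hull_inc[OF w(1), of affine] by auto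
  have "k \<noteq> 0" using k w(2) by auto
  have "convex F" using assms(2) by (rule face_of_imp_convex)
  then obtain s where s: "s > 1" "(1 - s) *\<^sub>R (w - k *\<^sub>R u) + s *\<^sub>R x \<in> F"
    using convex_rel_interior_if2[OF _ assms(3)] k by blast
  \<comment> \<open>The affine part of \<open>w\<close> cancels against the point of \<open>F\<close> opposite to it.\<close>
  have "(1 / s) *\<^sub>R ((1 - s) *\<^sub>R (w - k *\<^sub>R u) + s *\<^sub>R x) + ((s - 1) / s) *\<^sub>R w \<in> \<tau>"
  proof (rule convexD[OF assms(1)])
    show "(1 - s) *\<^sub>R (w - k *\<^sub>R u) + s *\<^sub>R x \<in> \<tau>" using s(2) F\<tau> by blast
  qed (use w(1) s(1) in \<open>auto simp: field_simps\<close>)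
  also have "(1 / s) *\<^sub>R ((1 - s) *\<^sub>R (w - k *\<^sub>R u) + s *\<^sub>R x) + ((s - 1) / s) *\<^sub>R w
      = x + ((s - 1) / s * k) *\<^sub>R u"
  proof -
    have "(1 / s) *\<^sub>R ((1 - s) *\<^sub>R (w - k *\<^sub>R u) + s *\<^sub>R x) + ((s - 1) / s) *\<^sub>R w
      = ((1 - s) / s + (s - 1) / s) *\<^sub>R w + (s / s) *\<^sub>R x + ((s - 1) / s * k) *\<^sub>R u"
      by (simp add: algebra_simps diff_divide_distrib)
    also have "(1 - s) / s + (s - 1) / s = 0" using s(1) by (simp add: field_simps)
    finally show ?thesis using s(1) by simp
  qed
  finally have mem: "x + ((s - 1) / s * k) *\<^sub>R u \<in> \<tau>" .
  have ex: "(\<exists>t>0. x + t *\<^sub>R u \<in> \<tau>) \<or> (\<exists>t>0. x + t *\<^sub>R (- u) \<in> \<tau>)"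
  proof (cases "k > 0")
    case True
    then have "(s - 1) / s * k > 0" using s(1) by (intro mult_pos_pos divide_pos_pos) auto
    then show ?thesis using mem by blast
  next
    case False
    then have "(s - 1) / s * (- k) > 0"
      using s(1) \<open>k \<noteq> 0\<close> by (intro mult_pos_pos divide_pos_pos) auto
    then show ?thesis using mem by (intro disjI2 exI[of _ "(s - 1) / s * (- k)"]) auto
  qed
  have False if t: "t > 0" "x + t *\<^sub>R u \<in> \<tau>" "t' > 0" "x + t' *\<^sub>R (- u) \<in> \<tau>" for t t'
  proof -
    have "u \<noteq> 0" using u(2) xF by (auto simp: hull_inc)
    have neq: "x + t *\<^sub>R u \<noteq> x + t' *\<^sub>R (- u)"
    proof
      assume "x + t *\<^sub>R u = x + t' *\<^sub>R (- u)"
      then have "(t + t') *\<^sub>R u = 0" by (simp add: algebra_simps)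
      then show False using t \<open>u \<noteq> 0\<close> by simp
    qed
    moreover have "x = (1 - t / (t + t')) *\<^sub>R (x + t *\<^sub>R u) + (t / (t + t')) *\<^sub>R (x + t' *\<^sub>R (- u))"
    proof -
      define c where "c = t / (t + t')"
      have "(1 - c) * t - c * t' = 0" using t by (simp add: c_def field_simps)
      moreover have "(1 - c) *\<^sub>R (x + t *\<^sub>R u) + c *\<^sub>R (x + t' *\<^sub>R (- u))
          = x + ((1 - c) * t - c * t') *\<^sub>R u" by (simp add: algebra_simps)
      ultimately show ?thesis by (simp add: c_def)
    qed
    ultimately have "x \<in> open_segment (x + t *\<^sub>R u) (x + t' *\<^sub>R (- u))"
      using t unfolding in_segment by (intro conjI exI[of _ "t / (t + t')"]) auto
    then have "x + t *\<^sub>R u \<in> F" using face_ofD[OF assms(2) _ t(2,4) xF] by blast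
    then show False
      using affine_ray_mem[of "affine hull F" x t u 1] u(2) t(1) xF by (auto simp: hull_inc)
  qed
  with ex show ?thesis by blast
qed

text \<open>A codimension one simplex \<open>F\<close> of a triangulated face \<open>Q\<close> has one facet on either side, except
  that the outer one is missing if \<open>F\<close> lies in a facet of \<open>Q\<close>, which is then unique.\<close>

lemma card_facets_around:
  fixes K :: "'a::euclidean_space set set"
  assumes K: "triangulates K P" and P: "polytope P" "Q face_of P"
    and F: "F \<in> K" "F \<noteq> {}" "F \<subseteq> Q" "aff_dim Q = aff_dim F + 1"
  defines "S \<equiv> {\<tau>\<in>K. F \<subseteq> \<tau> \<and> \<tau> \<subseteq> Q \<and> aff_dim \<tau> = aff_dim Q}"
    and "R \<equiv> {R. R face_of Q \<and> F \<subseteq> R \<and> aff_dim R = aff_dim F}"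
  shows "finite S" "finite R" "card S + card R = 2"
proof -
  have "convex P" using P(1) by (rule polytope_imp_convex)
  have Q: "polytope Q" using P by (rule face_of_polytope_polytope)
  then have "convex Q" by (rule polytope_imp_convex)
  show finS: "finite S" using triangulates_finite[OF K] by (simp add: S_def)
  have "finite {R. R face_of Q}" using Q by (rule finite_polytope_faces)
  then show finR: "finite R" by (rule finite_subset[rotated]) (auto simp: R_def)
  have convF: "convex F" using triangulates_simplex[OF K F(1)] convex_simplex by blast
  then obtain x where x: "x \<in> rel_interior F" using F(2) rel_interior_eq_empty by blast
  then have xF: "x \<in> F" using rel_interior_subset by blast
  obtain q where q: "q \<in> Q" "q \<notin> affine hull F"
  proof -
    have "\<not> Q \<subseteq> affine hull F"
      using aff_dim_subset[of Q "affine hull F"] F(4) by auto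
    then show ?thesis using that by blast
  qed
  define u where "u = q - x"
  have u: "x + u \<in> Q" "x + u \<notin> affine hull F" using q by (auto simp: u_def)
  have u': "x + (- u) \<notin> affine hull F"
    using affine_ray_mem[of "affine hull F" x "-1" u 1] u(2) xF by (auto simp: hull_inc)
  define S1 where "S1 = {\<tau>\<in>S. \<exists>t>0. x + t *\<^sub>R u \<in> \<tau>}"
  define S2 where "S2 = {\<tau>\<in>S. \<exists>t>0. x + t *\<^sub>R (- u) \<in> \<tau>}"
  have side: "(\<exists>t>0. x + t *\<^sub>R u \<in> \<tau>) \<longleftrightarrow> \<not> (\<exists>t>0. x + t *\<^sub>R (- u) \<in> \<tau>)" if "\<tau> \<in> S" for \<tau>
  proof (rule facet_direction_exclusive[OF _ _ x _ _ u(2)])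
    show "convex \<tau>" using that triangulates_simplex[OF K] convex_simplex by (auto simp: S_def)
    show "F face_of \<tau>" using that F(1) K by (auto simp: S_def triangulates_face_iff)
    show "aff_dim \<tau> = aff_dim F + 1" using that F(4) by (simp add: S_def)
    have "affine hull \<tau> = affine hull Q"
    proof (rule affine_dim_equal)
      show "affine hull \<tau> \<subseteq> affine hull Q" using that by (intro hull_mono) (auto simp: S_def)
      show "affine hull \<tau> \<noteq> {}" using that xF by (auto simp: S_def)
    qed (use that in \<open>auto simp: S_def\<close>)
    then show "x + u \<in> affine hull \<tau>" using u(1) by (simp add: hull_inc)
  qed
  then have S: "S = S1 \<union> S2" "S1 \<inter> S2 = {}" by (auto simp: S1_def S2_def)
  have "\<exists>\<tau>\<in>K. F \<subseteq> \<tau> \<and> \<tau> \<subseteq> Q \<and> aff_dim \<tau> = aff_dim Q \<and> (\<exists>t>0. x + t *\<^sub>R u \<in> \<tau>)"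
    using u by (intro ex_facet_in_direction[OF K P(2) \<open>convex P\<close> F(1,3) x F(4), of 1]) auto
  then obtain \<tau>1 where "\<tau>1 \<in> S1" by (auto simp: S1_def S_def)
  moreover have "\<tau> = \<tau>'" if "\<tau> \<in> S1" "\<tau>' \<in> S1" for \<tau> \<tau>'
    using that facet_in_direction_unique[OF K _ _ _ _ xF _ _ u(2)] F(4)
    by (auto simp: S1_def S_def) blast?
  ultimately have S1: "card S1 = 1" by (auto simp: card_1_singleton_iff)
  have S2_le: "\<tau> = \<tau>'" if "\<tau> \<in> S2" "\<tau>' \<in> S2" for \<tau> \<tau>'
    using that facet_in_direction_unique[OF K _ _ _ _ xF _ _ u'] F(4)
    by (auto simp: S2_def S_def) blast?
  have "card S2 + card R = 1"
  proof (cases "x \<in> rel_interior Q")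
    case True
    have "x - u \<in> affine hull Q" "x + u \<in> affine hull Q"
      using affine_ray_mem[of "affine hull Q" x 1 u "-1"] xF F(3) u(1) by (auto simp: hull_inc)
    then obtain s where s: "s > 1" "(1 - s) *\<^sub>R (x + u) + s *\<^sub>R x \<in> Q"
      using convex_rel_interior_if2[OF \<open>convex Q\<close> True] by blast
    then have "x + (s - 1) *\<^sub>R (- u) \<in> Q" by (simp add: algebra_simps)
    then have "\<exists>\<tau>\<in>K. F \<subseteq> \<tau> \<and> \<tau> \<subseteq> Q \<and> aff_dim \<tau> = aff_dim Q \<and> (\<exists>t>0. x + t *\<^sub>R (- u) \<in> \<tau>)"
      using s(1) u' by (intro ex_facet_in_direction[OF K P(2) \<open>convex P\<close> F(1,3) x F(4), of "s - 1"]) auto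
    then obtain \<tau>2 where "\<tau>2 \<in> S2" by (auto simp: S2_def S_def)
    then have "card S2 = 1" using S2_le by (auto simp: card_1_singleton_iff)
    moreover have "R = {}"
    proof -
      have False if "A \<in> R" for A
        using that face_of_disjoint_rel_interior[of A Q] True xF F(4) by (fastforce simp: R_def)
      then show ?thesis by blast
    qed
    ultimately show ?thesis by simp
  next
    case False
    have "x \<in> Q" using xF F(3) by blast
    with False obtain A where A: "A facet_of Q" "x \<in> A"
      using rel_boundary_of_polyhedron[of Q] Q polytope_imp_polyhedron by blast
    then have AQ: "A face_of Q" "aff_dim A = aff_dim Q - 1" by (auto simp: facet_of_def)
    have FA: "F \<subseteq> A" using subset_of_face_of[OF AQ(1) F(3)] A(2) x by blast
    have AR: "A \<in> R" using FA AQ F(4) by (auto simp: R_def)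
    have hull: "B = affine hull F \<inter> Q" if "B \<in> R" for B
    proof -
      have "affine hull F = affine hull B"
      proof (rule affine_dim_equal)
        show "affine hull F \<subseteq> affine hull B" using that by (intro hull_mono) (auto simp: R_def)
      qed (use that xF in \<open>auto simp: R_def\<close>)
      then show ?thesis using that face_of_imp_eq_affine_Int[OF \<open>convex Q\<close>, of B]
        by (auto simp: R_def)
    qed
    have "R = {A}" using AR hull by blast
    moreover have "S2 = {}"
    proof -
      have False if t: "t > 0" "x + t *\<^sub>R (- u) \<in> Q" for t
      proof -
        have "u \<noteq> 0" using u(2) xF by (auto simp: hull_inc)
        have "x + u \<noteq> x + t *\<^sub>R (- u)"
        proof
          assume "x + u = x + t *\<^sub>R (- u)"
          then have "(1 + t) *\<^sub>R u = 0" by (simp add: algebra_simps)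
          then show False using t \<open>u \<noteq> 0\<close> by simp
        qed
        moreover have "x = (1 - 1 / (1 + t)) *\<^sub>R (x + u) + (1 / (1 + t)) *\<^sub>R (x + t *\<^sub>R (- u))"
        proof -
          define c where "c = 1 / (1 + t)"
          have "(1 - c) - c * t = 0" using t by (simp add: c_def field_simps)
          moreover have "(1 - c) *\<^sub>R (x + u) + c *\<^sub>R (x + t *\<^sub>R (- u))
              = x + ((1 - c) - c * t) *\<^sub>R u" by (simp add: algebra_simps)
          ultimately show ?thesis by (simp add: c_def)
        qed
        ultimately have "x \<in> open_segment (x + u) (x + t *\<^sub>R (- u))"
          using t unfolding in_segment by (intro conjI exI[of _ "1 / (1 + t)"]) auto
        then have "x + u \<in> A" using face_ofD[OF AQ(1) _ u(1) t(2) A(2)] by blast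
        then show False using hull[OF AR] u(2) by blast
      qed
      then show ?thesis by (auto simp: S2_def S_def)
    qed
    ultimately show ?thesis by simp
  qed
  moreover have "card S = card S1 + card S2"
    unfolding S(1) using S finS by (intro card_Un_disjoint) auto
  ultimately show "card S + card R = 2" using S1 by simp
qed


section \<open>Uniformity as a parity condition\<close>

subsection \<open>Covectors on unimodular simplices\<close>

text \<open>For \<open>v \<noteq> w\<close>, an integral affine function that is odd at \<open>v\<close> and \<open>w\<close> and even elsewhere on \<open>V\<close>.  If \<open>V\<close>
  consists of the vertices of two adjacent unimodular simplices of full dimension with common
  facet \<open>F\<close> and opposite vertices \<open>a\<close> and \<open>b\<close>, then \<open>a + b = (\<Sum>f\<in>F. c f *\<^sub>R f)\<close> with integers \<open>c f\<close>, and such a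
  function exists for \<open>v, w \<in> F\<close> if and only if \<open>c v\<close> and \<open>c w\<close> have the same parity.\<close>

definition even_affine :: "'a::euclidean_space set \<Rightarrow> 'a \<Rightarrow> 'a \<Rightarrow> bool" where
  "even_affine V v w \<longleftrightarrow>
     (\<exists>u\<in>lattice_N. \<exists>k\<in>\<int>. \<forall>a\<in>V. (a \<bullet> u + k - of_bool (a = v) - of_bool (a = w)) / 2 \<in> \<int>)"

text \<open>The parity of the coefficients \<open>c f\<close> is the same for all vertices \<open>f \<in> G\<close> of the common facet.\<close>

definition parity_uniform :: "'a::euclidean_space set \<Rightarrow> 'a set set \<Rightarrow> bool" where
  "parity_uniform G K \<longleftrightarrow>
     (\<forall>\<tau>\<^sub>1\<in>K. \<forall>\<tau>\<^sub>2\<in>K. \<forall>v w.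
        card (vertices \<tau>\<^sub>1) = DIM('a) + 1 \<longrightarrow> card (vertices \<tau>\<^sub>2) = DIM('a) + 1 \<longrightarrow>
        card (vertices \<tau>\<^sub>1 \<inter> vertices \<tau>\<^sub>2) = DIM('a) \<longrightarrow>
        {v, w} \<subseteq> vertices \<tau>\<^sub>1 \<inter> vertices \<tau>\<^sub>2 \<inter> G \<longrightarrow>
        even_affine (vertices \<tau>\<^sub>1 \<union> vertices \<tau>\<^sub>2) v w)"

lemma even_affine_refl: "even_affine V v v"
  unfolding even_affine_def by (intro bexI[of _ 0] bexI[of _ 0] ballI) (auto simp: lattice_N_0)

lemma sum_const_card_2:
  fixes c :: "'b \<Rightarrow> bit"
  shows "card A = 2 \<Longrightarrow> (\<Sum>x\<in>A. c) = 0"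
  by (auto simp: card_2_iff)

lemma simplex_edge:
  assumes "k simplex \<sigma>" "E \<in> edges \<sigma>"
  shows "\<exists>a\<in>vertices \<sigma>. \<exists>b\<in>vertices \<sigma>. a \<noteq> b \<and> vertices E = {a, b} \<and> E = convex hull {a, b}"
proof -
  have "E face_of \<sigma>" "aff_dim E = 1" using assms(2) by (auto simp: edges_def)
  then obtain c where c: "c \<subseteq> vertices \<sigma>" "E = convex hull c"
    using simplex_face_iff[OF assms(1)] by blast
  obtain l where "l simplex E" using simplex_face[OF assms(1) \<open>E face_of \<sigma>\<close>] by blast
  then have "card (vertices E) = 2"
    using simplex_card[of l E] \<open>aff_dim E = 1\<close> by linarith
  then have "card c = 2" using vertices_hull_subset[OF assms(1) c(1)] c(2) by simp
  then obtain a b where "c = {a, b}" "a \<noteq> b" by (auto simp: card_2_iff)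
  then show ?thesis using c vertices_hull_subset[OF assms(1) c(1)] by auto
qed

lemma simplex_edgeI:
  assumes "k simplex \<sigma>" "a \<in> vertices \<sigma>" "b \<in> vertices \<sigma>" "a \<noteq> b"
  shows "convex hull {a, b} \<in> edges \<sigma>" "vertices (convex hull {a, b}) = {a, b}"
proof -
  show V: "vertices (convex hull {a, b}) = {a, b}"
    by (rule vertices_hull_subset[OF assms(1)]) (use assms in auto)
  have f: "convex hull {a, b} face_of \<sigma>" unfolding simplex_face_iff[OF assms(1)]
    by (rule exI[of _ "{a, b}"]) (simp add: assms)
  then obtain l where "l simplex (convex hull {a, b})" using simplex_face[OF assms(1)] by blast
  then have "aff_dim (convex hull {a, b}) = 1" using simplex_card[of l] V assms(4) by fastforce
  then show "convex hull {a, b} \<in> edges \<sigma>" using f by (simp add: edges_def)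
qed

lemma edges_face: "F face_of \<sigma> \<Longrightarrow> edges F \<subseteq> edges \<sigma>"
  by (auto simp: edges_def intro: face_of_trans)

lemma simplicial_d_edge: "vertices E = {a, b} \<Longrightarrow> a \<noteq> b \<Longrightarrow> simplicial_d f E = f a + f b"
  by (simp add: simplicial_d_def)

lemma restrict_simplicial_d_eq_iff:
  assumes "k simplex \<sigma>"
  shows "restrict_to_edges \<sigma> (simplicial_d f) = restrict_to_edges \<sigma> (simplicial_d g) \<longleftrightarrow>
    (\<forall>a\<in>vertices \<sigma>. \<forall>b\<in>vertices \<sigma>. f a + f b = g a + g b)"
proof
  assume eq: "restrict_to_edges \<sigma> (simplicial_d f) = restrict_to_edges \<sigma> (simplicial_d g)"
  have "f a + f b = g a + g b" if "a \<in> vertices \<sigma>" "b \<in> vertices \<sigma>" "a \<noteq> b" for a b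
    using fun_cong[OF eq, of "convex hull {a, b}"] simplex_edgeI[OF assms that] that(3)
    by (simp add: restrict_to_edges_def simplicial_d_edge)
  then show "\<forall>a\<in>vertices \<sigma>. \<forall>b\<in>vertices \<sigma>. f a + f b = g a + g b"
    by (metis bit_add_self)
next
  assume eq: "\<forall>a\<in>vertices \<sigma>. \<forall>b\<in>vertices \<sigma>. f a + f b = g a + g b"
  have "simplicial_d f E = simplicial_d g E" if "E \<in> edges \<sigma>" for E
    using simplex_edge[OF assms that] eq by (auto simp: simplicial_d_edge)
  then show "restrict_to_edges \<sigma> (simplicial_d f) = restrict_to_edges \<sigma> (simplicial_d g)"
    by (auto simp: restrict_to_edges_def)
qed

text \<open>In the boundary of a triangle every vertex lies on two edges.\<close>

lemma simplicial_d_cocycle: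
  assumes "k simplex \<sigma>"
  shows "restrict_to_edges \<sigma> (simplicial_d f) \<in> simplicial_Z1 \<sigma>"
proof -
  have "(\<Sum>E\<in>edges T. restrict_to_edges \<sigma> (simplicial_d f) E) = 0"
    if T: "T face_of \<sigma>" "aff_dim T = 2" for T
  proof -
    obtain l where l: "l simplex T" using simplex_face[OF assms T(1)] by blast
    then have "card (vertices T) = 3" using simplex_card[OF l] T(2) by linarith
    then obtain a b c where abc: "vertices T = {a, b, c}" "a \<noteq> b" "b \<noteq> c" "a \<noteq> c"
      by (auto simp: card_3_iff)
    have ab: "convex hull {a, b} \<in> edges T" "vertices (convex hull {a, b}) = {a, b}"
      and bc: "convex hull {b, c} \<in> edges T" "vertices (convex hull {b, c}) = {b, c}"
      and ac: "convex hull {a, c} \<in> edges T" "vertices (convex hull {a, c}) = {a, c}"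
      using simplex_edgeI[OF l] abc by blast+
    have "{a, b} \<noteq> {b, c}" "{a, b} \<noteq> {a, c}" "{b, c} \<noteq> {a, c}"
      using abc by (auto simp: doubleton_eq_iff)
    then have ne: "convex hull {a, b} \<noteq> convex hull {b, c}" "convex hull {a, b} \<noteq> convex hull {a, c}"
      "convex hull {b, c} \<noteq> convex hull {a, c}"
      using ab(2) bc(2) ac(2) by metis+
    have "E = convex hull {a, b} \<or> E = convex hull {b, c} \<or> E = convex hull {a, c}"
      if E: "E \<in> edges T" for E
    proof -
      obtain x y where "x \<in> {a, b, c}" "y \<in> {a, b, c}" "x \<noteq> y" "E = convex hull {x, y}"
        using simplex_edge[OF l E] abc(1) by auto
      then show ?thesis by (auto simp: insert_commute)
    qed
    with ab(1) bc(1) ac(1)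
    have "edges T = {convex hull {a, b}, convex hull {b, c}, convex hull {a, c}}" by blast
    moreover have "edges T \<subseteq> edges \<sigma>" using T(1) face_of_trans by (auto simp: edges_def)
    ultimately have "(\<Sum>E\<in>edges T. restrict_to_edges \<sigma> (simplicial_d f) E)
        = simplicial_d f (convex hull {a, b}) + simplicial_d f (convex hull {b, c})
          + simplicial_d f (convex hull {a, c})"
      using ne by (simp add: restrict_to_edges_def add.assoc)
    also have "\<dots> = (f a + f a) + (f b + f b) + (f c + f c)"
      by (simp add: simplicial_d_edge[OF ab(2) abc(2)] simplicial_d_edge[OF bc(2) abc(3)]
          simplicial_d_edge[OF ac(2) abc(4)] add_ac)
    finally show ?thesis by simp
  qed
  then show ?thesis by (simp add: simplicial_Z1_def restrict_to_edges_def)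
qed

lemma pairing_scale:
  assumes "r \<in> \<int>" "a \<in> lattice_M"
  shows "pairing (r *\<^sub>R a) z = parity r * pairing a z"
  using assms
  by (auto simp: pairing_def mod2_eq parity_mult lattice_M_def sum_distrib_left mult.assoc
      intro!: sum.cong)

lemma pairing_sum_left:
  assumes "finite I" "\<And>i. i \<in> I \<Longrightarrow> f i \<in> lattice_M"
  shows "pairing (sum f I) z = (\<Sum>i\<in>I. pairing (f i) z)"
  using assms
proof (induction I rule: finite_induct)
  case empty
  have "pairing 0 z = 0" by (auto simp: pairing_def mod2_eq)
  then show ?case by (simp only: sum.empty)
next
  case (insert x F)
  then show ?case by (simp add: pairing_add_left lattice_M_sum)
qed

lemma mod2_even:
  assumes "u \<in> lattice_N"
  shows "mod2 ((-2) *\<^sub>R u) = 0"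
proof -
  have "mod2 ((-2) *\<^sub>R u) b = 0" for b
  proof (cases "b \<in> Basis")
    case True
    then have "u \<bullet> b \<in> \<int>" using assms by (simp add: lattice_N_iff)
    then have "-2 * (u \<bullet> b) \<in> \<int>" "-2 * (u \<bullet> b) / 2 \<in> \<int>" by auto
    then have "parity (-2 * (u \<bullet> b)) = 0" by (simp add: parity_eq_0_iff)
    then show ?thesis using True by (simp add: mod2_eq)
  qed (simp add: mod2_eq)
  then show ?thesis by (simp add: fun_eq_iff)
qed

text \<open>The vertices of a unimodular simplex of full dimension generate the lattice affinely, since
  barycentric coordinates are integral affine functions.\<close>

lemma unimodular_integral_combination:
  fixes \<tau> :: "'a::euclidean_space set"
  assumes "unimodular \<tau>" "k simplex \<tau>" "card (vertices \<tau>) = DIM('a) + 1"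
  obtains c where "x = (\<Sum>a\<in>vertices \<tau>. c a *\<^sub>R a)" "sum c (vertices \<tau>) = 1"
    "\<And>a. x \<in> lattice_M \<Longrightarrow> a \<in> vertices \<tau> \<Longrightarrow> c a \<in> \<int>"
proof -
  let ?V = "vertices \<tau>"
  have V: "finite ?V" "\<not> affine_dependent ?V" using simplex_vertices[OF assms(2)] by auto
  have "aff_dim ?V = int DIM('a)" using V assms(3) aff_dim_affine_independent by force
  then have "affine hull ?V = UNIV" by (simp add: aff_dim_eq_full)
  then have "x \<in> affine hull ?V" by simp
  then obtain c where c: "sum c ?V = 1" "x = (\<Sum>a\<in>?V. c a *\<^sub>R a)"
    using affine_hull_finite[OF V(1)] by auto
  have "c b \<in> \<int>" if x: "x \<in> lattice_M" and b: "b \<in> ?V" for b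
  proof -
    obtain u k where u: "u \<in> lattice_N" "k \<in> \<int>" "\<And>a. a \<in> ?V \<Longrightarrow> a \<bullet> u + k = of_bool (a = b)"
      by (rule extends_intE[of ?V "\<lambda>a. of_bool (a = b)"]) (use assms(1) in \<open>auto simp: unimodular_def\<close>)
    have "x \<bullet> u + k = (\<Sum>a\<in>?V. c a * (a \<bullet> u)) + sum c ?V * k"
      using c by (simp add: inner_sum_left)
    also have "\<dots> = (\<Sum>a\<in>?V. c a * (a \<bullet> u + k))"
      by (simp add: distrib_left sum.distrib sum_distrib_right)
    also have "\<dots> = (\<Sum>a\<in>?V. if a = b then c b else 0)"
      by (intro sum.cong) (auto simp: u)
    also have "\<dots> = c b" using b V(1) by simp
    finally show ?thesis using inner_lattice[OF x u(1)] u(2) by (metis Ints_add)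
  qed
  then show ?thesis using c that by blast
qed

text \<open>Integral affine combinations of the vertices reach every lattice point, and \<open>z\<close> takes the same value at
  all of them as at \<open>0\<close>.\<close>

lemma unimodular_N2_zero:
  fixes \<tau> :: "'a::euclidean_space set"
  assumes \<tau>: "unimodular \<tau>" "k simplex \<tau>" "card (vertices \<tau>) = DIM('a) + 1"
    and z: "z \<in> N2" "\<And>a b. a \<in> vertices \<tau> \<Longrightarrow> b \<in> vertices \<tau> \<Longrightarrow> pairing a z = pairing b z"
  shows "z = 0"
proof -
  have "vertices \<tau> \<noteq> {}" using \<tau>(3) by auto
  then obtain b where b: "b \<in> vertices \<tau>" by blast
  have V: "vertices \<tau> \<subseteq> lattice_M" using \<tau>(1) by (simp add: unimodular_def)
  have const: "pairing x z = pairing b z" if "x \<in> lattice_M" for x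
  proof -
    obtain c where c: "x = (\<Sum>a\<in>vertices \<tau>. c a *\<^sub>R a)" "sum c (vertices \<tau>) = 1"
      "\<And>a. x \<in> lattice_M \<Longrightarrow> a \<in> vertices \<tau> \<Longrightarrow> c a \<in> \<int>"
      using unimodular_integral_combination[OF \<tau>] by blast
    note c = c(1,2) c(3)[OF that]
    have "pairing x z = (\<Sum>a\<in>vertices \<tau>. parity (c a) * pairing a z)"
      unfolding c(1) using simplex_vertices(2)[OF \<tau>(2)] V c(3)
      by (subst pairing_sum_left) (auto simp: lattice_M_scale pairing_scale subset_iff intro!: sum.cong)
    also have "\<dots> = (\<Sum>a\<in>vertices \<tau>. parity (c a) * pairing b z)"
      by (intro sum.cong refl arg_cong2[of _ _ _ _ "(*)"] z(2) b)
    also have "\<dots> = pairing b z"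
      using c by (simp add: sum_distrib_right[symmetric] parity_sum[symmetric])
    finally show ?thesis .
  qed
  have "pairing 0 z = 0" by (auto simp: pairing_def mod2_eq)
  then have "pairing x z = pairing x 0" if "x \<in> lattice_M" for x
    using const[OF that] const[OF lattice_M_0] by (simp only: pairing_0_right)
  then show ?thesis by (intro N2_eqI z(1) N2_0) auto
qed

text \<open>Exactness at \<open>N\<^sub>2\<close> of the sequence that defines waves: a covector modulo two that is constant on
  the vertices of a unimodular simplex lifts to an integral covector with the same property.
  An arbitrary lift \<open>U\<close> has even differences, and half of them extend to an integral affine function, whose
  linear part corrects \<open>U\<close>.\<close>

lemma W1_stalkI:
  assumes \<sigma>: "unimodular \<sigma>" "k simplex \<sigma>"
    and z: "z \<in> N2" "\<And>a b. a \<in> vertices \<sigma> \<Longrightarrow> b \<in> vertices \<sigma> \<Longrightarrow> pairing a z = pairing b z"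
  shows "z \<in> mod2 ` {u \<in> lattice_N. \<forall>t\<in>tangent \<sigma>. t \<bullet> u = 0}"
proof (cases "vertices \<sigma> = {}")
  case True
  then have "\<sigma> = {}" using simplex_vertices(3)[OF \<sigma>(2)] by simp
  then show ?thesis using z(1) by (auto simp: tangent_def N2_def)
next
  case False
  then obtain a0 where a0: "a0 \<in> vertices \<sigma>" by blast
  have V: "vertices \<sigma> \<subseteq> lattice_M" using \<sigma>(1) by (simp add: unimodular_def)
  obtain U where U: "U \<in> lattice_N" "z = mod2 U" using z(1) by (auto simp: N2_def)
  define m where "m a = (a - a0) \<bullet> U / 2" for a
  have "m a \<in> \<int>" if "a \<in> vertices \<sigma>" for a
  proof -
    have "parity (a \<bullet> U) = parity (a0 \<bullet> U)"
      using z(2)[OF that a0] U V a0 that by (simp add: pairing_mod2 subset_iff)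
    moreover have I: "(a - a0) \<bullet> U \<in> \<int>" "a0 \<bullet> U \<in> \<int>"
      using U V a0 that by (auto intro!: inner_lattice lattice_M_diff)
    moreover have "parity (a \<bullet> U) = parity ((a - a0) \<bullet> U) + parity (a0 \<bullet> U)"
      using parity_add[OF I] by (simp add: inner_diff_left)
    ultimately have "parity ((a - a0) \<bullet> U) = 0" by simp
    then show ?thesis using I by (simp add: m_def parity_eq_0_iff)
  qed
  then obtain u' k where u': "u' \<in> lattice_N" "\<And>a. a \<in> vertices \<sigma> \<Longrightarrow> a \<bullet> u' + k = m a"
    using \<sigma>(1) extends_intE[of "vertices \<sigma>" m] unfolding unimodular_def by metis
  define u where "u = U + (-2) *\<^sub>R u'"
  have uN: "u \<in> lattice_N" unfolding u_def using U u' by (intro lattice_N_add lattice_N_scale) auto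
  have "mod2 u = mod2 U + mod2 ((-2) *\<^sub>R u')"
    unfolding u_def using U u' by (intro mod2_add lattice_N_scale) auto
  then have "z = mod2 u" using U(2) mod2_even[OF u'(1)] by (simp only: add_0_right)
  have "a \<bullet> u = a0 \<bullet> u" if "a \<in> vertices \<sigma>" for a
  proof -
    have "m a0 = 0" by (simp add: m_def)
    then have "2 * (a \<bullet> u') - 2 * (a0 \<bullet> u') = 2 * m a"
      using u'(2)[OF that] u'(2)[OF a0] by simp
    then show ?thesis by (simp add: u_def m_def inner_diff_left inner_diff_right field_simps)
  qed
  then have "convex hull (vertices \<sigma>) \<subseteq> {x. u \<bullet> x = a0 \<bullet> u}"
    by (intro hull_minimal convex_hyperplane) (auto simp: inner_commute)
  then have \<sigma>u: "x \<bullet> u = a0 \<bullet> u" if "x \<in> \<sigma>" for x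
    using that simplex_vertices(3)[OF \<sigma>(2)] by (auto simp: inner_commute)
  have "t \<bullet> u = 0" if "t \<in> tangent \<sigma>" for t
    using that unfolding tangent_def
  proof (induction rule: span_induct)
    case base
    then show ?case using subspace_hyperplane2[of u] by (simp add: inner_commute)
  next
    case (step x)
    then show ?case using \<sigma>u by (auto simp: inner_diff_left)
  qed
  then show ?thesis using uN \<open>z = mod2 u\<close> by blast
qed

lemma W1_stalk_full:
  fixes \<tau> :: "'a::euclidean_space set"
  assumes \<tau>: "unimodular \<tau>" "k simplex \<tau>" "card (vertices \<tau>) = DIM('a) + 1"
  shows "mod2 ` {u \<in> lattice_N. \<forall>t\<in>tangent \<tau>. t \<bullet> u = 0} = {0}"
proof -
  have "u = 0" if u: "\<forall>t\<in>tangent \<tau>. t \<bullet> u = 0" for u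
  proof -
    have "vertices \<tau> \<noteq> {}" using \<tau>(3) by auto
    then obtain b where b: "b \<in> vertices \<tau>" by blast
    have const: "a \<bullet> u = b \<bullet> u" if "a \<in> vertices \<tau>" for a
    proof -
      have "a - b \<in> tangent \<tau>"
        using that b vertices_subset[of \<tau>] unfolding tangent_def by (intro span_base) blast
      then have "(a - b) \<bullet> u = 0" using u by blast
      then show ?thesis by (simp add: inner_diff_left)
    qed
    have "x \<bullet> u = b \<bullet> u" for x
    proof -
      obtain c where c: "x = (\<Sum>a\<in>vertices \<tau>. c a *\<^sub>R a)" "sum c (vertices \<tau>) = 1"
        using unimodular_integral_combination[OF \<tau>] by metis
      have "x \<bullet> u = (\<Sum>a\<in>vertices \<tau>. c a * (b \<bullet> u))"
        unfolding c(1) by (auto simp: inner_sum_left const intro!: sum.cong)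
      then show ?thesis using c(2) by (simp add: sum_distrib_right[symmetric])
    qed
    from this[of u] this[of 0] show "u = 0" by simp
  qed
  then have "{u \<in> lattice_N. \<forall>t\<in>tangent \<tau>. t \<bullet> u = 0} = {0}" by (auto simp: lattice_N_0)
  then show ?thesis by (simp only: image_insert image_empty mod2_0)
qed

lemma cell_le_trans: "cell_le a b \<Longrightarrow> cell_le b c \<Longrightarrow> cell_le a c"
  by (auto simp: cell_le_def intro: face_of_trans)

locale unimodular_triangulation =
  fixes P :: "'a::euclidean_space set" and K :: "'a set set"
  assumes P: "int DIM('a) simplex P" and K: "triangulates K P"
    and uni: "\<And>\<sigma>. \<sigma> \<in> K \<Longrightarrow> unimodular \<sigma>"
begin

abbreviation X where "X \<equiv> cells_X P K"

subsection \<open>Incidences between cells\<close>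

lemma mem_X: "c \<in> X \<longleftrightarrow> fst c \<in> K \<and> snd c face_of P \<and> fst c \<subseteq> snd c \<and> aff_dim (fst c) \<ge> 1"
  by (cases c) (auto simp: cells_X_def cells_Y_def)

lemma finite_X: "finite X"
proof (rule finite_subset)
  show "X \<subseteq> K \<times> {F. F face_of P}" by (auto simp: mem_X)
  show "finite (K \<times> {F. F face_of P})"
    using triangulates_finite[OF K] finite_simplex_faces[OF P] by blast
qed

lemma cell_dim_X:
  assumes "c \<in> X"
  shows "int (cell_dim c) = aff_dim (snd c) - aff_dim (fst c)"
  using assms aff_dim_subset[of "fst c" "snd c"] by (simp add: mem_X cell_dim_def)

lemma simplex_K: "\<sigma> \<in> K \<Longrightarrow> \<exists>k. k simplex \<sigma>"
  using triangulates_simplex[OF K] .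

lemma card_K: "\<sigma> \<in> K \<Longrightarrow> aff_dim \<sigma> = int (card (vertices \<sigma>)) - 1"
  using simplex_K simplex_card by blast

lemma simplex_face_P: "Q face_of P \<Longrightarrow> \<exists>k. k simplex Q"
  using simplex_face[OF P] .

lemma face_of_sub_face: "R face_of P \<Longrightarrow> Q face_of P \<Longrightarrow> R \<subseteq> Q \<Longrightarrow> R face_of Q"
  by (meson face_of_imp_subset face_of_subset)

text \<open>The two \<open>0\<close>-cells below \<open>(F, Q)\<close> correspond to the two sides of \<open>F\<close> in \<open>Q\<close>: a simplex \<open>\<tau>\<close> on that side
  gives \<open>(\<tau>, Q)\<close>, and a facet \<open>R\<close> of \<open>Q\<close> in its place gives \<open>(F, R)\<close>.\<close>

lemma card_0_cells:
  assumes c: "c \<in> X" "cell_dim c = 1"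
  shows "card {c'\<in>X. cell_dim c' = 0 \<and> cell_le c' c} = 2"
proof -
  obtain F Q where FQ: "c = (F, Q)" by (cases c)
  have F: "F \<in> K" "F \<noteq> {}" "F \<subseteq> Q" "Q face_of P" "aff_dim F \<ge> 1"
    using c(1) FQ by (auto simp: mem_X)
  have dim: "aff_dim Q = aff_dim F + 1" using cell_dim_X[OF c(1)] c(2) FQ by simp
  define S where "S = {\<tau>\<in>K. F \<subseteq> \<tau> \<and> \<tau> \<subseteq> Q \<and> aff_dim \<tau> = aff_dim Q}"
  define R where "R = {R. R face_of Q \<and> F \<subseteq> R \<and> aff_dim R = aff_dim F}"
  have SR: "finite S" "finite R" "card S + card R = 2"
    unfolding S_def R_def
    using card_facets_around[OF K simplex_imp_polytope[OF P] F(4) F(1,2,3) dim] by auto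
  have "{c'\<in>X. cell_dim c' = 0 \<and> cell_le c' c} = (\<lambda>\<tau>. (\<tau>, Q)) ` S \<union> Pair F ` R"
  proof (intro subset_antisym subsetI)
    fix c' assume c': "c' \<in> {c'\<in>X. cell_dim c' = 0 \<and> cell_le c' c}"
    obtain \<tau> A where tA: "c' = (\<tau>, A)" by (cases c')
    have \<tau>: "\<tau> \<in> K" "\<tau> \<subseteq> A" "A face_of P" "F face_of \<tau>" "A \<subseteq> Q"
      using c' tA FQ by (auto simp: mem_X cell_le_def)
    have dA: "aff_dim A = aff_dim \<tau>" using c' tA cell_dim_X[of c'] by auto
    have AQ: "A face_of Q" by (rule face_of_sub_face[OF \<tau>(3) F(4) \<tau>(5)])
    have F\<tau>: "F \<subseteq> \<tau>" using \<tau>(4) by (rule face_of_imp_subset)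
    have convQ: "convex Q" using F(4) by (rule face_of_imp_convex)
    show "c' \<in> (\<lambda>\<tau>. (\<tau>, Q)) ` S \<union> Pair F ` R"
    proof (cases "A = Q")
      case True
      then show ?thesis using \<tau> F\<tau> dA tA by (auto simp: S_def)
    next
      case False
      then have "aff_dim A < aff_dim Q" using face_of_aff_dim_lt[OF convQ AQ] by simp
      then have "\<not> aff_dim F < aff_dim \<tau>" using dA dim by linarith
      moreover have "convex \<tau>" using simplex_K[OF \<tau>(1)] convex_simplex by blast
      ultimately have "F = \<tau>" using face_of_aff_dim_lt[OF _ \<tau>(4)] by blast
      then show ?thesis using tA AQ \<tau>(2) dA by (auto simp: R_def)
    qed
  next
    fix c' assume "c' \<in> (\<lambda>\<tau>. (\<tau>, Q)) ` S \<union> Pair F ` R"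
    then show "c' \<in> {c'\<in>X. cell_dim c' = 0 \<and> cell_le c' c}"
    proof
      assume "c' \<in> (\<lambda>\<tau>. (\<tau>, Q)) ` S"
      then obtain \<tau> where "c' = (\<tau>, Q)" "\<tau> \<in> K" "F \<subseteq> \<tau>" "\<tau> \<subseteq> Q" "aff_dim \<tau> = aff_dim Q"
        by (auto simp: S_def)
      then show ?thesis using F dim FQ triangulates_face_iff[OF K F(1)]
        by (auto simp: mem_X cell_dim_def cell_le_def)
    next
      assume "c' \<in> Pair F ` R"
      then obtain A where "c' = (F, A)" "A face_of Q" "F \<subseteq> A" "aff_dim A = aff_dim F"
        by (auto simp: R_def)
      moreover have "convex F" using simplex_K[OF F(1)] convex_simplex by blast
      ultimately show ?thesis using F FQ
        by (auto simp: mem_X cell_dim_def cell_le_def face_of_refl face_of_imp_subset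
            dest: face_of_trans)
    qed
  qed
  moreover have "(\<lambda>\<tau>. (\<tau>, Q)) ` S \<inter> Pair F ` R = {}" using dim by (auto simp: S_def)
  ultimately show ?thesis
    using SR by (simp add: card_Un_disjoint card_image inj_on_def)
qed

text \<open>The interval between a \<open>0\<close>-cell \<open>(\<tau>, R)\<close> and a \<open>2\<close>-cell \<open>(\<sigma>, Q)\<close> is Boolean: an
  intermediate cell removes a vertex of \<open>\<tau>\<close> not in \<open>\<sigma>\<close>, or adds to \<open>R\<close> a vertex of \<open>Q\<close>.\<close>

lemma card_1_cells_between:
  assumes c0: "c0 \<in> X" "cell_dim c0 = 0" and c2: "c2 \<in> X" "cell_dim c2 = 2"
    and le: "cell_le c0 c2"
  shows "card {c\<in>X. cell_dim c = 1 \<and> cell_le c0 c \<and> cell_le c c2} = 2"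
proof -
  obtain \<tau> R where tR: "c0 = (\<tau>, R)" by (cases c0)
  obtain \<sigma> Q where sQ: "c2 = (\<sigma>, Q)" by (cases c2)
  have t: "\<tau> \<in> K" "R face_of P" "\<tau> \<subseteq> R" using c0 tR by (auto simp: mem_X)
  have s: "\<sigma> \<in> K" "Q face_of P" "aff_dim \<sigma> \<ge> 1" using c2 sQ by (auto simp: mem_X)
  have st: "\<sigma> face_of \<tau>" "R \<subseteq> Q" using le tR sQ by (auto simp: cell_le_def)
  have RQ: "R face_of Q" by (rule face_of_sub_face[OF t(2) s(2) st(2)])
  obtain k l kR kQ where sim: "k simplex \<tau>" "l simplex \<sigma>" "kR simplex R" "kQ simplex Q"
    using simplex_K[OF t(1)] simplex_K[OF s(1)] simplex_face_P[OF t(2)] simplex_face_P[OF s(2)]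
    by blast
  note card = simplex_card[OF sim(1)] simplex_card[OF sim(2)] simplex_card[OF sim(3)]
    simplex_card[OF sim(4)]
  note fin = simplex_vertices(2)[OF sim(1)] simplex_vertices(2)[OF sim(2)]
    simplex_vertices(2)[OF sim(3)] simplex_vertices(2)[OF sim(4)]
  have dim: "aff_dim R = aff_dim \<tau>" "aff_dim Q = aff_dim \<sigma> + 2"
    using cell_dim_X[OF c0(1)] cell_dim_X[OF c2(1)] c0 c2 tR sQ by auto
  have V: "vertices \<sigma> \<subseteq> vertices \<tau>" "vertices R \<subseteq> vertices Q" "vertices Q \<subseteq> vertices P"
    using st(1) RQ s(2) by (auto simp: vertices_face_eq)
  define A where "A = (\<lambda>a. (convex hull (vertices \<tau> - {a}), R)) ` (vertices \<tau> - vertices \<sigma>)"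
  define B where "B = (\<lambda>b. (\<tau>, convex hull (insert b (vertices R)))) ` (vertices Q - vertices R)"
  have eq: "{c\<in>X. cell_dim c = 1 \<and> cell_le c0 c \<and> cell_le c c2} = A \<union> B"
  proof (intro subset_antisym subsetI)
    fix c assume c: "c \<in> {c\<in>X. cell_dim c = 1 \<and> cell_le c0 c \<and> cell_le c c2}"
    obtain F S where FS: "c = (F, S)" by (cases c)
    have F: "F \<in> K" "S face_of P" "F \<subseteq> S" "F face_of \<tau>" "\<sigma> face_of F" "R \<subseteq> S" "S \<subseteq> Q"
      and dF: "aff_dim S = aff_dim F + 1"
      using c FS tR sQ cell_dim_X[of c] by (auto simp: mem_X cell_le_def)
    obtain m p where sim': "m simplex F" "p simplex S"
      using simplex_K[OF F(1)] simplex_face_P[OF F(2)] by blast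
    note card' = simplex_card[OF sim'(1)] simplex_card[OF sim'(2)]
    have VF: "vertices \<sigma> \<subseteq> vertices F" "vertices F \<subseteq> vertices \<tau>" "vertices R \<subseteq> vertices S"
      "vertices S \<subseteq> vertices Q"
      using F t s face_of_sub_face[of R S] face_of_sub_face[of S Q] by (auto simp: vertices_face_eq)
    show "c \<in> A \<union> B"
    proof (cases "F = \<tau>")
      case True
      then have "card (vertices S) = Suc (card (vertices R))"
        using card card' dim dF by simp
      then have "card (vertices S - vertices R) = 1"
        using VF(3) fin(3) by (simp add: card_Diff_subset)
      then obtain b where b: "vertices S - vertices R = {b}" by (auto simp: card_1_singleton_iff)
      then have "vertices S = insert b (vertices R)" using VF(3) by blast
      then have "S = convex hull (insert b (vertices R))" using simplex_vertices(3)[OF sim'(2)] by simp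
      moreover have "b \<in> vertices Q - vertices R" using b VF(4) by blast
      ultimately have "c \<in> B" unfolding B_def FS True by (intro image_eqI[of _ _ b]) auto
      then show ?thesis by blast
    next
      case False
      have "convex \<tau>" using sim(1) by (rule convex_simplex)
      then have "aff_dim F < aff_dim \<tau>" using face_of_aff_dim_lt F(4) False by blast
      moreover have "aff_dim R \<le> aff_dim S" using F(6) by (rule aff_dim_subset)
      ultimately have d: "aff_dim S = aff_dim R" "aff_dim \<tau> = aff_dim F + 1" using dF dim by linarith+
      have "R face_of S" by (rule face_of_sub_face[OF t(2) F(2) F(6)])
      moreover have "convex S" using F(2) by (rule face_of_imp_convex)
      ultimately have "R = S" using face_of_aff_dim_lt[of S R] d(1) by force
      have "card (vertices \<tau>) = Suc (card (vertices F))"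
        using card card' d by simp
      then have "card (vertices \<tau> - vertices F) = 1"
        using card_Diff_subset[OF finite_subset[OF VF(2) fin(1)] VF(2)] by simp
      then obtain b where b: "vertices \<tau> - vertices F = {b}" by (auto simp: card_1_singleton_iff)
      then have "vertices F = vertices \<tau> - {b}" using VF(2) by blast
      then have "F = convex hull (vertices \<tau> - {b})" using simplex_vertices(3)[OF sim'(1)] by simp
      moreover have "b \<in> vertices \<tau> - vertices \<sigma>" using b VF(1) by blast
      ultimately have "c \<in> A" unfolding A_def FS \<open>R = S\<close> by (intro image_eqI[of _ _ b]) auto
      then show ?thesis by blast
    qed
  next
    fix c assume "c \<in> A \<union> B"
    then show "c \<in> {c\<in>X. cell_dim c = 1 \<and> cell_le c0 c \<and> cell_le c c2}"
    proof
      assume "c \<in> A"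
      then obtain a where a: "a \<in> vertices \<tau>" "a \<notin> vertices \<sigma>"
        and c: "c = (convex hull (vertices \<tau> - {a}), R)" by (auto simp: A_def)
      define F where "F = convex hull (vertices \<tau> - {a})"
      have VF: "vertices F = vertices \<tau> - {a}"
        unfolding F_def by (rule vertices_hull_subset[OF sim(1)]) auto
      have f: "F face_of \<tau>" using simplex_face_iff[OF sim(1)] by (auto simp: F_def)
      then obtain m where m: "m simplex F" using simplex_face[OF sim(1)] by blast
      have "F \<in> K" using triangulates_face[OF K t(1) f] .
      moreover have "\<sigma> face_of F" using simplex_face_iff_vertices[OF m sim(2)] V(1) VF a by blast
      moreover have "aff_dim \<tau> = aff_dim F + 1"
        using simplex_card[OF m] card(1) VF a(1) fin(1) card_Suc_Diff1[of "vertices \<tau>" a] by simp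
      moreover have "aff_dim \<sigma> \<le> aff_dim F"
        using \<open>\<sigma> face_of F\<close> by (intro aff_dim_subset face_of_imp_subset)
      moreover have "F \<subseteq> \<tau>" using f by (rule face_of_imp_subset)
      ultimately show ?thesis unfolding c F_def[symmetric] tR sQ using f t s st dim
        by (auto simp: mem_X cell_le_def cell_dim_def)
    next
      assume "c \<in> B"
      then obtain b where b: "b \<in> vertices Q" "b \<notin> vertices R"
        and c: "c = (\<tau>, convex hull (insert b (vertices R)))" by (auto simp: B_def)
      define S where "S = convex hull (insert b (vertices R))"
      have VS: "vertices S = insert b (vertices R)"
        unfolding S_def by (rule vertices_hull_subset[OF sim(4)]) (use V b in auto)
      have f: "S face_of Q" unfolding S_def simplex_face_iff[OF sim(4)] using V b by blast
      then obtain m where m: "m simplex S" using simplex_face[OF sim(4)] by blast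
      have "R face_of S" using simplex_face_iff_vertices[OF m sim(3)] VS by blast
      then have "R \<subseteq> S" by (rule face_of_imp_subset)
      moreover have "S \<subseteq> Q" using f by (rule face_of_imp_subset)
      moreover have "S face_of P" using f s(2) by (rule face_of_trans)
      moreover have "aff_dim S = aff_dim R + 1"
        using simplex_card[OF m] card(3) VS b(2) fin(3) by simp
      moreover have "convex \<tau>" using sim(1) by (rule convex_simplex)
      moreover have "aff_dim \<tau> \<ge> 1" using c0(1) tR by (simp add: mem_X)
      ultimately show ?thesis unfolding c S_def[symmetric] tR sQ using t s st dim
        by (auto simp: mem_X cell_le_def cell_dim_def face_of_refl)
    qed
  qed
  have "inj_on (\<lambda>a. (convex hull (vertices \<tau> - {a}), R)) (vertices \<tau> - vertices \<sigma>)"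
  proof (rule inj_onI)
    fix a b assume ab: "a \<in> vertices \<tau> - vertices \<sigma>" "b \<in> vertices \<tau> - vertices \<sigma>"
      "(convex hull (vertices \<tau> - {a}), R) = (convex hull (vertices \<tau> - {b}), R)"
    then have "vertices (convex hull (vertices \<tau> - {a})) = vertices (convex hull (vertices \<tau> - {b}))"
      by simp
    then have "vertices \<tau> - {a} = vertices \<tau> - {b}"
      using vertices_hull_subset[OF sim(1)] by (metis Diff_subset)
    then show "a = b" using ab by blast
  qed
  then have cA: "card A = card (vertices \<tau> - vertices \<sigma>)" unfolding A_def by (rule card_image)
  have "inj_on (\<lambda>b. (\<tau>, convex hull (insert b (vertices R)))) (vertices Q - vertices R)"
  proof (rule inj_onI)
    fix a b assume ab: "a \<in> vertices Q - vertices R" "b \<in> vertices Q - vertices R"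
      "(\<tau>, convex hull (insert a (vertices R))) = (\<tau>, convex hull (insert b (vertices R)))"
    then have "vertices (convex hull (insert a (vertices R))) = vertices (convex hull (insert b (vertices R)))"
      by simp
    moreover have "insert a (vertices R) \<subseteq> vertices Q" "insert b (vertices R) \<subseteq> vertices Q"
      using ab V by auto
    ultimately have "insert a (vertices R) = insert b (vertices R)"
      using vertices_hull_subset[OF sim(4)] by metis
    then show "a = b" using ab by blast
  qed
  then have cB: "card B = card (vertices Q - vertices R)" unfolding B_def by (rule card_image)
  have disj: "A \<inter> B = {}"
  proof -
    have False if "c \<in> A" "c \<in> B" for c
    proof -
      obtain a where a: "a \<in> vertices \<tau>" "\<tau> = convex hull (vertices \<tau> - {a})"
        using \<open>c \<in> A\<close> \<open>c \<in> B\<close> by (auto simp: A_def B_def)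
      have "vertices (convex hull (vertices \<tau> - {a})) = vertices \<tau> - {a}"
        by (rule vertices_hull_subset[OF sim(1)]) auto
      with a show False by auto
    qed
    then show ?thesis by blast
  qed
  have "card (A \<union> B) = card A + card B"
    using disj fin by (intro card_Un_disjoint) (auto simp: A_def B_def)
  also have "\<dots> = (card (vertices \<tau>) - card (vertices \<sigma>)) + (card (vertices Q) - card (vertices R))"
    unfolding cA cB using V fin by (simp add: card_Diff_subset)
  also have "\<dots> = 2"
    using dim card card_mono[OF fin(1) V(1)] card_mono[OF fin(4) V(2)] by linarith
  finally show ?thesis unfolding eq .
qed

end

subsection \<open>Cochains on subcomplexes\<close>

lemma transition_W1 [simp]: "transition W1 c' c u = u"
  by (simp add: W1_def)

lemma transition_N2 [simp]: "transition N2_sheaf c' c u = u"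
  by (simp add: N2_sheaf_def)

lemma stalk_W1: "stalk W1 c = mod2 ` {u \<in> lattice_N. \<forall>t\<in>tangent (fst c). t \<bullet> u = 0}"
  by (simp add: W1_def)

lemma cochainsD:
  assumes "s \<in> cochains X G q"
  shows "c \<in> X \<Longrightarrow> cell_dim c = q \<Longrightarrow> s c \<in> stalk G c"
    and "c \<notin> X \<or> cell_dim c \<noteq> q \<Longrightarrow> s c = 0"
  using assms by (auto simp only: cochains_def mem_Collect_eq dest!: spec[of _ c] split: if_splits)

definition down_closed :: "'a::euclidean_space cell set \<Rightarrow> 'a cell set \<Rightarrow> bool" where
  "down_closed B A \<longleftrightarrow> A \<subseteq> B \<and> (\<forall>c\<in>A. \<forall>c'\<in>B. cell_le c' c \<longrightarrow> c' \<in> A)"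

lemma coboundary_restrict:
  assumes "down_closed B A"
  shows "coboundary A W1 q (restrict_cochain A s) = restrict_cochain A (coboundary B W1 q s)"
proof
  fix c
  show "coboundary A W1 q (restrict_cochain A s) c = restrict_cochain A (coboundary B W1 q s) c"
  proof (cases "c \<in> A")
    case True
    then have "{c'\<in>A. cell_dim c' = q \<and> cell_le c' c} = {c'\<in>B. cell_dim c' = q \<and> cell_le c' c}"
      "c \<in> B"
      using assms by (auto simp: down_closed_def)
    moreover have "(\<Sum>c'\<in>{c'\<in>A. cell_dim c' = q \<and> cell_le c' c}. restrict_cochain A s c')
        = (\<Sum>c'\<in>{c'\<in>A. cell_dim c' = q \<and> cell_le c' c}. s c')"
      by (intro sum.cong) (auto simp: restrict_cochain_def)
    ultimately show ?thesis using True by (simp add: coboundary_def restrict_cochain_def)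
  qed (simp add: coboundary_def restrict_cochain_def)
qed

lemma restrict_cocycle:
  assumes "down_closed B A" "s \<in> cocycles B W1 q"
  shows "restrict_cochain A s \<in> cocycles A W1 q"
proof -
  have "A \<subseteq> B" using assms(1) by (simp add: down_closed_def)
  have s: "s \<in> cochains B W1 q" "coboundary B W1 q s = 0"
    using assms(2) by (auto simp: cocycles_def)
  have "restrict_cochain A s c \<in> stalk W1 c" if "c \<in> A" "cell_dim c = q" for c
    using cochainsD(1)[OF s(1), of c] that \<open>A \<subseteq> B\<close> by (auto simp: restrict_cochain_def)
  moreover have "restrict_cochain A s c = 0" if "\<not> (c \<in> A \<and> cell_dim c = q)" for c
    using cochainsD(2)[OF s(1), of c] that by (auto simp: restrict_cochain_def)
  ultimately have "restrict_cochain A s \<in> cochains A W1 q" by (simp add: cochains_def)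
  moreover have "coboundary A W1 q (restrict_cochain A s) = 0"
    unfolding coboundary_restrict[OF assms(1)] s(2) by (auto simp: restrict_cochain_def)
  ultimately show ?thesis by (simp add: cocycles_def)
qed

lemma cohomology_class_trivial:
  assumes "coboundaries A G q = {0}" "s \<in> cocycles A G q"
  shows "cohomology_class A G q s = {s}"
  using assms by (auto simp: cohomology_class_def cohomologous_def)

lemma Un_singleton_const:
  assumes "I \<noteq> {}" "\<And>i. i \<in> I \<Longrightarrow> f i = {b}"
  shows "(\<Union>i\<in>I. f i) = {b}"
  using assms by auto

subsection \<open>The Hessian of a vertex indicator\<close>

context unimodular_triangulation
begin

text \<open>A function on the vertices of a simplex, up to constants, is the restriction of a covector modulo
  two; \<open>covector\<close> chooses one, which is unique on simplices of full dimension.\<close>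

definition is_covector :: "('a \<Rightarrow> bit) \<Rightarrow> 'a set \<Rightarrow> ('a \<Rightarrow> bit) \<Rightarrow> bool" where
  "is_covector \<epsilon> \<tau> u \<longleftrightarrow> u \<in> N2 \<and>
     (\<forall>a\<in>vertices \<tau>. \<forall>b\<in>vertices \<tau>. pairing a u + pairing b u = \<epsilon> a + \<epsilon> b)"

definition covector :: "('a \<Rightarrow> bit) \<Rightarrow> 'a set \<Rightarrow> 'a \<Rightarrow> bit" where
  "covector \<epsilon> \<tau> = (SOME u. is_covector \<epsilon> \<tau> u)"

lemma is_covector_covector:
  assumes "\<tau> \<in> K"
  shows "is_covector \<epsilon> \<tau> (covector \<epsilon> \<tau>)"
proof -
  have V: "vertices \<tau> \<subseteq> lattice_M" "extends_int (vertices \<tau>)"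
    using uni[OF assms] by (auto simp: unimodular_def)
  obtain u k where u: "u \<in> lattice_N" "k \<in> \<int>" "\<And>a. a \<in> vertices \<tau> \<Longrightarrow> a \<bullet> u + k = of_bool (\<epsilon> a = 1)"
    by (rule extends_intE[OF V(2), of "\<lambda>a. of_bool (\<epsilon> a = 1)"]) auto
  have val: "pairing a (mod2 u) + parity k = \<epsilon> a" if "a \<in> vertices \<tau>" for a
  proof -
    have "a \<in> lattice_M" using V(1) that by blast
    then have "pairing a (mod2 u) + parity k = parity (a \<bullet> u + k)"
      using u(1,2) by (simp add: pairing_mod2 parity_add inner_lattice)
    also have "\<dots> = parity (of_bool (\<epsilon> a = 1))" using u(3)[OF that] by simp
    also have "\<dots> = \<epsilon> a" by (cases "\<epsilon> a") simp_all
    finally show ?thesis .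
  qed
  have "pairing a (mod2 u) + pairing b (mod2 u) = \<epsilon> a + \<epsilon> b"
    if "a \<in> vertices \<tau>" "b \<in> vertices \<tau>" for a b
  proof -
    have "\<epsilon> a + \<epsilon> b = (pairing a (mod2 u) + pairing b (mod2 u)) + (parity k + parity k)"
      using val[OF that(1)] val[OF that(2)] by (metis add.assoc add.commute)
    then show ?thesis by simp
  qed
  then have "is_covector \<epsilon> \<tau> (mod2 u)" using u(1) by (auto simp: is_covector_def N2_def)
  then show ?thesis unfolding covector_def by (rule someI[of "is_covector \<epsilon> \<tau>"])
qed

definition full :: "'a set \<Rightarrow> bool" where
  "full \<tau> \<longleftrightarrow> \<tau> \<in> K \<and> card (vertices \<tau>) = DIM('a) + 1"

lemma is_covector_unique:
  assumes "full \<tau>" "is_covector \<epsilon> \<tau> u" "is_covector \<epsilon> \<tau> u'"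
  shows "u = u'"
proof -
  have \<tau>: "\<tau> \<in> K" "card (vertices \<tau>) = DIM('a) + 1" using assms(1) by (auto simp: full_def)
  obtain k where k: "k simplex \<tau>" using simplex_K[OF \<tau>(1)] by blast
  have "u + u' = 0"
  proof (rule unimodular_N2_zero[OF uni[OF \<tau>(1)] k \<tau>(2)])
    show "u + u' \<in> N2" using assms by (auto simp: is_covector_def intro: N2_add)
    fix a b assume "a \<in> vertices \<tau>" "b \<in> vertices \<tau>"
    then have "pairing a u + pairing b u = pairing a u' + pairing b u'"
      using assms by (auto simp: is_covector_def)
    then have "(pairing a u + pairing b u) + (pairing a u' + pairing b u') = 0" by simp
    then have "(pairing a u + pairing a u') + (pairing b u + pairing b u') = 0" by (simp add: ac_simps)
    then show "pairing a (u + u') = pairing b (u + u')"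
      by (simp only: bit_add_eq_0_iff pairing_add_right)
  qed
  then show ?thesis by (simp only: fun_bit_add_eq_0_iff)
qed

text \<open>The coboundary of a lifting of \<open>d \<epsilon>\<close> to \<open>N\<^sub>2\<close>.\<close>

definition hess :: "('a \<Rightarrow> bit) \<Rightarrow> 'a cell \<Rightarrow> 'a \<Rightarrow> bit" where
  "hess \<epsilon> = coboundary X N2_sheaf 0 (\<lambda>c. covector \<epsilon> (fst c))"

definition lifting :: "('a \<Rightarrow> bit) \<Rightarrow> ('a cell \<Rightarrow> 'a \<Rightarrow> bit) \<Rightarrow> bool" where
  "lifting \<epsilon> t \<longleftrightarrow> t \<in> cochains X N2_sheaf 0 \<and>
     (\<forall>c\<in>X. cell_dim c = 0 \<longrightarrow> is_covector \<epsilon> (fst c) (t c))"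

text \<open>In the double sum every \<open>0\<close>-cell is counted once for each of the two intermediate \<open>1\<close>-cells.\<close>

lemma coboundary_coboundary:
  "coboundary X W1 (Suc 0) (coboundary X N2_sheaf 0 t) = (0 :: 'a cell \<Rightarrow> 'a \<Rightarrow> bit)"
proof
  fix c
  show "coboundary X W1 (Suc 0) (coboundary X N2_sheaf 0 t) c = (0 :: 'a cell \<Rightarrow> 'a \<Rightarrow> bit) c"
  proof (cases "c \<in> X \<and> cell_dim c = 2")
    case True
    define C1 where "C1 = {c'\<in>X. cell_dim c' = Suc 0 \<and> cell_le c' c}"
    define C0 where "C0 = {c'\<in>X. cell_dim c' = 0}"
    have fin: "finite C1" "finite C0" using finite_X by (auto simp: C1_def C0_def)
    have "coboundary X W1 (Suc 0) (coboundary X N2_sheaf 0 t) c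
        = (\<Sum>c1\<in>C1. \<Sum>c0\<in>{c0\<in>C0. cell_le c0 c1}. t c0)"
    proof -
      have "coboundary X N2_sheaf 0 t c1 = (\<Sum>c0\<in>{c0\<in>C0. cell_le c0 c1}. t c0)" if "c1 \<in> C1" for c1
      proof -
        have "{c'\<in>X. cell_dim c' = 0 \<and> cell_le c' c1} = {c0\<in>C0. cell_le c0 c1}"
          by (auto simp: C0_def)
        then show ?thesis using that by (simp add: coboundary_def C1_def)
      qed
      then have "(\<Sum>c1\<in>C1. coboundary X N2_sheaf 0 t c1)
          = (\<Sum>c1\<in>C1. \<Sum>c0\<in>{c0\<in>C0. cell_le c0 c1}. t c0)" by (intro sum.cong) auto
      moreover have "coboundary X W1 (Suc 0) (coboundary X N2_sheaf 0 t) c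
          = (\<Sum>c1\<in>C1. coboundary X N2_sheaf 0 t c1)"
        using True unfolding coboundary_def[of X W1] C1_def by simp
      ultimately show ?thesis by simp
    qed
    also have "\<dots> = (\<Sum>c0\<in>C0. \<Sum>c1\<in>{c1\<in>C1. cell_le c0 c1}. t c0)"
      using fin by (rule sum.swap_restrict)
    also have "\<dots> = (\<Sum>c0\<in>C0. 0)"
    proof (rule sum.cong)
      fix c0 assume c0: "c0 \<in> C0"
      show "(\<Sum>c1\<in>{c1\<in>C1. cell_le c0 c1}. t c0) = 0"
      proof (cases "cell_le c0 c")
        case le: True
        have "{c1\<in>C1. cell_le c0 c1} = {c'\<in>X. cell_dim c' = 1 \<and> cell_le c0 c' \<and> cell_le c' c}"
          by (auto simp: C1_def)
        then show ?thesis
          using card_1_cells_between[of c0 c] c0 True le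
          by (intro sum_const_card_2) (simp add: C0_def)
      next
        case False
        then have "{c1\<in>C1. cell_le c0 c1} = {}" using cell_le_trans[of c0 _ c] unfolding C1_def by blast
        then show ?thesis by (simp only: sum.empty)
      qed
    qed auto
    finally show ?thesis by (simp only: sum.neutral_const zero_fun_apply)
  next
    case False
    then show ?thesis by (auto simp: coboundary_def fun_eq_iff)
  qed
qed

text \<open>The two covectors at the ends of a \<open>1\<close>-cell \<open>(F, Q)\<close> both lift \<open>d \<epsilon>\<close> on \<open>F\<close>, so their sum is constant on the
  vertices of \<open>F\<close>.\<close>

lemma coboundary_lifting:
  assumes t: "lifting \<epsilon> t"
  shows "coboundary X N2_sheaf 0 t \<in> cocycles X W1 (Suc 0)"
proof -
  have "coboundary X N2_sheaf 0 t c \<in> stalk W1 c" if c: "c \<in> X" "cell_dim c = Suc 0" for c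
  proof -
    define C where "C = {c'\<in>X. cell_dim c' = 0 \<and> cell_le c' c}"
    have C2: "card C = 2" using card_0_cells c by (simp add: C_def)
    have cob: "coboundary X N2_sheaf 0 t c = (\<Sum>c'\<in>C. t c')"
      using c by (simp add: coboundary_def C_def)
    have Fc: "fst c \<in> K" using c by (simp add: mem_X)
    obtain k where k: "k simplex (fst c)" using simplex_K[OF Fc] by blast
    show ?thesis unfolding cob stalk_W1
    proof (rule W1_stalkI[OF uni[OF Fc] k])
      show "(\<Sum>c'\<in>C. t c') \<in> N2"
        using t by (intro N2_sum) (auto simp: C_def lifting_def is_covector_def)
      fix a b assume ab: "a \<in> vertices (fst c)" "b \<in> vertices (fst c)"
      have "pairing a (t c') + pairing b (t c') = \<epsilon> a + \<epsilon> b" if "c' \<in> C" for c'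
        using t that ab by (auto simp: C_def lifting_def is_covector_def cell_le_def vertices_face_eq)
      then have "(\<Sum>c'\<in>C. pairing a (t c') + pairing b (t c')) = (\<Sum>c'\<in>C. \<epsilon> a + \<epsilon> b)"
        by (intro sum.cong) auto
      also have "\<dots> = 0"
      proof -
        obtain x y where "C = {x, y}" "x \<noteq> y" using C2 unfolding card_2_iff by blast
        then show ?thesis by simp
      qed
      finally have "(\<Sum>c'\<in>C. pairing a (t c')) + (\<Sum>c'\<in>C. pairing b (t c')) = 0"
        by (simp add: sum.distrib)
      then show "pairing a (\<Sum>c'\<in>C. t c') = pairing b (\<Sum>c'\<in>C. t c')"
        by (simp only: pairing_sum_right bit_add_eq_0_iff)
    qed
  qed
  then have "coboundary X N2_sheaf 0 t \<in> cochains X W1 (Suc 0)"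
    by (auto simp: cochains_def coboundary_def)
  then show ?thesis using coboundary_coboundary by (simp add: cocycles_def)
qed

lemma z_map_eq_iff:
  assumes "c \<in> X" "cell_dim c = 0" "u \<in> N2"
  shows "z_map c u = d_section P K \<epsilon> c \<longleftrightarrow> is_covector \<epsilon> (fst c) u"
proof -
  obtain k where k: "k simplex (fst c)" using simplex_K assms(1) by (auto simp: mem_X)
  show ?thesis
    using assms unfolding z_map_def d_section_def is_covector_def
    by (simp add: restrict_simplicial_d_eq_iff[OF k])
qed

lemma d_section_cocycle: "d_section P K \<epsilon> \<in> cocycles X Z1_sheaf 0"
proof -
  have "d_section P K \<epsilon> c \<in> stalk Z1_sheaf c" if c: "c \<in> X" "cell_dim c = 0" for c
  proof -
    obtain k where k: "k simplex (fst c)" using simplex_K c(1) by (auto simp: mem_X)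
    then show ?thesis using c simplicial_d_cocycle[OF k] by (simp add: d_section_def Z1_sheaf_def)
  qed
  then have "d_section P K \<epsilon> \<in> cochains X Z1_sheaf 0"
    by (auto simp: cochains_def d_section_def)
  moreover have "coboundary X Z1_sheaf 0 (d_section P K \<epsilon>) c = 0" for c
  proof (cases "c \<in> X \<and> cell_dim c = 1")
    case True
    define C where "C = {c'\<in>X. cell_dim c' = 0 \<and> cell_le c' c}"
    have C2: "card C = 2" using card_0_cells True by (simp add: C_def)
    have "coboundary X Z1_sheaf 0 (d_section P K \<epsilon>) c
        = (\<Sum>c'\<in>C. restrict_to_edges (fst c) (d_section P K \<epsilon> c'))"
      using True by (simp add: coboundary_def C_def Z1_sheaf_def)
    also have "\<dots> = (\<Sum>c'\<in>C. restrict_to_edges (fst c) (simplicial_d \<epsilon>))"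
    proof (rule sum.cong)
      fix c' assume "c' \<in> C"
      then have "edges (fst c) \<subseteq> edges (fst c')" "c' \<in> X" "cell_dim c' = 0"
        using edges_face by (auto simp: C_def cell_le_def)
      then show "restrict_to_edges (fst c) (d_section P K \<epsilon> c')
          = restrict_to_edges (fst c) (simplicial_d \<epsilon>)"
        by (auto simp: restrict_to_edges_def d_section_def fun_eq_iff)
    qed auto
    also have "\<dots> = 0" using C2 by (rule sum_const_card_2)
    finally show ?thesis .
  qed (auto simp: coboundary_def)
  ultimately show ?thesis by (simp add: cocycles_def fun_eq_iff)
qed

lemma hessian_eq:
  "hessian P K \<epsilon> = (\<Union>t\<in>{t. lifting \<epsilon> t}. cohomology_class X W1 (Suc 0) (coboundary X N2_sheaf 0 t))"
proof -
  have "cohomology_class X Z1_sheaf 0 (d_section P K \<epsilon>) = {d_section P K \<epsilon>}"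
    by (rule cohomology_class_trivial[OF _ d_section_cocycle]) (simp add: coboundaries_def)
  moreover have "{t \<in> cochains X N2_sheaf 0. \<forall>c\<in>X. cell_dim c = 0 \<longrightarrow> z_map c (t c) = d_section P K \<epsilon> c}
      = {t. lifting \<epsilon> t}"
  proof -
    have "t c \<in> N2" if "t \<in> cochains X N2_sheaf 0" "c \<in> X" "cell_dim c = 0" for t c
      using cochainsD(1)[OF that] by (simp add: N2_sheaf_def)
    then show ?thesis unfolding lifting_def using z_map_eq_iff by blast
  qed
  ultimately show ?thesis unfolding hessian_def connecting_def by simp
qed

lemma lifting_covector:
  "lifting \<epsilon> (\<lambda>c. if c \<in> X \<and> cell_dim c = 0 then covector \<epsilon> (fst c) else 0)"
  using is_covector_covector
  by (auto simp: lifting_def cochains_def N2_sheaf_def mem_X is_covector_def)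

lemma hess_cocycle: "hess \<epsilon> \<in> cocycles X W1 (Suc 0)"
proof -
  have "coboundary X N2_sheaf 0 (\<lambda>c. if c \<in> X \<and> cell_dim c = 0 then covector \<epsilon> (fst c) else 0)
      = hess \<epsilon>"
    unfolding hess_def coboundary_def by (intro ext if_cong refl sum.cong) auto
  then show ?thesis using coboundary_lifting[OF lifting_covector[of \<epsilon>]] by simp
qed

subsection \<open>Dual cells of interior vertices\<close>

abbreviation D where "D v \<equiv> boundary_dual_cell P K {v}"

lemma face_through_interior:
  assumes "v \<in> interior P" "Q face_of P" "v \<in> Q"
  shows "Q = P"
  using face_of_disjoint_interior[of Q P] assms by blast

lemma interior_vertex_iff: "interior_vertex P K v \<longleftrightarrow> {v} \<in> K \<and> v \<in> interior P"
proof -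
  have "closed P" using P by (rule closed_simplex)
  then show ?thesis using triangulates_subset[OF K, of "{v}"]
    by (auto simp: interior_vertex_def frontier_def)
qed

lemma mem_D:
  assumes v: "interior_vertex P K v"
  shows "c \<in> D v \<longleftrightarrow> c \<in> X \<and> snd c = P \<and> v \<in> vertices (fst c)"
proof -
  obtain \<sigma> Q where c: "c = (\<sigma>, Q)" by (cases c)
  have vP: "{v} \<in> K" "v \<in> interior P" using v by (auto simp: interior_vertex_iff)
  have eq: "{v} face_of \<sigma> \<longleftrightarrow> v \<in> vertices \<sigma>" by (simp add: vertices_def face_of_singleton)
  have QP: "Q = P" if "Q face_of P" "\<sigma> \<subseteq> Q" "v \<in> vertices \<sigma>"
    using that face_through_interior[OF vP(2)] vertices_subset by blast
  have dim: "aff_dim \<sigma> \<ge> 1 \<longleftrightarrow> \<sigma> \<noteq> {v}" if s: "\<sigma> \<in> K" "v \<in> vertices \<sigma>"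
  proof
    assume "\<sigma> \<noteq> {v}"
    obtain k where k: "k simplex \<sigma>" using simplex_K[OF s(1)] by blast
    have "vertices \<sigma> \<noteq> {v}" using simplex_vertices(3)[OF k] \<open>\<sigma> \<noteq> {v}\<close> by auto
    then have "card (vertices \<sigma>) \<noteq> 1" using s(2) by (auto simp: card_1_singleton_iff)
    moreover have "card (vertices \<sigma>) \<noteq> 0" using s(2) simplex_vertices(2)[OF k] by auto
    ultimately show "aff_dim \<sigma> \<ge> 1" using card_K[OF s(1)] by linarith
  qed auto
  have "P face_of P" using simplex_imp_polytope[OF P] polytope_imp_convex face_of_refl by blast
  then show ?thesis unfolding c
    using QP dim eq face_of_imp_subset[of Q P] vP(1) triangulates_subset[OF K vP(1)]
    by (auto simp: boundary_dual_cell_def dual_cell_def cells_Y_def cell_le_def mem_X)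
qed

lemma D_down_closed:
  assumes v: "interior_vertex P K v"
  shows "down_closed X (D v)"
proof -
  have "c' \<in> D v" if c: "c \<in> D v" "c' \<in> X" "cell_le c' c" for c c'
  proof -
    have "v \<in> vertices (fst c')" using c by (auto simp: mem_D[OF v] cell_le_def vertices_face_eq)
    moreover have "snd c' = P"
      using c \<open>v \<in> vertices (fst c')\<close> vertices_subset[of "fst c'"] v face_through_interior[of v "snd c'"]
      by (auto simp: mem_X interior_vertex_iff)
    ultimately show ?thesis using c by (simp add: mem_D[OF v])
  qed
  moreover have "D v \<subseteq> X" using mem_D[OF v] by blast
  ultimately show ?thesis unfolding down_closed_def by blast
qed

lemma X0_eq: "cells_X0 P K = (\<Union>v\<in>{v. interior_vertex P K v}. D v)"
proof -
  have "X \<inter> dual_cell P K {v} = D v" if v: "interior_vertex P K v" for v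
  proof -
    have "({v}, P) \<notin> X" by (simp add: mem_X)
    then show ?thesis using mem_D[OF v] by (auto simp: boundary_dual_cell_def)
  qed
  then show ?thesis unfolding cells_X0_def by auto
qed

lemma X0_down_closed: "down_closed X (cells_X0 P K)"
proof -
  have D: "D v \<subseteq> X \<and> (\<forall>c\<in>D v. \<forall>c'\<in>X. cell_le c' c \<longrightarrow> c' \<in> D v)" if "interior_vertex P K v" for v
    using D_down_closed[OF that] by (simp add: down_closed_def)
  show ?thesis unfolding down_closed_def X0_eq
  proof (intro conjI ballI impI)
    show "(\<Union>v\<in>{v. interior_vertex P K v}. D v) \<subseteq> X" using D by blast
    fix c c' assume "c \<in> (\<Union>v\<in>{v. interior_vertex P K v}. D v)" "c' \<in> X" "cell_le c' c"
    then obtain v where v: "interior_vertex P K v" "c \<in> D v" by blast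
    then have "c' \<in> D v" using D \<open>c' \<in> X\<close> \<open>cell_le c' c\<close> by blast
    then show "c' \<in> (\<Union>v\<in>{v. interior_vertex P K v}. D v)" using v(1) by blast
  qed
qed

lemma D_down_closed_X0:
  assumes v: "interior_vertex P K v"
  shows "down_closed (cells_X0 P K) (D v)"
proof -
  have "D v \<subseteq> cells_X0 P K" using v by (auto simp: X0_eq)
  moreover have "cells_X0 P K \<subseteq> X" by (auto simp: cells_X0_def)
  ultimately show ?thesis using D_down_closed[OF v] unfolding down_closed_def by blast
qed

lemma top_cell_full:
  assumes "c \<in> X" "snd c = P" "cell_dim c = 0"
  shows "full (fst c)"
proof -
  have "aff_dim P = int DIM('a)" using P by (rule aff_dim_simplex)
  then have "aff_dim (fst c) = int DIM('a)" using cell_dim_X[OF assms(1)] assms by simp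
  then show ?thesis using assms card_K[of "fst c"] by (auto simp: full_def mem_X)
qed

text \<open>Waves vanish on simplices of full dimension, so there are no \<open>0\<close>-cochains near interior
  vertices and cocycles of degree one can be identified with their classes.\<close>

lemma cochain_0_top:
  assumes "r \<in> cochains A W1 0" "c \<in> X" "snd c = P" "cell_dim c = 0"
  shows "r c = 0"
proof (cases "c \<in> A")
  case True
  obtain k where k: "k simplex (fst c)" using simplex_K assms(2) by (auto simp: mem_X)
  have "r c \<in> stalk W1 c" using cochainsD(1)[OF assms(1) True] assms(4) by simp
  moreover have "full (fst c)" using assms top_cell_full by blast
  ultimately show ?thesis
    using W1_stalk_full[OF uni k] by (simp add: stalk_W1 full_def)
next
  case False
  then show ?thesis using cochainsD(2)[OF assms(1)] by blast
qed

lemma coboundaries_trivial: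
  assumes A: "A \<subseteq> X" "\<And>c. c \<in> A \<Longrightarrow> snd c = P"
  shows "coboundaries A W1 (Suc 0) = {0}"
proof -
  have "coboundary A W1 0 r = 0" if r: "r \<in> cochains A W1 0" for r
  proof
    fix c
    have "r c' = 0" if "c' \<in> A" "cell_dim c' = 0" for c'
      using cochain_0_top[OF r] that A by blast
    then show "coboundary A W1 0 r c = (0 :: 'a cell \<Rightarrow> 'a \<Rightarrow> bit) c"
      unfolding coboundary_def transition_W1 zero_fun_apply
      by (auto intro!: sum.neutral simp del: sum_fun_apply)
  qed
  moreover have "0 \<in> cochains A W1 0"
    by (auto simp: cochains_def stalk_W1 lattice_N_0 intro!: image_eqI[of _ _ 0])
  ultimately show ?thesis by (force simp: coboundaries_def)
qed

lemma coboundaries_D: "interior_vertex P K v \<Longrightarrow> coboundaries (D v) W1 (Suc 0) = {0}"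
  using mem_D by (intro coboundaries_trivial) auto

lemma coboundaries_X0: "coboundaries (cells_X0 P K) W1 (Suc 0) = {0}"
  using mem_D by (intro coboundaries_trivial) (auto simp: X0_eq)

text \<open>Another representative or another lifting changes the cocycle by the coboundary of a \<open>0\<close>-cochain of
  waves, and these vanish near an interior vertex.\<close>

lemma restrict_hessian:
  assumes v: "interior_vertex P K v"
  shows "restrict_class (D v) W1 1 (hessian P K \<epsilon>) = {restrict_cochain (D v) (hess \<epsilon>)}"
  unfolding restrict_class_def One_nat_def
proof (rule Un_singleton_const)
  have "hess \<epsilon> \<in> cohomology_class X W1 (Suc 0) (hess \<epsilon>)"
  proof -
    have "0 \<in> cochains X W1 0"
      by (auto simp: cochains_def stalk_W1 lattice_N_0 intro!: image_eqI[of _ _ 0])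
    moreover have "coboundary X W1 0 0 = (0 :: 'a cell \<Rightarrow> 'a \<Rightarrow> bit)"
      by (auto simp: coboundary_def fun_eq_iff sum_fun_apply)
    ultimately have "0 \<in> coboundaries X W1 (Suc 0)" by (force simp: coboundaries_def)
    then show ?thesis using hess_cocycle by (simp add: cohomology_class_def cohomologous_def)
  qed
  moreover have "coboundary X N2_sheaf 0 (\<lambda>c. if c \<in> X \<and> cell_dim c = 0 then covector \<epsilon> (fst c) else 0)
      = hess \<epsilon>"
    unfolding hess_def coboundary_def by (intro ext if_cong refl sum.cong) auto
  ultimately have "hess \<epsilon> \<in> hessian P K \<epsilon>"
    unfolding hessian_eq using lifting_covector by fastforce
  then show "hessian P K \<epsilon> \<noteq> {}" by blast
next
  fix s assume "s \<in> hessian P K \<epsilon>"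
  then obtain t where t: "lifting \<epsilon> t"
    and s: "s \<in> cohomology_class X W1 (Suc 0) (coboundary X N2_sheaf 0 t)"
    unfolding hessian_eq by blast
  then obtain r where s_coc: "s \<in> cocycles X W1 (Suc 0)" and r: "r \<in> cochains X W1 0"
    "coboundary X N2_sheaf 0 t - s = coboundary X W1 0 r"
    by (auto simp: cohomology_class_def cohomologous_def coboundaries_def)
  have "s c = hess \<epsilon> c" if c: "c \<in> D v" for c
  proof (cases "cell_dim c = Suc 0")
    case False
    have "s \<in> cochains X W1 (Suc 0)" "hess \<epsilon> \<in> cochains X W1 (Suc 0)"
      using s_coc hess_cocycle by (auto simp: cocycles_def)
    then show ?thesis using False cochainsD(2) by metis
  next
    case True
    define C where "C = {c'\<in>X. cell_dim c' = 0 \<and> cell_le c' c}"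
    have cX: "c \<in> X" using c mem_D[OF v] by blast
    have C: "c' \<in> D v" if "c' \<in> C" for c'
      using D_down_closed[OF v] c that by (auto simp: down_closed_def C_def)
    have "coboundary X W1 0 r c = (\<Sum>c'\<in>C. r c')"
      using True cX by (simp add: coboundary_def C_def)
    also have "\<dots> = 0"
    proof (rule sum.neutral, rule ballI)
      fix c' assume "c' \<in> C"
      then show "r c' = 0"
        using C[of c'] cochain_0_top[OF r(1), of c'] mem_D[OF v] by (auto simp: C_def)
    qed
    finally have "coboundary X N2_sheaf 0 t c - s c = 0" using fun_cong[OF r(2), of c] by simp
    then have "s c = coboundary X N2_sheaf 0 t c" by (simp only: right_minus_eq)
    also have "\<dots> = (\<Sum>c'\<in>C. t c')" using True cX by (simp add: coboundary_def C_def)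
    also have "\<dots> = (\<Sum>c'\<in>C. covector \<epsilon> (fst c'))"
    proof (rule sum.cong)
      fix c' assume c': "c' \<in> C"
      then have "c' \<in> X" "snd c' = P" "cell_dim c' = 0"
        using C mem_D[OF v] by (auto simp: C_def)
      then have "full (fst c')" "is_covector \<epsilon> (fst c') (t c')"
        using top_cell_full t by (auto simp: lifting_def)
      then show "t c' = covector \<epsilon> (fst c')"
        using is_covector_unique is_covector_covector by (auto simp: full_def)
    qed auto
    also have "\<dots> = hess \<epsilon> c" using True cX by (simp add: hess_def coboundary_def C_def)
    finally show ?thesis .
  qed
  then have "restrict_cochain (D v) s = restrict_cochain (D v) (hess \<epsilon>)"
    by (auto simp: restrict_cochain_def)
  then show "cohomology_class (D v) W1 (Suc 0) (restrict_cochain (D v) s)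
      = {restrict_cochain (D v) (hess \<epsilon>)}"
    using cohomology_class_trivial[OF coboundaries_D[OF v] restrict_cocycle[OF D_down_closed[OF v] hess_cocycle]]
    by simp
qed

text \<open>Cocycles and classes agree near interior vertices, so \<open>\<rho>\<close> is glued from the values of the Hessians; the
  cocycle condition at a \<open>2\<close>-cell is the one for the Hessian of any interior vertex of it.\<close>

lemma rho_uniform_iff_hess:
  "rho_uniform P K \<longleftrightarrow> (\<forall>v w c. interior_vertex P K v \<longrightarrow> interior_vertex P K w \<longrightarrow>
     c \<in> D v \<inter> D w \<longrightarrow> hess (vertex_indicator v) c = hess (vertex_indicator w) c)"
    (is "_ \<longleftrightarrow> ?rhs")
proof
  assume "rho_uniform P K"
  then obtain \<rho> where \<rho>: "\<rho> \<in> cohomology (cells_X0 P K) W1 1"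
    "\<And>v. interior_vertex P K v \<Longrightarrow> restrict_class (D v) W1 1 \<rho> =
      restrict_class (D v) W1 1 (hessian P K (vertex_indicator v))"
    unfolding rho_uniform_def by blast
  then obtain s where s: "s \<in> cocycles (cells_X0 P K) W1 (Suc 0)"
    "\<rho> = cohomologous (cells_X0 P K) W1 (Suc 0) `` {s}"
    unfolding cohomology_def by (auto elim!: quotientE)
  have "\<rho> = {s}"
    using s(2) cohomology_class_trivial[OF coboundaries_X0 s(1)] by (simp add: cohomology_class_def)
  have "s c = hess (vertex_indicator v) c" if v: "interior_vertex P K v" "c \<in> D v" for v c
  proof -
    have "restrict_class (D v) W1 1 \<rho> = {restrict_cochain (D v) s}"
      unfolding restrict_class_def \<open>\<rho> = {s}\<close>
      using cohomology_class_trivial[OF coboundaries_D[OF v(1)]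
          restrict_cocycle[OF D_down_closed_X0[OF v(1)] s(1)]] by simp
    then have "restrict_cochain (D v) s = restrict_cochain (D v) (hess (vertex_indicator v))"
      using \<rho>(2)[OF v(1)] restrict_hessian[OF v(1)] by simp
    from fun_cong[OF this, of c] show ?thesis using v(2) by (simp add: restrict_cochain_def)
  qed
  note s_hess = this
  show ?rhs
  proof (intro allI impI)
    fix v w c assume "interior_vertex P K v" "interior_vertex P K w" "c \<in> D v \<inter> D w"
    then show "hess (vertex_indicator v) c = hess (vertex_indicator w) c"
      using s_hess[of v c] s_hess[of w c] by simp
  qed
next
  assume R: ?rhs
  define near where "near c = (SOME v. interior_vertex P K v \<and> c \<in> D v)" for c
  define s where "s = restrict_cochain (cells_X0 P K) (\<lambda>c. hess (vertex_indicator (near c)) c)"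
  have s_hess: "s c = hess (vertex_indicator v) c" if v: "interior_vertex P K v" "c \<in> D v" for v c
  proof -
    have "\<exists>v. interior_vertex P K v \<and> c \<in> D v" using v by blast
    then have "interior_vertex P K (near c) \<and> c \<in> D (near c)"
      unfolding near_def by (rule someI_ex)
    then have "hess (vertex_indicator (near c)) c = hess (vertex_indicator v) c"
      using R v by blast
    moreover have "c \<in> cells_X0 P K" using v X0_eq by blast
    ultimately show ?thesis by (simp add: s_def restrict_cochain_def)
  qed
  have X0X: "cells_X0 P K \<subseteq> X" by (auto simp: cells_X0_def)
  have hess: "hess \<epsilon> \<in> cochains X W1 (Suc 0)" "coboundary X W1 (Suc 0) (hess \<epsilon>) = 0" for \<epsilon>
    using hess_cocycle by (auto simp: cocycles_def)
  have "s c \<in> stalk W1 c" if c: "c \<in> cells_X0 P K" "cell_dim c = Suc 0" for c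
  proof -
    obtain v where v: "interior_vertex P K v" "c \<in> D v" using c X0_eq by blast
    have "c \<in> X" using c X0X by blast
    then show ?thesis using s_hess[OF v] cochainsD(1)[OF hess(1)] c(2) by simp
  qed
  moreover have "s c = 0" if "\<not> (c \<in> cells_X0 P K \<and> cell_dim c = Suc 0)" for c
  proof (cases "c \<in> cells_X0 P K")
    case True
    then obtain v where v: "interior_vertex P K v" "c \<in> D v" using X0_eq by blast
    then show ?thesis using s_hess[OF v] cochainsD(2)[OF hess(1)] that True by simp
  qed (simp add: s_def restrict_cochain_def)
  ultimately have s_cochain: "s \<in> cochains (cells_X0 P K) W1 (Suc 0)"
    by (simp add: cochains_def)
  have "coboundary (cells_X0 P K) W1 (Suc 0) s c = 0" for c
  proof (cases "c \<in> cells_X0 P K \<and> cell_dim c = Suc (Suc 0)")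
    case True
    then obtain v where v: "interior_vertex P K v" "c \<in> D v" using X0_eq by blast
    have sub: "{c'\<in>cells_X0 P K. cell_dim c' = Suc 0 \<and> cell_le c' c}
        = {c'\<in>X. cell_dim c' = Suc 0 \<and> cell_le c' c}"
      using X0_down_closed True by (auto simp: down_closed_def)
    have "coboundary (cells_X0 P K) W1 (Suc 0) s c
        = (\<Sum>c'\<in>{c'\<in>X. cell_dim c' = Suc 0 \<and> cell_le c' c}. s c')"
      using True by (simp add: coboundary_def sub)
    also have "\<dots> = (\<Sum>c'\<in>{c'\<in>X. cell_dim c' = Suc 0 \<and> cell_le c' c}. hess (vertex_indicator v) c')"
      using s_hess[OF v(1)] D_down_closed[OF v(1)] v(2)
      by (intro sum.cong) (auto simp: down_closed_def)
    also have "\<dots> = coboundary X W1 (Suc 0) (hess (vertex_indicator v)) c"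
      using True X0X by (auto simp: coboundary_def)
    also have "\<dots> = 0" using hess(2) by simp
    finally show ?thesis .
  qed (auto simp: coboundary_def)
  then have s: "s \<in> cocycles (cells_X0 P K) W1 (Suc 0)"
    using s_cochain by (simp add: cocycles_def fun_eq_iff)
  have cls: "cohomologous (cells_X0 P K) W1 (Suc 0) `` {s} = {s}"
    using cohomology_class_trivial[OF coboundaries_X0 s] by (simp add: cohomology_class_def)
  have "{s} \<in> cohomology (cells_X0 P K) W1 1"
    unfolding cohomology_def One_nat_def using quotientI[OF s] cls by metis
  moreover have "restrict_class (D v) W1 1 {s}
      = restrict_class (D v) W1 1 (hessian P K (vertex_indicator v))"
    if v: "interior_vertex P K v" for v
  proof -
    have "restrict_class (D v) W1 1 {s} = {restrict_cochain (D v) s}"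
      unfolding restrict_class_def
      using cohomology_class_trivial[OF coboundaries_D[OF v]
          restrict_cocycle[OF D_down_closed_X0[OF v] s]] by simp
    moreover have "restrict_cochain (D v) s = restrict_cochain (D v) (hess (vertex_indicator v))"
      using s_hess[OF v] by (auto simp: restrict_cochain_def)
    ultimately show ?thesis using restrict_hessian[OF v] by simp
  qed
  ultimately show "rho_uniform P K" unfolding rho_uniform_def by blast
qed

end

lemma parity_of_bool: "parity (of_bool (a = v)) = vertex_indicator v a"
  by (auto simp: vertex_indicator_def)

lemma Ints_of_bool: "of_bool b \<in> (\<int> :: real set)"
  by (cases b) auto

lemma parity_minus: "r \<in> \<int> \<Longrightarrow> s \<in> \<int> \<Longrightarrow> parity (r - s) = parity r + parity s"
proof -
  assume "r \<in> \<int>" "s \<in> \<int>"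
  then have "parity r = parity (r - s) + parity s" using parity_add[of "r - s" s] by simp
  then have "parity r + parity s = parity (r - s) + (parity s + parity s)" by (simp add: add.assoc)
  then show ?thesis by simp
qed

lemma even_affine_iff:
  assumes "V \<subseteq> lattice_M"
  shows "even_affine V v w \<longleftrightarrow> (\<exists>u\<in>N2. \<exists>k. \<forall>a\<in>V.
    pairing a u + k = vertex_indicator v a + vertex_indicator w a)"
proof -
  have iff: "(a \<bullet> u + k - of_bool (a = v) - of_bool (a = w)) / 2 \<in> \<int> \<longleftrightarrow>
      pairing a (mod2 u) + parity k = vertex_indicator v a + vertex_indicator w a"
    if "a \<in> V" "u \<in> lattice_N" "k \<in> \<int>" for a u k
  proof -
    have a: "a \<in> lattice_M" using assms that by blast
    then have au: "a \<bullet> u \<in> \<int>" using that inner_lattice by blast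
    have "parity (a \<bullet> u + k - of_bool (a = v) - of_bool (a = w))
        = pairing a (mod2 u) + parity k + vertex_indicator v a + vertex_indicator w a"
      using that a au by (simp only: parity_minus parity_add Ints_add Ints_diff Ints_of_bool
          parity_of_bool pairing_mod2)
    then have "parity (a \<bullet> u + k - of_bool (a = v) - of_bool (a = w)) = 0 \<longleftrightarrow>
        (pairing a (mod2 u) + parity k) + (vertex_indicator v a + vertex_indicator w a) = 0"
      by (simp only: add.assoc)
    moreover have I: "a \<bullet> u + k - of_bool (a = v) - of_bool (a = w) \<in> \<int>"
      using au that by (intro Ints_diff Ints_add Ints_of_bool)
    ultimately show ?thesis unfolding parity_eq_0_iff[OF I] bit_add_eq_0_iff by simp
  qed
  show ?thesis
  proof
    assume "even_affine V v w"
    then obtain u k where "u \<in> lattice_N" "k \<in> \<int>"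
      "\<forall>a\<in>V. (a \<bullet> u + k - of_bool (a = v) - of_bool (a = w)) / 2 \<in> \<int>"
      unfolding even_affine_def by blast
    then show "\<exists>u\<in>N2. \<exists>k. \<forall>a\<in>V. pairing a u + k = vertex_indicator v a + vertex_indicator w a"
      by (intro bexI[of _ "mod2 u"] exI[of _ "parity k"]) (auto simp: iff N2_def)
  next
    assume "\<exists>u\<in>N2. \<exists>k. \<forall>a\<in>V. pairing a u + k = vertex_indicator v a + vertex_indicator w a"
    then obtain u k where u: "u \<in> lattice_N"
      "\<forall>a\<in>V. pairing a (mod2 u) + k = vertex_indicator v a + vertex_indicator w a"
      unfolding N2_def by blast
    have "parity (of_bool (k = 1)) = k" by (cases k) simp_all
    then show "even_affine V v w"
      unfolding even_affine_def using u by (intro bexI[of _ u] bexI[of _ "of_bool (k = 1)"]) (auto simp: iff)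
  qed
qed

context unimodular_triangulation
begin

text \<open>The two sides of the equation below are the values at a common facet of the Hessians of \<open>v\<close> and \<open>w\<close>.
  They agree if and only if the covectors of \<open>\<chi>\<^sub>v + \<chi>\<^sub>w\<close> on both simplices agree.\<close>

lemma covector_sum_eq_iff:
  assumes full: "full \<tau>\<^sub>1" "full \<tau>\<^sub>2" and ne: "vertices \<tau>\<^sub>1 \<inter> vertices \<tau>\<^sub>2 \<noteq> {}"
  shows "covector (vertex_indicator v) \<tau>\<^sub>1 + covector (vertex_indicator v) \<tau>\<^sub>2 =
      covector (vertex_indicator w) \<tau>\<^sub>1 + covector (vertex_indicator w) \<tau>\<^sub>2 \<longleftrightarrow>
    even_affine (vertices \<tau>\<^sub>1 \<union> vertices \<tau>\<^sub>2) v w"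
proof -
  define ind where "ind a = vertex_indicator v a + vertex_indicator w a" for a
  define \<delta> where "\<delta> \<tau> = covector (vertex_indicator v) \<tau> + covector (vertex_indicator w) \<tau>" for \<tau>
  have tK: "\<tau>\<^sub>1 \<in> K" "\<tau>\<^sub>2 \<in> K" using full by (auto simp: full_def)
  have V: "vertices \<tau>\<^sub>1 \<union> vertices \<tau>\<^sub>2 \<subseteq> lattice_M"
    using uni[OF tK(1)] uni[OF tK(2)] by (auto simp: unimodular_def)
  have cov: "is_covector ind \<tau> (\<delta> \<tau>)" if "\<tau> \<in> K" for \<tau>
  proof -
    note c = is_covector_covector[OF that, of "vertex_indicator v"]
      is_covector_covector[OF that, of "vertex_indicator w"]
    have "pairing a (\<delta> \<tau>) + pairing b (\<delta> \<tau>) = ind a + ind b"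
      if "a \<in> vertices \<tau>" "b \<in> vertices \<tau>" for a b
    proof -
      have "pairing a (\<delta> \<tau>) + pairing b (\<delta> \<tau>)
         = (pairing a (covector (vertex_indicator v) \<tau>) + pairing b (covector (vertex_indicator v) \<tau>))
         + (pairing a (covector (vertex_indicator w) \<tau>) + pairing b (covector (vertex_indicator w) \<tau>))"
        unfolding \<delta>_def pairing_add_right by (simp only: ac_simps)
      also have "\<dots> = (vertex_indicator v a + vertex_indicator v b)
          + (vertex_indicator w a + vertex_indicator w b)"
        using c that by (simp add: is_covector_def)
      finally show ?thesis by (simp only: ind_def ac_simps)
    qed
    moreover have "\<delta> \<tau> \<in> N2" unfolding \<delta>_def using c by (intro N2_add) (auto simp: is_covector_def)
    ultimately show ?thesis by (simp add: is_covector_def)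
  qed
  have "covector (vertex_indicator v) \<tau>\<^sub>1 + covector (vertex_indicator v) \<tau>\<^sub>2 =
      covector (vertex_indicator w) \<tau>\<^sub>1 + covector (vertex_indicator w) \<tau>\<^sub>2 \<longleftrightarrow>
      (covector (vertex_indicator v) \<tau>\<^sub>1 + covector (vertex_indicator v) \<tau>\<^sub>2) +
      (covector (vertex_indicator w) \<tau>\<^sub>1 + covector (vertex_indicator w) \<tau>\<^sub>2) = 0"
    by (simp only: fun_bit_add_eq_0_iff)
  also have "\<dots> \<longleftrightarrow> \<delta> \<tau>\<^sub>1 + \<delta> \<tau>\<^sub>2 = 0" by (simp only: \<delta>_def ac_simps)
  also have "\<dots> \<longleftrightarrow> \<delta> \<tau>\<^sub>1 = \<delta> \<tau>\<^sub>2" by (simp only: fun_bit_add_eq_0_iff)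
  also have "\<dots> \<longleftrightarrow> even_affine (vertices \<tau>\<^sub>1 \<union> vertices \<tau>\<^sub>2) v w"
  proof
    assume eq: "\<delta> \<tau>\<^sub>1 = \<delta> \<tau>\<^sub>2"
    obtain b where b: "b \<in> vertices \<tau>\<^sub>1" "b \<in> vertices \<tau>\<^sub>2" using ne by blast
    have "pairing a (\<delta> \<tau>\<^sub>1) + (pairing b (\<delta> \<tau>\<^sub>1) + ind b) = ind a"
      if "a \<in> vertices \<tau>\<^sub>1 \<union> vertices \<tau>\<^sub>2" for a
    proof -
      have "pairing a (\<delta> \<tau>\<^sub>1) + pairing b (\<delta> \<tau>\<^sub>1) = ind a + ind b"
        using that b cov[OF tK(1)] cov[OF tK(2)] eq by (auto simp: is_covector_def)
      then have "(pairing a (\<delta> \<tau>\<^sub>1) + pairing b (\<delta> \<tau>\<^sub>1)) + ind b = ind a + (ind b + ind b)"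
        by (simp only: add.assoc)
      then show ?thesis by (simp add: add.assoc)
    qed
    moreover have "\<delta> \<tau>\<^sub>1 \<in> N2" using cov[OF tK(1)] by (simp add: is_covector_def)
    ultimately show "even_affine (vertices \<tau>\<^sub>1 \<union> vertices \<tau>\<^sub>2) v w"
      unfolding even_affine_iff[OF V] ind_def by blast
  next
    assume "even_affine (vertices \<tau>\<^sub>1 \<union> vertices \<tau>\<^sub>2) v w"
    then obtain u k where u: "u \<in> N2"
      "\<And>a. a \<in> vertices \<tau>\<^sub>1 \<union> vertices \<tau>\<^sub>2 \<Longrightarrow> pairing a u + k = ind a"
      unfolding even_affine_iff[OF V] ind_def by blast
    have "is_covector ind \<tau> u" if "\<tau> = \<tau>\<^sub>1 \<or> \<tau> = \<tau>\<^sub>2" for \<tau>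
    proof -
      have "pairing a u + pairing b u = ind a + ind b" if "a \<in> vertices \<tau>" "b \<in> vertices \<tau>" for a b
      proof -
        have ab: "a \<in> vertices \<tau>\<^sub>1 \<union> vertices \<tau>\<^sub>2" "b \<in> vertices \<tau>\<^sub>1 \<union> vertices \<tau>\<^sub>2"
          using that \<open>\<tau> = \<tau>\<^sub>1 \<or> \<tau> = \<tau>\<^sub>2\<close> by auto
        have "ind a + ind b = (pairing a u + pairing b u) + (k + k)"
          unfolding u(2)[OF ab(1), symmetric] u(2)[OF ab(2), symmetric] by (simp only: ac_simps)
        then show ?thesis by simp
      qed
      then show ?thesis using u(1) by (simp add: is_covector_def)
    qed
    then have "\<delta> \<tau>\<^sub>1 = u" "\<delta> \<tau>\<^sub>2 = u"
      using is_covector_unique[OF full(1) cov[OF tK(1)]] is_covector_unique[OF full(2) cov[OF tK(2)]]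
      by auto
    then show "\<delta> \<tau>\<^sub>1 = \<delta> \<tau>\<^sub>2" by simp
  qed
  finally show ?thesis .
qed

text \<open>All \<open>0\<close>-cells below a \<open>1\<close>-cell of \<open>\<partial>v\<^sup>*\<close> come from simplices of full dimension, so the \<open>1\<close>-cells of \<open>\<partial>v\<^sup>*\<close>
  are the pairs of adjacent facets of \<open>K\<close> that contain \<open>v\<close>.\<close>

lemma ridge_cell:
  assumes v: "interior_vertex P K v" and c: "c \<in> D v" "cell_dim c = 1"
  obtains \<tau>\<^sub>1 \<tau>\<^sub>2 where "full \<tau>\<^sub>1" "full \<tau>\<^sub>2" "vertices \<tau>\<^sub>1 \<inter> vertices \<tau>\<^sub>2 = vertices (fst c)"
    "card (vertices (fst c)) = DIM('a)" "\<And>\<epsilon>. hess \<epsilon> c = covector \<epsilon> \<tau>\<^sub>1 + covector \<epsilon> \<tau>\<^sub>2"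
proof -
  define C where "C = {c'\<in>X. cell_dim c' = 0 \<and> cell_le c' c}"
  have cX: "c \<in> X" "snd c = P" using c mem_D[OF v] by auto
  have "card C = 2" using card_0_cells[OF cX(1) c(2)] by (simp add: C_def)
  then obtain c1 c2 where C: "C = {c1, c2}" "c1 \<noteq> c2" unfolding card_2_iff by blast
  have C_D: "c' \<in> D v" if "c' \<in> C" for c'
    using that D_down_closed[OF v] c(1) unfolding down_closed_def C_def by blast
  have top: "snd c' = P" "full (fst c')" "fst c face_of fst c'" if "c' \<in> C" for c'
  proof -
    show "snd c' = P" using C_D[OF that] mem_D[OF v] by blast
    then show "full (fst c')" using that top_cell_full[of c'] by (auto simp: C_def)
    show "fst c face_of fst c'" using that by (auto simp: C_def cell_le_def)
  qed
  have c12: "c1 \<in> C" "c2 \<in> C" using C by auto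
  have ne: "fst c1 \<noteq> fst c2" using C(2) top(1)[OF c12(1)] top(1)[OF c12(2)] by (auto simp: prod_eq_iff)
  note full = top(2)[OF c12(1)] top(2)[OF c12(2)]
  have tK: "fst c1 \<in> K" "fst c2 \<in> K" using full by (auto simp: full_def)
  have fin: "finite (vertices (fst c1))" using simplex_K[OF tK(1)] simplex_vertices(2) by blast
  have cardF: "card (vertices (fst c)) = DIM('a)"
  proof -
    have "aff_dim P = int DIM('a)" using P by (rule aff_dim_simplex)
    then show ?thesis using cell_dim_X[OF cX(1)] c(2) cX card_K[of "fst c"] by (auto simp: mem_X)
  qed
  have sub: "vertices (fst c) \<subseteq> vertices (fst c1) \<inter> vertices (fst c2)"
    using vertices_face_eq[OF top(3)[OF c12(1)]] vertices_face_eq[OF top(3)[OF c12(2)]] by blast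
  have "vertices (fst c) = vertices (fst c1) \<inter> vertices (fst c2)"
  proof (rule card_subset_eq)
    have "vertices (fst c1) \<noteq> vertices (fst c2)" using ne triangulates_eqI[OF K tK] by blast
    moreover have "card (vertices (fst c1)) = card (vertices (fst c2))" using full by (simp add: full_def)
    ultimately have "vertices (fst c1) \<inter> vertices (fst c2) \<noteq> vertices (fst c1)"
      using card_subset_eq[of "vertices (fst c2)" "vertices (fst c1)"]
        simplex_K[OF tK(2)] simplex_vertices(2) by blast
    then have "card (vertices (fst c1) \<inter> vertices (fst c2)) < card (vertices (fst c1))"
      using fin by (intro psubset_card_mono) auto
    then have "card (vertices (fst c1) \<inter> vertices (fst c2)) \<le> DIM('a)"
      using full by (simp add: full_def)
    then show "card (vertices (fst c)) = card (vertices (fst c1) \<inter> vertices (fst c2))"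
      using card_mono[OF _ sub] fin cardF by simp
  qed (use fin sub in auto)
  moreover have "hess \<epsilon> c = covector \<epsilon> (fst c1) + covector \<epsilon> (fst c2)" for \<epsilon>
  proof -
    have "hess \<epsilon> c = (\<Sum>c'\<in>C. covector \<epsilon> (fst c'))"
      using cX c(2) by (simp add: hess_def coboundary_def C_def)
    then show ?thesis using C by simp
  qed
  ultimately show ?thesis using full cardF that by metis
qed

lemma ridge_of_pair:
  assumes v: "interior_vertex P K v" and full: "full \<tau>\<^sub>1" "full \<tau>\<^sub>2"
    and card: "card (vertices \<tau>\<^sub>1 \<inter> vertices \<tau>\<^sub>2) = DIM('a)" "DIM('a) \<ge> 2"
    and "v \<in> vertices \<tau>\<^sub>1 \<inter> vertices \<tau>\<^sub>2"
  shows "(\<tau>\<^sub>1 \<inter> \<tau>\<^sub>2, P) \<in> D v" "hess \<epsilon> (\<tau>\<^sub>1 \<inter> \<tau>\<^sub>2, P) = covector \<epsilon> \<tau>\<^sub>1 + covector \<epsilon> \<tau>\<^sub>2"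
proof -
  let ?c = "(\<tau>\<^sub>1 \<inter> \<tau>\<^sub>2, P)"
  have tK: "\<tau>\<^sub>1 \<in> K" "\<tau>\<^sub>2 \<in> K" using full by (auto simp: full_def)
  note V = triangulates_vertices_Int[OF K tK]
  have F: "\<tau>\<^sub>1 \<inter> \<tau>\<^sub>2 \<in> K" using triangulates_Int[OF K tK] by blast
  have dimP: "aff_dim P = int DIM('a)" using P by (rule aff_dim_simplex)
  have PP: "P face_of P" using simplex_imp_polytope[OF P] polytope_imp_convex face_of_refl by blast
  have dimF: "aff_dim (\<tau>\<^sub>1 \<inter> \<tau>\<^sub>2) = int DIM('a) - 1" using card_K[OF F] V card(1) by simp
  then have cX: "?c \<in> X" using F PP card(2) triangulates_subset[OF K F] by (simp add: mem_X)
  then show "?c \<in> D v" using assms(6) V by (simp add: mem_D[OF v])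
  have cd: "cell_dim ?c = 1" using dimP dimF by (simp add: cell_dim_def)
  define C where "C = {c'\<in>X. cell_dim c' = 0 \<and> cell_le c' ?c}"
  have C2: "card C = 2" using card_0_cells[OF cX cd] by (simp add: C_def)
  have ne: "\<tau>\<^sub>1 \<noteq> \<tau>\<^sub>2" using card(1) full by (auto simp: full_def)
  have "(\<tau>, P) \<in> C" if "\<tau> = \<tau>\<^sub>1 \<or> \<tau> = \<tau>\<^sub>2" for \<tau>
  proof -
    have "\<tau> \<in> K" "card (vertices \<tau>) = DIM('a) + 1" "\<tau>\<^sub>1 \<inter> \<tau>\<^sub>2 face_of \<tau>"
      using that full triangulates_Int[OF K tK] by (auto simp: full_def)
    then show ?thesis using card_K[of \<tau>] dimP PP triangulates_subset[OF K, of \<tau>]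
      by (auto simp: C_def mem_X cell_dim_def cell_le_def)
  qed
  then have "{(\<tau>\<^sub>1, P), (\<tau>\<^sub>2, P)} \<subseteq> C" by blast
  moreover have "finite C" using finite_X by (simp add: C_def)
  ultimately have "{(\<tau>\<^sub>1, P), (\<tau>\<^sub>2, P)} = C"
    using C2 ne by (intro card_subset_eq) auto
  moreover have "hess \<epsilon> ?c = (\<Sum>c'\<in>C. covector \<epsilon> (fst c'))"
    using cX cd by (simp add: hess_def coboundary_def C_def)
  ultimately show "hess \<epsilon> ?c = covector \<epsilon> \<tau>\<^sub>1 + covector \<epsilon> \<tau>\<^sub>2"
    using ne by (auto simp flip: \<open>_ = C\<close>)
qed

text \<open>The Hessians of \<open>v\<close> and \<open>w\<close> are compared on each common \<open>1\<close>-cell, that is, on a pair of adjacent facets.\<close>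

theorem rho_uniform_iff: "rho_uniform P K \<longleftrightarrow> parity_uniform (interior P) K"
proof
  assume "rho_uniform P K"
  then have eq: "hess (vertex_indicator v) c = hess (vertex_indicator w) c"
    if "interior_vertex P K v" "interior_vertex P K w" "c \<in> D v" "c \<in> D w" for v w c
    using that unfolding rho_uniform_iff_hess by blast
  show "parity_uniform (interior P) K"
    unfolding parity_uniform_def
  proof (intro ballI allI impI)
    fix \<tau>\<^sub>1 \<tau>\<^sub>2 v w
    assume t: "\<tau>\<^sub>1 \<in> K" "\<tau>\<^sub>2 \<in> K" "card (vertices \<tau>\<^sub>1) = DIM('a) + 1" "card (vertices \<tau>\<^sub>2) = DIM('a) + 1"
      and c: "card (vertices \<tau>\<^sub>1 \<inter> vertices \<tau>\<^sub>2) = DIM('a)"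
      and vw: "{v, w} \<subseteq> vertices \<tau>\<^sub>1 \<inter> vertices \<tau>\<^sub>2 \<inter> interior P"
    show "even_affine (vertices \<tau>\<^sub>1 \<union> vertices \<tau>\<^sub>2) v w"
    proof (cases "v = w")
      case True
      then show ?thesis by (simp add: even_affine_refl)
    next
      case False
      have full: "full \<tau>\<^sub>1" "full \<tau>\<^sub>2" using t by (auto simp: full_def)
      have int: "interior_vertex P K v" "interior_vertex P K w"
        using vw triangulates_vertex_face(2)[OF K t(1)] by (auto simp: interior_vertex_iff)
      have fin: "finite (vertices \<tau>\<^sub>1)" using simplex_K[OF t(1)] simplex_vertices(2) by blast
      have "card {v, w} \<le> card (vertices \<tau>\<^sub>1 \<inter> vertices \<tau>\<^sub>2)"
        using vw fin by (intro card_mono) auto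
      then have "DIM('a) \<ge> 2" using c False by simp
      note r1 = ridge_of_pair[OF int(1) full c this] and r2 = ridge_of_pair[OF int(2) full c this]
      have "hess (vertex_indicator v) (\<tau>\<^sub>1 \<inter> \<tau>\<^sub>2, P) = hess (vertex_indicator w) (\<tau>\<^sub>1 \<inter> \<tau>\<^sub>2, P)"
        using r1 r2 vw by (intro eq int) auto
      moreover have "v \<in> vertices \<tau>\<^sub>1 \<inter> vertices \<tau>\<^sub>2" using vw by blast
      moreover have "vertices \<tau>\<^sub>1 \<inter> vertices \<tau>\<^sub>2 \<noteq> {}" using vw by blast
      ultimately show ?thesis using covector_sum_eq_iff[OF full] r1(2) by metis
    qed
  qed
next
  assume R: "parity_uniform (interior P) K"
  show "rho_uniform P K"
    unfolding rho_uniform_iff_hess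
  proof (intro allI impI)
    fix v w c
    assume v: "interior_vertex P K v" and w: "interior_vertex P K w" and c: "c \<in> D v \<inter> D w"
    show "hess (vertex_indicator v) c = hess (vertex_indicator w) c"
    proof (cases "cell_dim c = 1")
      case False
      have "hess \<epsilon> \<in> cochains X W1 (Suc 0)" for \<epsilon> using hess_cocycle by (auto simp: cocycles_def)
      then show ?thesis using cochainsD(2) False by (metis One_nat_def)
    next
      case True
      have cv: "c \<in> D v" and cw: "c \<in> D w" using c by auto
      obtain \<tau>\<^sub>1 \<tau>\<^sub>2 where t: "full \<tau>\<^sub>1" "full \<tau>\<^sub>2" "vertices \<tau>\<^sub>1 \<inter> vertices \<tau>\<^sub>2 = vertices (fst c)"
        "card (vertices (fst c)) = DIM('a)" "\<And>\<epsilon>. hess \<epsilon> c = covector \<epsilon> \<tau>\<^sub>1 + covector \<epsilon> \<tau>\<^sub>2"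
        using ridge_cell[OF v cv True] by blast
      have "{v, w} \<subseteq> vertices \<tau>\<^sub>1 \<inter> vertices \<tau>\<^sub>2 \<inter> interior P"
        using t(3) cv cw v w mem_D[OF v] mem_D[OF w] by (auto simp: interior_vertex_iff)
      moreover from this have "vertices \<tau>\<^sub>1 \<inter> vertices \<tau>\<^sub>2 \<noteq> {}" by blast
      moreover have "even_affine (vertices \<tau>\<^sub>1 \<union> vertices \<tau>\<^sub>2) v w"
        using R calculation(1) t(1,2,3,4) unfolding parity_uniform_def full_def by metis
      ultimately show ?thesis using covector_sum_eq_iff[OF t(1,2)] t(5) by metis
    qed
  qed
qed

end


section \<open>Lattice simplices of minimal volume\<close>

lemma nn_integral_lborel_affine_image:
  fixes t :: "'a::euclidean_space"
  assumes [measurable]: "f \<in> borel_measurable borel" and c: "\<bar>c\<bar> = 1"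
  shows "(\<integral>\<^sup>+x. f (t + c *\<^sub>R x) \<partial>lborel) = (\<integral>\<^sup>+x. f x \<partial>lborel)"
proof -
  have "c \<noteq> 0" using c by auto
  have "(\<integral>\<^sup>+x. f x \<partial>lborel)
      = (\<integral>\<^sup>+x. f x \<partial>density (distr lborel borel (\<lambda>x. t + c *\<^sub>R x)) (\<lambda>_. \<bar>c\<bar> ^ DIM('a)))"
    by (subst lborel_affine[OF \<open>c \<noteq> 0\<close>, of t]) simp
  also have "\<dots> = (\<integral>\<^sup>+x. f (t + c *\<^sub>R x) \<partial>lborel)"
    by (subst nn_integral_density) (simp_all add: nn_integral_distr c)
  finally show ?thesis by simp
qed

text \<open>An invertible linear map rescales volumes by a constant factor.  Both sides are the integral over
  \<open>(x, z)\<close> of the indicator of \<open>x \<in> A \<and> x + g z \<in> B\<close>, where \<open>g\<close> is the inverse of \<open>f\<close>, by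
  translation invariance.\<close>

lemma emeasure_linear_image_exchange:
  fixes f g :: "'a::euclidean_space \<Rightarrow> 'a"
  assumes f: "linear f" and g: "linear g" and fg: "\<And>x. f (g x) = x" "\<And>x. g (f x) = x"
    and A [measurable]: "A \<in> sets borel" and B [measurable]: "B \<in> sets borel"
  shows "emeasure lborel A * emeasure lborel (f ` B) = emeasure lborel B * emeasure lborel (f ` A)"
proof -
  have [measurable]: "g \<in> borel_measurable borel" "f \<in> borel_measurable borel"
    using f g by (auto intro!: borel_measurable_continuous_onI linear_continuous_on
        simp: linear_conv_bounded_linear)
  have img: "f ` C = g -` C" for C
    using fg by (auto simp: image_iff) (metis fg(1))
  have borel: "f ` C \<in> sets borel" if "C \<in> sets borel" for C
  proof -
    have "g -` C \<inter> space borel \<in> sets borel" using that by measurable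
    then show ?thesis by (simp add: img)
  qed
  have ind: "(\<integral>\<^sup>+z. indicator C (g z) \<partial>lborel) = emeasure lborel (f ` C)" if "C \<in> sets borel" for C
  proof -
    have "(\<integral>\<^sup>+z. indicator C (g z) \<partial>lborel) = (\<integral>\<^sup>+z. indicator (f ` C) z \<partial>lborel)"
      by (intro nn_integral_cong) (auto simp: img indicator_def)
    then show ?thesis using borel[OF that] by simp
  qed
  define h :: "'a \<Rightarrow> 'a \<Rightarrow> ennreal" where "h x z = indicator A x * indicator B (x + g z)" for x z
  have [measurable]: "case_prod h \<in> borel_measurable (lborel \<Otimes>\<^sub>M lborel)"
    unfolding h_def by measurable
  have "(\<integral>\<^sup>+x. \<integral>\<^sup>+z. h x z \<partial>lborel \<partial>lborel) = (\<integral>\<^sup>+x. indicator A x * emeasure lborel (f ` B) \<partial>lborel)"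
  proof (rule nn_integral_cong)
    fix x :: 'a
    have "(\<integral>\<^sup>+z. indicator B (x + g z) \<partial>lborel) = (\<integral>\<^sup>+z. indicator B (g (f x + 1 *\<^sub>R z)) \<partial>(lborel :: 'a measure))"
      by (simp add: linear_add[OF g] fg)
    also have "\<dots> = (\<integral>\<^sup>+z. (indicator B (g z) :: ennreal) \<partial>lborel)"
      by (rule nn_integral_lborel_affine_image) auto
    also have "\<dots> = emeasure lborel (f ` B)" by (rule ind[OF B])
    finally show "(\<integral>\<^sup>+z. h x z \<partial>lborel) = indicator A x * emeasure lborel (f ` B)"
      unfolding h_def by (subst nn_integral_cmult) auto
  qed
  also have "\<dots> = emeasure lborel A * emeasure lborel (f ` B)"
    by (subst nn_integral_multc) auto
  finally have 1: "(\<integral>\<^sup>+x. \<integral>\<^sup>+z. h x z \<partial>lborel \<partial>lborel) = emeasure lborel A * emeasure lborel (f ` B)" .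
  have "(\<integral>\<^sup>+x. \<integral>\<^sup>+z. h x z \<partial>lborel \<partial>lborel) = (\<integral>\<^sup>+z. \<integral>\<^sup>+x. h x z \<partial>lborel \<partial>lborel)"
    by (rule lborel_pair.Fubini'[symmetric]) measurable
  also have "\<dots> = (\<integral>\<^sup>+z. \<integral>\<^sup>+x. indicator A (x - g z) * indicator B x \<partial>lborel \<partial>lborel)"
  proof (rule nn_integral_cong)
    fix z :: 'a
    have "(\<integral>\<^sup>+x. h x z \<partial>lborel)
        = (\<integral>\<^sup>+x. indicator A ((g z + 1 *\<^sub>R x) - g z) * indicator B (g z + 1 *\<^sub>R x) \<partial>lborel)"
      by (intro nn_integral_cong) (simp add: h_def add.commute)
    also have "\<dots> = (\<integral>\<^sup>+x. indicator A (x - g z) * indicator B x \<partial>lborel)"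
      by (rule nn_integral_lborel_affine_image) auto
    finally show "(\<integral>\<^sup>+x. h x z \<partial>lborel) = (\<integral>\<^sup>+x. indicator A (x - g z) * indicator B x \<partial>lborel)" .
  qed
  also have "\<dots> = (\<integral>\<^sup>+x. \<integral>\<^sup>+z. indicator A (x - g z) * indicator B x \<partial>lborel \<partial>lborel)"
    by (rule lborel_pair.Fubini') measurable
  also have "\<dots> = (\<integral>\<^sup>+x. emeasure lborel (f ` A) * indicator B x \<partial>lborel)"
  proof (rule nn_integral_cong)
    fix x :: 'a
    have "(\<integral>\<^sup>+z. indicator A (x - g z) \<partial>lborel) = (\<integral>\<^sup>+z. indicator A (g (f x + (-1) *\<^sub>R z)) \<partial>(lborel :: 'a measure))"
      by (simp add: linear_diff[OF g] fg)
    also have "\<dots> = (\<integral>\<^sup>+z. (indicator A (g z) :: ennreal) \<partial>lborel)"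
      by (rule nn_integral_lborel_affine_image) auto
    also have "\<dots> = emeasure lborel (f ` A)" by (rule ind[OF A])
    finally show "(\<integral>\<^sup>+z. indicator A (x - g z) * indicator B x \<partial>lborel) = emeasure lborel (f ` A) * indicator B x"
      by (subst nn_integral_multc) auto
  qed
  also have "\<dots> = emeasure lborel (f ` A) * emeasure lborel B"
    by (subst nn_integral_cmult) auto
  finally show ?thesis using 1 by (simp add: mult.commute)
qed

definition unit_cube :: "'a::euclidean_space set" where
  "unit_cube = {x. \<forall>b\<in>Basis. 0 \<le> x \<bullet> b \<and> x \<bullet> b < 1}"

lemma unit_cube_borel [measurable]: "unit_cube \<in> sets borel"
  unfolding unit_cube_def by measurable

lemma emeasure_unit_cube: "emeasure lborel (unit_cube :: 'a::euclidean_space set) = 1"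
proof (rule antisym)
  have "emeasure lborel (unit_cube :: 'a set) \<le> emeasure lborel (cbox 0 (One :: 'a))"
    by (intro emeasure_mono) (auto simp: unit_cube_def mem_box less_imp_le)
  also have "\<dots> = 1" by (subst emeasure_lborel_cbox) auto
  finally show "emeasure lborel (unit_cube :: 'a set) \<le> 1" .
  have "1 = emeasure lborel (box 0 (One :: 'a))" by (subst emeasure_lborel_box) auto
  also have "\<dots> \<le> emeasure lborel (unit_cube :: 'a set)"
    by (intro emeasure_mono) (auto simp: unit_cube_def mem_box less_imp_le)
  finally show "1 \<le> emeasure lborel (unit_cube :: 'a set)" .
qed

lemma unit_cube_lattice_unique:
  assumes "x \<in> unit_cube" "y \<in> unit_cube" "x - y \<in> lattice_M"
  shows "x = y"
proof (rule euclidean_eqI)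
  fix b :: 'a assume b: "b \<in> Basis"
  have "x \<bullet> b - y \<bullet> b \<in> \<int>" using assms(3) b by (simp add: lattice_M_def inner_diff_left)
  then obtain m where m: "x \<bullet> b - y \<bullet> b = of_int m" by (elim Ints_cases)
  have "\<bar>x \<bullet> b - y \<bullet> b\<bar> < 1" using assms(1,2) b by (auto simp: unit_cube_def abs_less_iff) (smt (verit))+
  then have "\<bar>real_of_int m\<bar> < 1" using m by simp
  then have "m = 0" by linarith
  then show "x \<bullet> b = y \<bullet> b" using m by simp
qed

lemma unit_cube_lattice_cover: "\<exists>m\<in>lattice_M. x - m \<in> unit_cube"
proof -
  define m where "m = (\<Sum>b\<in>Basis. of_int \<lfloor>x \<bullet> b\<rfloor> *\<^sub>R b)"
  have "m \<bullet> b = of_int \<lfloor>x \<bullet> b\<rfloor>" if "b \<in> Basis" for b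
    using that unfolding m_def by (simp add: inner_sum_left inner_Basis if_distrib cong: if_cong)
  then have "m \<in> lattice_M" "x - m \<in> unit_cube"
    by (auto simp: lattice_M_def unit_cube_def inner_diff_left) linarith+
  then show ?thesis by blast
qed

lemma countable_lattice_M: "countable (lattice_M :: 'a::euclidean_space set)"
proof (rule countable_subset)
  show "lattice_M \<subseteq> (\<lambda>f. \<Sum>b\<in>Basis. f b *\<^sub>R b) ` (PiE Basis (\<lambda>_. \<int>) :: ('a \<Rightarrow> real) set)"
  proof
    fix x :: 'a assume "x \<in> lattice_M"
    then have "restrict ((\<bullet>) x) Basis \<in> PiE Basis (\<lambda>_. \<int>)" by (auto simp: lattice_M_def)
    moreover have "x = (\<Sum>b\<in>Basis. restrict ((\<bullet>) x) Basis b *\<^sub>R b)"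
      by (simp add: euclidean_representation)
    ultimately show "x \<in> (\<lambda>f. \<Sum>b\<in>Basis. f b *\<^sub>R b) ` (PiE Basis (\<lambda>_. \<int>) :: ('a \<Rightarrow> real) set)"
      by blast
  qed
  have "countable (\<int> :: real set)" by (simp add: Ints_def)
  then show "countable ((\<lambda>f. \<Sum>b\<in>Basis. f b *\<^sub>R b) ` (PiE Basis (\<lambda>_. \<int>) :: ('a \<Rightarrow> real) set))"
    by (intro countable_image countable_PiE) auto
qed

text \<open>Cut \<open>E\<close> along the translates of the unit cube and move the pieces into the cube, where they do not
  overlap.\<close>

lemma emeasure_incongruent_le_1:
  fixes E :: "'a::euclidean_space set"
  assumes E [measurable]: "E \<in> sets borel"
    and inc: "\<And>x y. x \<in> E \<Longrightarrow> y \<in> E \<Longrightarrow> x - y \<in> lattice_M \<Longrightarrow> x = y"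
  shows "emeasure lborel E \<le> 1"
proof -
  define G where "G m = {x. x + m \<in> E \<and> x \<in> unit_cube}" for m
  define H where "H m = {x. x \<in> E \<and> x - m \<in> unit_cube}" for m
  have [measurable]: "G m \<in> sets borel" "H m \<in> sets borel" for m
    unfolding G_def H_def by measurable
  have GH: "emeasure lborel (G m) = emeasure lborel (H m)" for m
  proof -
    have "(\<integral>\<^sup>+x. indicator (H m) (m + 1 *\<^sub>R x) \<partial>lborel) = (\<integral>\<^sup>+x. indicator (H m) x \<partial>lborel)"
      by (rule nn_integral_lborel_affine_image) auto
    moreover have "(\<integral>\<^sup>+x. indicator (H m) (m + 1 *\<^sub>R x) \<partial>lborel) = (\<integral>\<^sup>+x. (indicator (G m) x :: ennreal) \<partial>lborel)"
      by (intro nn_integral_cong) (auto simp: G_def H_def indicator_def add.commute)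
    ultimately show ?thesis by simp
  qed
  have "E = (\<Union>m\<in>lattice_M. H m)" using unit_cube_lattice_cover by (auto simp: H_def)
  then have "emeasure lborel E = emeasure lborel (\<Union>m\<in>lattice_M. H m)" by simp
  also have "\<dots> = (\<integral>\<^sup>+m. emeasure lborel (H m) \<partial>count_space lattice_M)"
  proof (rule emeasure_UN_countable)
    show "disjoint_family_on H lattice_M"
      unfolding disjoint_family_on_def
    proof (intro ballI impI)
      fix m m' :: 'a assume m: "m \<in> lattice_M" "m' \<in> lattice_M" "m \<noteq> m'"
      have False if "x \<in> H m" "x \<in> H m'" for x
      proof -
        have "(x - m) - (x - m') \<in> lattice_M" using m lattice_M_diff[of m' m] by simp
        then have "x - m = x - m'" using that by (intro unit_cube_lattice_unique) (auto simp: H_def)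
        then show False using m(3) by simp
      qed
      then show "H m \<inter> H m' = {}" by blast
    qed
  qed (auto simp: countable_lattice_M)
  also have "\<dots> = (\<integral>\<^sup>+m. emeasure lborel (G m) \<partial>count_space lattice_M)" by (simp add: GH)
  also have "\<dots> = emeasure lborel (\<Union>m\<in>lattice_M. G m)"
  proof (rule emeasure_UN_countable[symmetric])
    show "disjoint_family_on G lattice_M"
      unfolding disjoint_family_on_def
    proof (intro ballI impI)
      fix m m' :: 'a assume m: "m \<in> lattice_M" "m' \<in> lattice_M" "m \<noteq> m'"
      have False if "x \<in> G m" "x \<in> G m'" for x
        using inc[of "x + m" "x + m'"] that m lattice_M_diff[of m m'] by (auto simp: G_def)
      then show "G m \<inter> G m' = {}" by blast
    qed
  qed (auto simp: countable_lattice_M)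
  also have "\<dots> \<le> emeasure lborel (unit_cube :: 'a set)"
    by (intro emeasure_mono) (auto simp: G_def)
  also have "\<dots> = 1" by (rule emeasure_unit_cube)
  finally show ?thesis .
qed

text \<open>If \<open>f\<close> preserves volumes and maps the lattice into itself, then the preimage of the unit cube already
  fills a fundamental domain, which leaves no room for a second coset.\<close>

lemma volume_preserving_lattice_surj:
  fixes f g :: "'a::euclidean_space \<Rightarrow> 'a"
  assumes f: "linear f" and g: "linear g" and fg: "\<And>x. f (g x) = x" "\<And>x. g (f x) = x"
    and fM: "\<And>x. x \<in> lattice_M \<Longrightarrow> f x \<in> lattice_M"
    and vol: "emeasure lborel (f ` (unit_cube :: 'a set)) = 1"
    and p: "p \<in> lattice_M"
  shows "g p \<in> lattice_M"
proof (rule ccontr)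
  assume np: "g p \<notin> lattice_M"
  define E1 E2 :: "'a set" where "E1 = {x. f x \<in> unit_cube}" and "E2 = {x. f (x - g p) \<in> unit_cube}"
  have [measurable]: "f \<in> borel_measurable borel"
    using f by (auto intro!: borel_measurable_continuous_onI linear_continuous_on
        simp: linear_conv_bounded_linear)
  have [measurable]: "E1 \<in> sets borel" "E2 \<in> sets borel" unfolding E1_def E2_def by measurable
  have key: "x = y" if "f x \<in> unit_cube" "f y \<in> unit_cube" "f (x - y) \<in> lattice_M" for x y
  proof -
    have "f x = f y" using that by (intro unit_cube_lattice_unique) (auto simp: linear_diff[OF f])
    then show ?thesis using fg by metis
  qed
  have E1E2: False if "x \<in> E1" "y \<in> E2" "x - y \<in> lattice_M \<or> y - x \<in> lattice_M" for x y
  proof -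
    have xy: "x - y \<in> lattice_M" "y - x \<in> lattice_M"
      using that(3) lattice_M_scale[of "x - y" "-1"] lattice_M_scale[of "y - x" "-1"] by auto
    have "f (x - (y - g p)) = f (x - y) + p"
      by (simp add: linear_diff[OF f] fg)
    then have "f (x - (y - g p)) \<in> lattice_M" using xy(1) fM p by (simp add: lattice_M_add)
    then have "x = y - g p" using that by (intro key) (auto simp: E1_def E2_def)
    then have "g p = y - x" by simp
    then show False using xy(2) np by simp
  qed
  have "emeasure lborel (E1 \<union> E2) \<le> 1"
  proof (rule emeasure_incongruent_le_1)
    fix x y assume xy: "x \<in> E1 \<union> E2" "y \<in> E1 \<union> E2" "x - y \<in> lattice_M"
    then consider "x \<in> E1" "y \<in> E1" | "x \<in> E2" "y \<in> E2"
      using E1E2[of x y] E1E2[of y x] by blast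
    then show "x = y"
    proof cases
      case 1
      then show ?thesis using xy(3) fM by (intro key) (auto simp: E1_def)
    next
      case 2
      have "x - g p = y - g p" using 2 xy(3) fM by (intro key) (auto simp: E2_def)
      then show ?thesis by simp
    qed
  qed measurable
  moreover have "E1 \<inter> E2 = {}" using E1E2 by fastforce
  then have "emeasure lborel (E1 \<union> E2) = emeasure lborel E1 + emeasure lborel E2"
    by (intro plus_emeasure[symmetric]) auto
  moreover have E1: "emeasure lborel E1 = 1"
  proof -
    have "x \<in> f ` E1" if "x \<in> unit_cube" for x
      by (rule image_eqI[of _ _ "g x"]) (simp_all add: fg E1_def that)
    then have "f ` E1 = unit_cube" by (auto simp: E1_def)
    then show ?thesis
      using emeasure_linear_image_exchange[OF f g fg, of unit_cube E1] vol
      by (simp add: emeasure_unit_cube)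
  qed
  moreover have "emeasure lborel E2 = emeasure lborel E1"
  proof -
    have "(\<integral>\<^sup>+x. indicator E2 (g p + 1 *\<^sub>R x) \<partial>lborel) = (\<integral>\<^sup>+x. indicator E2 x \<partial>lborel)"
      by (rule nn_integral_lborel_affine_image) auto
    moreover have "(\<integral>\<^sup>+x. indicator E2 (g p + 1 *\<^sub>R x) \<partial>lborel) = (\<integral>\<^sup>+x. (indicator E1 x :: ennreal) \<partial>lborel)"
      by (intro nn_integral_cong) (auto simp: E1_def E2_def indicator_def)
    ultimately show ?thesis by simp
  qed
  ultimately have "(1 :: ennreal) + 1 \<le> 1" by simp
  then have "ennreal 2 \<le> ennreal 1" by (simp add: one_add_one)
  then show False by (subst (asm) ennreal_le_iff) auto
qed

text \<open>The linear part \<open>f\<close> of the affine map from the standard simplex to \<open>\<tau>\<close> preserves volumes, hence maps the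
  lattice onto itself.  Its inverse transports the coordinate functions of the standard simplex.\<close>

lemma unimodular_of_volume:
  fixes \<tau> :: "'a::euclidean_space set"
  assumes \<tau>: "k simplex \<tau>" "vertices \<tau> \<subseteq> lattice_M"
    and vol: "measure lebesgue \<tau> = 1 / fact DIM('a)"
  shows "unimodular \<tau>"
proof -
  let ?V = "vertices \<tau>" and ?S = "convex hull (insert 0 Basis :: 'a set)"
  have V: "finite ?V" "convex hull ?V = \<tau>" using simplex_vertices[OF \<tau>(1)] by auto
  have vol_neg: "\<not> negligible \<tau>" using vol negligible_imp_measure0[of \<tau>] by auto
  then have "interior \<tau> \<noteq> {}" using negligible_convex_interior convex_simplex[OF \<tau>(1)] by blast
  then have "aff_dim \<tau> = DIM('a)" by (rule aff_dim_nonempty_interior)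
  then have card: "card ?V = DIM('a) + 1" using simplex_card[OF \<tau>(1)] by simp
  then obtain v0 where v0: "v0 \<in> ?V" by fastforce
  have "card (?V - {v0}) = card (Basis :: 'a set)" using card v0 V(1) by simp
  then obtain h where h: "bij_betw h (Basis :: 'a set) (?V - {v0})"
    using finite_same_card_bij[of "Basis :: 'a set" "?V - {v0}"] V(1) by auto
  define f where "f x = (\<Sum>b\<in>Basis. (x \<bullet> b) *\<^sub>R (h b - v0))" for x
  have f: "linear f"
    unfolding f_def by (intro linearI)
      (simp_all add: inner_add_left scaleR_add_left sum.distrib scaleR_sum_right)
  have fB: "f b = h b - v0" if "b \<in> Basis" for b
  proof -
    have "f b = (\<Sum>c\<in>Basis. if c = b then h b - v0 else 0)"
      unfolding f_def using that by (intro sum.cong) (auto simp: inner_Basis)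
    then show ?thesis using that by simp
  qed
  have hV: "h b \<in> ?V" if "b \<in> Basis" for b using h that by (auto simp: bij_betw_def)
  have VI: "(+) v0 ` f ` insert 0 Basis = ?V"
  proof -
    have "(+) v0 ` f ` Basis = h ` Basis" using fB by (auto simp: image_iff)
    then show ?thesis using h v0 linear_0[OF f] by (auto simp: bij_betw_def)
  qed
  have \<tau>_eq: "\<tau> = (+) v0 ` f ` ?S"
  proof -
    have "\<tau> = convex hull ((+) v0 ` f ` insert 0 Basis)" unfolding VI using V(2) by simp
    also have "\<dots> = (+) v0 ` (convex hull (f ` insert 0 Basis))" by (rule convex_hull_translation)
    also have "\<dots> = (+) v0 ` f ` ?S" by (simp only: convex_hull_linear_image[OF f])
    finally show ?thesis .
  qed
  have contf: "continuous_on X f" for X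
    using f by (simp add: linear_continuous_on linear_conv_bounded_linear)
  have "compact ?S" by (intro finite_imp_compact_convex_hull) auto
  then have cS: "compact (f ` ?S)" using contf by (intro compact_continuous_image)
  have mS: "measure lebesgue (f ` ?S) = 1 / fact DIM('a)"
    using vol unfolding \<tau>_eq by (simp add: measure_translation)
  have bS: "f ` ?S \<in> sets borel" "?S \<in> sets borel"
    using cS \<open>compact ?S\<close> by (auto intro: borel_compact)
  have eS: "emeasure lborel (f ` ?S) = ennreal (1 / fact DIM('a))"
  proof -
    have "emeasure lborel (f ` ?S) < \<infinity>"
      using cS by (intro emeasure_bounded_finite compact_imp_bounded)
    then have "emeasure lborel (f ` ?S) = ennreal (measure lborel (f ` ?S))"
      by (intro emeasure_eq_ennreal_measure) auto
    then show ?thesis using mS bS by simp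
  qed
  have "surj f"
  proof (rule ccontr)
    assume "\<not> surj f"
    have "subspace (range f)" using f by (simp add: linear_subspace_image)
    then have "dim (range f) \<noteq> DIM('a)"
      using \<open>\<not> surj f\<close> by (metis dim_eq_full span_eq_iff)
    then have "dim (range f) < DIM('a)" using dim_subset_UNIV[of "range f"] by simp
    then have "negligible (range f)" by (rule negligible_lowdim)
    then have "negligible (f ` ?S)" by (rule negligible_subset) auto
    then show False using mS negligible_imp_measure0 by fastforce
  qed
  then obtain g where g: "linear g" "\<And>x. g (f x) = x" "\<And>x. f (g x) = x"
    using linear_surjective_isomorphism[OF f] by blast
  have fM: "f x \<in> lattice_M" if "x \<in> lattice_M" for x
    unfolding f_def using that hV v0 \<tau>(2)
    by (intro lattice_M_sum lattice_M_scale lattice_M_diff) (auto simp: lattice_M_def)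
  have "emeasure lborel (f ` (unit_cube :: 'a set)) = 1"
  proof -
    have "ennreal (1 / fact DIM('a)) = ennreal (1 / fact DIM('a)) * emeasure lborel (f ` (unit_cube :: 'a set))"
      using emeasure_linear_image_exchange[OF f g(1,3,2) unit_cube_borel bS(2)]
      unfolding emeasure_unit_cube eS emeasure_std_simplex by simp
    then have "ennreal (1 / fact DIM('a)) * 1 = ennreal (1 / fact DIM('a)) * emeasure lborel (f ` (unit_cube :: 'a set))"
      by simp
    moreover have "ennreal (1 / fact DIM('a)) \<noteq> 0" by simp
    ultimately show ?thesis by (subst (asm) ennreal_mult_cancel_left) auto
  qed
  then have gM: "g p \<in> lattice_M" if "p \<in> lattice_M" for p
    using volume_preserving_lattice_surj[OF f g(1,3,2) fM _ that] by blast
  have "extends_int ?V"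
    unfolding extends_int_def
  proof (intro allI impI)
    fix \<epsilon> :: "'a \<Rightarrow> real" assume \<epsilon>: "\<forall>a\<in>?V. \<epsilon> a \<in> \<int>"
    \<comment> \<open>The linear form that takes the required differences on the edges at \<open>v0\<close>, transported by \<open>f\<close>.\<close>
    define w where "w = (\<Sum>b\<in>Basis. (\<epsilon> (h b) - \<epsilon> v0) *\<^sub>R b)"
    have w: "b \<bullet> w = \<epsilon> (h b) - \<epsilon> v0" if "b \<in> Basis" for b
      using that unfolding w_def by (simp add: inner_sum_right inner_Basis if_distrib cong: if_cong)
    have wM: "w \<in> lattice_M"
      unfolding w_def using \<epsilon> hV v0 by (intro lattice_M_sum lattice_M_scale lattice_M_Basis) auto
    define u where "u = adjoint g w"
    have xu: "x \<bullet> u = g x \<bullet> w" for x unfolding u_def by (rule adjoint_works[OF g(1)])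
    have u: "u \<in> lattice_N"
      unfolding lattice_N_iff
    proof
      fix b :: 'a assume "b \<in> Basis"
      then have "b \<bullet> u \<in> \<int>" unfolding xu by (intro inner_Ints_lattice wM gM lattice_M_Basis)
      then show "u \<bullet> b \<in> \<int>" by (simp add: inner_commute)
    qed
    have "\<epsilon> v0 - v0 \<bullet> u \<in> \<int>" using \<epsilon> v0 \<tau>(2) u by (auto intro!: Ints_diff inner_lattice)
    moreover have "a \<bullet> u + (\<epsilon> v0 - v0 \<bullet> u) = \<epsilon> a" if a: "a \<in> ?V" for a
    proof (cases "a = v0")
      case False
      then have "a \<in> h ` Basis" using a h by (simp add: bij_betw_def)
      then obtain b where b: "b \<in> Basis" "a = h b" by blast
      have "(a - v0) \<bullet> u = b \<bullet> w" using xu[of "f b"] unfolding g(2) unfolding fB[OF b(1)] b(2) by simp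
      then show ?thesis using w[OF b(1)] b(2) by (simp add: inner_diff_left)
    qed simp
    ultimately show "\<exists>u\<in>lattice_N. \<exists>k\<in>\<int>. \<forall>a\<in>?V. a \<bullet> u + k = \<epsilon> a" using u by blast
  qed
  then show ?thesis using \<tau>(2) by (simp add: unimodular_def)
qed

lemma primitive_triangulation_unimodular:
  assumes K: "primitive_triangulation K P" and "\<sigma> \<in> K"
  shows "unimodular \<sigma>"
proof -
  have T: "triangulates K P" using K by (simp add: primitive_triangulation_def)
  obtain \<tau> where \<tau>: "\<tau> \<in> K" "\<sigma> \<subseteq> \<tau>" "\<forall>\<rho>\<in>K. \<tau> \<subseteq> \<rho> \<longrightarrow> \<rho> = \<tau>"
    using finite_has_maximal2[OF triangulates_finite[OF T] assms(2)] by metis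
  then have "measure lebesgue \<tau> = 1 / fact DIM('a)" "vertices \<tau> \<subseteq> lattice_M"
    using K by (auto simp: primitive_triangulation_def)
  then have "unimodular \<tau>" using triangulates_simplex[OF T \<tau>(1)] unimodular_of_volume by blast
  moreover have "\<sigma> face_of \<tau>" using triangulates_face_iff[OF T assms(2) \<tau>(1)] \<tau>(2) by simp
  ultimately show ?thesis by (rule unimodular_face)
qed


section \<open>The staircase decomposition of a slab\<close>

subsection \<open>Homogeneous coordinates\<close>

text \<open>Coordinates of \<open>x\<close> with respect to \<open>e\<^sub>0, \<dots>, e\<^sub>n\<close>, normalised to have sum \<open>D\<close>.\<close>

definition coord :: "(nat \<Rightarrow> 'a::euclidean_space) \<Rightarrow> real \<Rightarrow> 'a \<Rightarrow> nat \<Rightarrow> real" where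
  "coord e D x k = (if k = 0 then D - (\<Sum>b\<in>Basis. x \<bullet> b) else x \<bullet> e k)"

text \<open>The face spanned by \<open>D e\<^sub>j\<close> for \<open>j \<in> I\<close>.\<close>

definition dilated_face :: "(nat \<Rightarrow> 'a::euclidean_space) \<Rightarrow> real \<Rightarrow> nat set \<Rightarrow> 'a set" where
  "dilated_face e D I =
     {x. \<forall>k\<le>DIM('a). 0 \<le> coord e D x k \<and> (k \<notin> I \<longrightarrow> coord e D x k = 0)}"

lemma basis_enum_Basis: "basis_enum (e :: nat \<Rightarrow> 'a::euclidean_space) \<Longrightarrow> k \<in> {1..DIM('a)} \<Longrightarrow> e k \<in> Basis"
  by (auto simp: basis_enum_def bij_betw_def)

lemma basis_enum_inner:
  fixes e :: "nat \<Rightarrow> 'a::euclidean_space"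
  assumes "basis_enum e" "j \<le> DIM('a)" "k \<in> {1..DIM('a)}"
  shows "e j \<bullet> e k = of_bool (j = k)"
proof (cases "j = 0")
  case True
  then show ?thesis using assms by (auto simp: basis_enum_def)
next
  case False
  then have "j \<in> {1..DIM('a)}" using assms(2) by auto
  then have "e j \<in> Basis" "e k \<in> Basis" "e j = e k \<longleftrightarrow> j = k"
    using assms basis_enum_Basis by (auto simp: basis_enum_def bij_betw_def dest: inj_onD)
  then show ?thesis by (simp add: inner_Basis)
qed

lemma sum_basis_enum:
  fixes e :: "nat \<Rightarrow> 'a::euclidean_space"
  assumes "basis_enum e"
  shows "(\<Sum>b\<in>Basis. f b) = (\<Sum>k\<in>{1..DIM('a)}. f (e k))"
  using assms by (intro sum.reindex_bij_betw[symmetric]) (auto simp: basis_enum_def)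

lemma atMost_eq_insert_0: "{..n::nat} = insert 0 {1..n}"
  by auto

lemma coord_sum:
  fixes e :: "nat \<Rightarrow> 'a::euclidean_space"
  assumes "basis_enum e"
  shows "(\<Sum>k\<le>DIM('a). coord e D x k) = D"
proof -
  have "(\<Sum>k\<le>DIM('a). coord e D x k) = coord e D x 0 + (\<Sum>k\<in>{1..DIM('a)}. coord e D x k)"
    unfolding atMost_eq_insert_0 by (subst sum.insert) auto
  also have "(\<Sum>k\<in>{1..DIM('a)}. coord e D x k) = (\<Sum>k\<in>{1..DIM('a)}. x \<bullet> e k)"
    by (intro sum.cong) (auto simp: coord_def)
  finally show ?thesis by (simp add: coord_def sum_basis_enum[OF assms])
qed

lemma coord_expansion:
  fixes e :: "nat \<Rightarrow> 'a::euclidean_space"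
  assumes "basis_enum e"
  shows "(\<Sum>k\<le>DIM('a). coord e D x k *\<^sub>R e k) = x"
proof -
  have "(\<Sum>k\<le>DIM('a). coord e D x k *\<^sub>R e k)
      = coord e D x 0 *\<^sub>R e 0 + (\<Sum>k\<in>{1..DIM('a)}. coord e D x k *\<^sub>R e k)"
    unfolding atMost_eq_insert_0 by (subst sum.insert) auto
  also have "\<dots> = (\<Sum>k\<in>{1..DIM('a)}. (x \<bullet> e k) *\<^sub>R e k)"
    using assms by (auto simp: basis_enum_def coord_def intro!: sum.cong)
  also have "\<dots> = (\<Sum>b\<in>Basis. (x \<bullet> b) *\<^sub>R b)" by (rule sum_basis_enum[OF assms, symmetric])
  finally show ?thesis by (simp add: euclidean_representation)
qed

lemma coord_eqI:
  fixes e :: "nat \<Rightarrow> 'a::euclidean_space"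
  assumes "basis_enum e" "\<And>k. k \<le> DIM('a) \<Longrightarrow> coord e D x k = coord e D' x' k"
  shows "x = x'"
proof -
  have "(\<Sum>k\<le>DIM('a). coord e D x k *\<^sub>R e k) = (\<Sum>k\<le>DIM('a). coord e D' x' k *\<^sub>R e k)"
    using assms(2) by (intro sum.cong) auto
  then show ?thesis by (simp add: coord_expansion[OF assms(1)])
qed

lemma coord_combination:
  fixes e :: "nat \<Rightarrow> 'a::euclidean_space"
  assumes e: "basis_enum e" and c: "(\<Sum>k\<le>DIM('a). c k) = D" and k: "k \<le> DIM('a)"
  shows "coord e D (\<Sum>j\<le>DIM('a). c j *\<^sub>R e j) k = c k"
proof -
  have inner: "(\<Sum>j\<le>DIM('a). c j *\<^sub>R e j) \<bullet> e l = c l" if "l \<in> {1..DIM('a)}" for l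
  proof -
    have "(\<Sum>j\<le>DIM('a). c j *\<^sub>R e j) \<bullet> e l = (\<Sum>j\<le>DIM('a). if j = l then c l else 0)"
      unfolding inner_sum_left using that by (intro sum.cong) (auto simp: basis_enum_inner[OF e])
    then show ?thesis using that by simp
  qed
  show ?thesis
  proof (cases "k = 0")
    case True
    have "(\<Sum>b\<in>Basis. (\<Sum>j\<le>DIM('a). c j *\<^sub>R e j) \<bullet> b) = (\<Sum>l\<in>{1..DIM('a)}. c l)"
      unfolding sum_basis_enum[OF e] by (intro sum.cong) (auto simp: inner)
    moreover have "D = c 0 + (\<Sum>l\<in>{1..DIM('a)}. c l)"
      unfolding c[symmetric] atMost_eq_insert_0 by (subst sum.insert) auto
    ultimately show ?thesis using True by (simp add: coord_def)
  next
    case False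
    then show ?thesis using k inner[of k] by (simp add: coord_def)
  qed
qed

lemma coord_affine:
  "coord e (a * D + b * D') (a *\<^sub>R x + b *\<^sub>R x') k = a * coord e D x k + b * coord e D' x' k"
  by (simp add: coord_def inner_add_left sum.distrib sum_distrib_left right_diff_distrib)

lemma convex_dilated_face: "convex (dilated_face e D I)"
proof (rule convexI)
  fix x y and a b :: real
  assume xy: "x \<in> dilated_face e D I" "y \<in> dilated_face e D I" and ab: "0 \<le> a" "0 \<le> b" "a + b = 1"
  have "a * D + b * D = D" using ab(3) by (metis distrib_right mult_1)
  then show "a *\<^sub>R x + b *\<^sub>R y \<in> dilated_face e D I"
    using xy ab coord_affine[of e a D b D x y] by (auto simp: dilated_face_def)
qed

lemma dilated_vertex:
  fixes e :: "nat \<Rightarrow> 'a::euclidean_space"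
  assumes "basis_enum e" "j \<le> DIM('a)" "k \<le> DIM('a)"
  shows "coord e D (D *\<^sub>R e j) k = (if k = j then D else 0)"
proof -
  have "(\<Sum>l\<le>DIM('a). (if l = j then D else 0) *\<^sub>R e l) = (\<Sum>l\<le>DIM('a). if l = j then D *\<^sub>R e j else 0)"
    by (intro sum.cong) auto
  then have "D *\<^sub>R e j = (\<Sum>l\<le>DIM('a). (if l = j then D else 0) *\<^sub>R e l)" using assms(2) by simp
  then show ?thesis
    using coord_combination[OF assms(1) _ assms(3), of "\<lambda>l. if l = j then D else 0" D] assms(2) by simp
qed

lemma convex_hull_dilated:
  fixes e :: "nat \<Rightarrow> 'a::euclidean_space"
  assumes e: "basis_enum e" and "D > 0" "I \<subseteq> {..DIM('a)}"
  shows "convex hull ((\<lambda>j. D *\<^sub>R e j) ` I) = dilated_face e D I"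
proof (intro subset_antisym)
  show "convex hull ((\<lambda>j. D *\<^sub>R e j) ` I) \<subseteq> dilated_face e D I"
    using assms by (intro hull_minimal convex_dilated_face)
      (auto simp: dilated_face_def dilated_vertex subset_iff)
next
  show "dilated_face e D I \<subseteq> convex hull ((\<lambda>j. D *\<^sub>R e j) ` I)"
  proof
    fix x assume x: "x \<in> dilated_face e D I"
    have fin: "finite I" using assms(3) finite_subset by blast
    have sumI: "(\<Sum>k\<in>I. f k) = (\<Sum>k\<le>DIM('a). f k)" if "\<And>k. k \<le> DIM('a) \<Longrightarrow> k \<notin> I \<Longrightarrow> f k = 0"
      for f :: "nat \<Rightarrow> 'c::comm_monoid_add"
      using that assms(3) by (intro sum.mono_neutral_left) auto
    have "(\<Sum>k\<in>I. (coord e D x k / D) *\<^sub>R (D *\<^sub>R e k)) \<in> convex hull ((\<lambda>j. D *\<^sub>R e j) ` I)"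
    proof (rule convex_sum[OF fin convex_convex_hull])
      have "(\<Sum>k\<in>I. coord e D x k) = D"
        using x by (subst sumI) (auto simp: dilated_face_def coord_sum[OF e])
      then show "(\<Sum>k\<in>I. coord e D x k / D) = 1"
        using assms(2) by (simp add: sum_divide_distrib[symmetric])
      show "coord e D x i / D \<ge> 0" if "i \<in> I" for i
        using x that assms by (auto simp: dilated_face_def subset_iff)
    qed (auto intro: hull_inc)
    moreover have "(\<Sum>k\<in>I. (coord e D x k / D) *\<^sub>R (D *\<^sub>R e k)) = (\<Sum>k\<in>I. coord e D x k *\<^sub>R e k)"
      using assms(2) by (intro sum.cong) auto
    moreover have "(\<Sum>k\<in>I. coord e D x k *\<^sub>R e k) = x"
      using x by (subst sumI) (auto simp: dilated_face_def coord_expansion[OF e])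
    ultimately show "x \<in> convex hull ((\<lambda>j. D *\<^sub>R e j) ` I)" by simp
  qed
qed

subsection \<open>Dilated standard simplices\<close>

lemma std_simplex_scaled: "std_simplex d = (\<lambda>x. real d *\<^sub>R x) ` (convex hull (insert 0 Basis))"
  unfolding std_simplex_def convex_hull_scaling[symmetric] by simp

lemma std_simplex_iff:
  fixes x :: "'a::euclidean_space"
  assumes "d \<ge> 1"
  shows "x \<in> std_simplex d \<longleftrightarrow> (\<forall>b\<in>Basis. 0 \<le> x \<bullet> b) \<and> (\<Sum>b\<in>Basis. x \<bullet> b) \<le> real d"
    (is ?A)
    and "x \<in> interior (std_simplex d) \<longleftrightarrow> (\<forall>b\<in>Basis. 0 < x \<bullet> b) \<and> (\<Sum>b\<in>Basis. x \<bullet> b) < real d"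
    (is ?B)
proof -
  have d: "real d > 0" using assms by simp
  have scale: "x \<in> (\<lambda>x. real d *\<^sub>R x) ` S \<longleftrightarrow> (1 / real d) *\<^sub>R x \<in> S" for S :: "'a set"
  proof
    assume "(1 / real d) *\<^sub>R x \<in> S"
    then have "real d *\<^sub>R ((1 / real d) *\<^sub>R x) \<in> (\<lambda>x. real d *\<^sub>R x) ` S" by blast
    then show "x \<in> (\<lambda>x. real d *\<^sub>R x) ` S" using d by simp
  qed (use d in auto)
  have sum: "(\<Sum>b\<in>Basis. ((1 / real d) *\<^sub>R x) \<bullet> b) = (\<Sum>b\<in>Basis. x \<bullet> b) / real d"
    by (simp add: sum_divide_distrib)
  show ?A
    unfolding std_simplex_scaled scale std_simplex mem_Collect_eq sum using d
    by (auto simp: zero_le_divide_iff pos_divide_le_eq)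
  have "interior (std_simplex d :: 'a set) = (\<lambda>x. real d *\<^sub>R x) ` interior (convex hull (insert 0 Basis))"
    unfolding std_simplex_scaled using d
    by (intro interior_injective_linear_image injI linear_scaleR) simp
  then show ?B
    unfolding scale interior_std_simplex mem_Collect_eq using sum d
    by (auto simp: zero_less_divide_iff pos_divide_less_eq scale interior_std_simplex)
qed

lemma ball_Basis_enum:
  fixes e :: "nat \<Rightarrow> 'a::euclidean_space"
  assumes "basis_enum e"
  shows "(\<forall>b\<in>Basis. Q b) \<longleftrightarrow> (\<forall>k\<in>{1..DIM('a)}. Q (e k))"
proof -
  have "\<exists>k\<in>{1..DIM('a)}. b = e k" if "b \<in> Basis" for b
    using assms that unfolding basis_enum_def bij_betw_def by blast
  then show ?thesis using basis_enum_Basis[OF assms] by blast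
qed

lemma coord_nonneg_iff:
  fixes e :: "nat \<Rightarrow> 'a::euclidean_space"
  assumes "basis_enum e"
  shows "(\<forall>k\<le>DIM('a). 0 \<le> coord e D x k) \<longleftrightarrow> (\<forall>b\<in>Basis. 0 \<le> x \<bullet> b) \<and> (\<Sum>b\<in>Basis. x \<bullet> b) \<le> D"
    "(\<forall>k\<le>DIM('a). 0 < coord e D x k) \<longleftrightarrow> (\<forall>b\<in>Basis. 0 < x \<bullet> b) \<and> (\<Sum>b\<in>Basis. x \<bullet> b) < D"
proof -
  have all: "(\<forall>k\<le>DIM('a). Q k) \<longleftrightarrow> Q 0 \<and> (\<forall>k\<in>{1..DIM('a)}. Q k)" for Q
    by (auto simp: Suc_le_eq)
  show "(\<forall>k\<le>DIM('a). 0 \<le> coord e D x k) \<longleftrightarrow> (\<forall>b\<in>Basis. 0 \<le> x \<bullet> b) \<and> (\<Sum>b\<in>Basis. x \<bullet> b) \<le> D"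
    "(\<forall>k\<le>DIM('a). 0 < coord e D x k) \<longleftrightarrow> (\<forall>b\<in>Basis. 0 < x \<bullet> b) \<and> (\<Sum>b\<in>Basis. x \<bullet> b) < D"
    unfolding all ball_Basis_enum[OF assms] by (auto simp: coord_def)
qed

lemma std_simplex_coord:
  fixes e :: "nat \<Rightarrow> 'a::euclidean_space"
  assumes "basis_enum e" "d \<ge> 1"
  shows "x \<in> std_simplex d \<longleftrightarrow> (\<forall>k\<le>DIM('a). 0 \<le> coord e d x k)"
    "x \<in> interior (std_simplex d) \<longleftrightarrow> (\<forall>k\<le>DIM('a). 0 < coord e d x k)"
  using std_simplex_iff[OF assms(2)] coord_nonneg_iff[OF assms(1)] by auto

lemma sum_Basis_prod_real:
  fixes f :: "'a::euclidean_space \<times> real \<Rightarrow> 'c::comm_monoid_add"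
  shows "(\<Sum>b\<in>Basis. f b) = (\<Sum>b\<in>Basis. f (b, 0)) + f (0, 1)"
  unfolding Basis_prod_def
  by (subst sum.union_disjoint) (auto simp: sum.reindex inj_on_def)

lemma std_simplex_slice:
  fixes e :: "nat \<Rightarrow> 'a::euclidean_space"
  assumes "basis_enum e" "d \<ge> 1"
  shows "(x, h) \<in> std_simplex d \<longleftrightarrow> 0 \<le> h \<and> (\<forall>k\<le>DIM('a). 0 \<le> coord e (real d - h) x k)"
    "(x, h) \<in> interior (std_simplex d) \<longleftrightarrow> 0 < h \<and> (\<forall>k\<le>DIM('a). 0 < coord e (real d - h) x k)"
proof -
  have B: "(\<forall>b\<in>Basis. Q b) \<longleftrightarrow> (\<forall>b\<in>Basis. Q (b, 0)) \<and> Q (0, 1)" for Q :: "'a \<times> real \<Rightarrow> bool"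
    unfolding Basis_prod_def by auto
  show "(x, h) \<in> std_simplex d \<longleftrightarrow> 0 \<le> h \<and> (\<forall>k\<le>DIM('a). 0 \<le> coord e (real d - h) x k)"
    "(x, h) \<in> interior (std_simplex d) \<longleftrightarrow> 0 < h \<and> (\<forall>k\<le>DIM('a). 0 < coord e (real d - h) x k)"
    unfolding std_simplex_iff[OF assms(2)] coord_nonneg_iff[OF assms(1)] B sum_Basis_prod_real by auto
qed

subsection \<open>Joins between two consecutive levels\<close>

definition level_join :: "'a::euclidean_space set \<Rightarrow> 'a set \<Rightarrow> ('a \<times> real) set" where
  "level_join \<sigma> \<rho> = convex hull (\<sigma> \<times> {1} \<union> \<rho> \<times> {0})"

lemma convex_level: "convex \<sigma> \<Longrightarrow> convex (\<sigma> \<times> {h::real})"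
  by (intro convex_Times) auto

lemma level_join_empty [simp]:
  "convex \<sigma> \<Longrightarrow> level_join \<sigma> {} = \<sigma> \<times> {1}" "convex \<rho> \<Longrightarrow> level_join {} \<rho> = \<rho> \<times> {0}"
  by (simp_all add: level_join_def convex_level hull_same)

lemma mem_level_join:
  assumes "convex \<sigma>" "convex \<rho>"
  shows "(x, h) \<in> level_join \<sigma> \<rho> \<longleftrightarrow> h = 1 \<and> x \<in> \<sigma> \<or> h = 0 \<and> x \<in> \<rho> \<or>
    0 < h \<and> h < 1 \<and> (\<exists>s\<in>\<sigma>. \<exists>t\<in>\<rho>. x = h *\<^sub>R s + (1 - h) *\<^sub>R t)"
proof (cases "\<sigma> = {} \<or> \<rho> = {}")
  case True
  then show ?thesis using assms by auto
next
  case False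
  have "level_join \<sigma> \<rho> = {u *\<^sub>R s + v *\<^sub>R t | u v s t. u \<ge> 0 \<and> v \<ge> 0 \<and> u + v = 1 \<and> s \<in> \<sigma> \<times> {1} \<and> t \<in> \<rho> \<times> {0}}"
    unfolding level_join_def using False assms by (intro convex_hull_union_two convex_level) auto
  then have mem: "(x, h) \<in> level_join \<sigma> \<rho> \<longleftrightarrow> 0 \<le> h \<and> h \<le> 1 \<and> (\<exists>s\<in>\<sigma>. \<exists>t\<in>\<rho>. x = h *\<^sub>R s + (1 - h) *\<^sub>R t)"
    (is "_ \<longleftrightarrow> ?R")
  proof -
    have "?R \<longleftrightarrow> (\<exists>u v s t. (x, h) = u *\<^sub>R s + v *\<^sub>R t \<and> u \<ge> 0 \<and> v \<ge> 0 \<and> u + v = 1 \<and> s \<in> \<sigma> \<times> {1} \<and> t \<in> \<rho> \<times> {0})"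
    proof
      assume ?R
      then obtain s t where "0 \<le> h" "h \<le> 1" "s \<in> \<sigma>" "t \<in> \<rho>" "x = h *\<^sub>R s + (1 - h) *\<^sub>R t" by blast
      then show "\<exists>u v s t. (x, h) = u *\<^sub>R s + v *\<^sub>R t \<and> u \<ge> 0 \<and> v \<ge> 0 \<and> u + v = 1 \<and> s \<in> \<sigma> \<times> {1} \<and> t \<in> \<rho> \<times> {0}"
        by (intro exI[of _ h] exI[of _ "1 - h"] exI[of _ "(s, 1)"] exI[of _ "(t, 0)"]) auto
    next
      assume "\<exists>u v s t. (x, h) = u *\<^sub>R s + v *\<^sub>R t \<and> u \<ge> 0 \<and> v \<ge> 0 \<and> u + v = 1 \<and> s \<in> \<sigma> \<times> {1} \<and> t \<in> \<rho> \<times> {0}"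
      then obtain u v s t where "(x, h) = u *\<^sub>R (s, 1) + v *\<^sub>R (t, 0)" "u \<ge> 0" "v \<ge> 0" "u + v = 1" "s \<in> \<sigma>" "t \<in> \<rho>"
        by auto
      moreover from this have "h = u" "x = u *\<^sub>R s + v *\<^sub>R t" "v = 1 - u" by auto
      ultimately show ?R by auto
    qed
    with \<open>level_join \<sigma> \<rho> = _\<close> show ?thesis by simp
  qed
  have "(\<exists>s\<in>\<sigma>. \<exists>t\<in>\<rho>. x = 0 *\<^sub>R s + (1 - 0) *\<^sub>R t) \<longleftrightarrow> x \<in> \<rho>"
    "(\<exists>s\<in>\<sigma>. \<exists>t\<in>\<rho>. x = 1 *\<^sub>R s + (1 - 1) *\<^sub>R t) \<longleftrightarrow> x \<in> \<sigma>"
    using False by auto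
  then show ?thesis unfolding mem by (cases "h = 0"; cases "h = 1") auto
qed

lemma level_join_mono: "\<sigma> \<subseteq> \<sigma>' \<Longrightarrow> \<rho> \<subseteq> \<rho>' \<Longrightarrow> level_join \<sigma> \<rho> \<subseteq> level_join \<sigma>' \<rho>'"
  unfolding level_join_def by (intro hull_mono) auto

lemma level_join_hull:
  "level_join (convex hull C) (convex hull D) = convex hull (C \<times> {1} \<union> D \<times> {0})"
proof -
  have "(convex hull C) \<times> {1::real} = convex hull (C \<times> {1})"
    "(convex hull D) \<times> {0::real} = convex hull (D \<times> {0})"
    by (simp_all add: convex_hull_Times)
  then show ?thesis unfolding level_join_def by (metis hull_Un_left hull_Un_right)
qed

subsection \<open>Cells of the staircase\<close>

text \<open>The rank \<open>r\<close> is the identity for \<open>K + L'\<close> and reverses the order for \<open>K + (-1)L'\<close>.  The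
  cell with index \<open>i\<close> is the join of the face of the upper simplex spanned by ranks at most
  \<open>r i\<close> and of the face of the lower simplex spanned by ranks at least \<open>r i\<close>.\<close>

locale staircase =
  fixes e :: "nat \<Rightarrow> 'a::euclidean_space" and r :: "nat \<Rightarrow> nat" and d :: nat
  assumes e: "basis_enum e" and r: "inj_on r {..DIM('a)}" and d: "d \<ge> 1"
begin

definition ranks_upto where "ranks_upto i = {k. k \<le> DIM('a) \<and> r k \<le> r i}"
definition ranks_from where "ranks_from i = {k. k \<le> DIM('a) \<and> r i \<le> r k}"

definition upper where "upper i = dilated_face e (real d) (ranks_upto i)"
definition lower where "lower i = dilated_face e (real (d + 1)) (ranks_from i)"

lemma rank_eq: "i \<le> DIM('a) \<Longrightarrow> j \<le> DIM('a) \<Longrightarrow> r i = r j \<Longrightarrow> i = j"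
  using r by (auto simp: inj_on_def)

lemma convex_upper: "convex (upper i)" and convex_lower: "convex (lower i)"
  by (simp_all add: upper_def lower_def convex_dilated_face)

lemma upper_coord: "s \<in> upper i \<Longrightarrow> k \<le> DIM('a) \<Longrightarrow> 0 \<le> coord e d s k"
  "s \<in> upper i \<Longrightarrow> k \<le> DIM('a) \<Longrightarrow> r i < r k \<Longrightarrow> coord e d s k = 0"
  by (auto simp: upper_def dilated_face_def ranks_upto_def)

lemma lower_coord: "t \<in> lower i \<Longrightarrow> k \<le> DIM('a) \<Longrightarrow> 0 \<le> coord e (d + 1) t k"
  "t \<in> lower i \<Longrightarrow> k \<le> DIM('a) \<Longrightarrow> r k < r i \<Longrightarrow> coord e (d + 1) t k = 0"
  by (auto simp: lower_def dilated_face_def ranks_from_def)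

text \<open>A point strictly between the two levels determines its two components, even if they lie in
  different cells.  All coordinates of \<open>s\<close> are at most those of \<open>s'\<close> if \<open>r i < r j\<close>, and they have the
  same sum.\<close>

lemma decomposition_unique_ordered:
  assumes ij: "i \<le> DIM('a)" "j \<le> DIM('a)" "r i < r j" and h: "0 < h" "h < 1"
    and st: "s \<in> upper i" "t \<in> lower i" "s' \<in> upper j" "t' \<in> lower j"
    and eq: "h *\<^sub>R s + (1 - h) *\<^sub>R t = h *\<^sub>R s' + (1 - h) *\<^sub>R t'"
  shows "s = s'"
proof -
  have c: "h * coord e d s k + (1 - h) * coord e (d + 1) t k
      = h * coord e d s' k + (1 - h) * coord e (d + 1) t' k" for k
    unfolding coord_affine[symmetric] eq by simp
  have le: "coord e d s k \<le> coord e d s' k" if k: "k \<le> DIM('a)" for k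
  proof (cases "r i < r k")
    case True
    then show ?thesis using upper_coord(2)[OF st(1) k] upper_coord(1)[OF st(3) k] by simp
  next
    case False
    then have "coord e (d + 1) t' k = 0" using lower_coord(2)[OF st(4) k] ij(3) by simp
    moreover have "0 \<le> (1 - h) * coord e (d + 1) t k" using lower_coord(1)[OF st(2) k] h by simp
    ultimately have "h * coord e d s k \<le> h * coord e d s' k" using c[of k] by simp
    then show ?thesis using h(1) by simp
  qed
  have "coord e d s k = coord e d s' k" if "k \<le> DIM('a)" for k
    by (rule sum_mono_inv[of _ "{..DIM('a)}"]) (use le that in \<open>auto simp: coord_sum[OF e]\<close>)
  then show ?thesis by (rule coord_eqI[OF e])
qed

lemma decomposition_unique_same:
  assumes i: "i \<le> DIM('a)" and h: "0 < h" "h < 1"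
    and st: "s \<in> upper i" "t \<in> lower i" "s' \<in> upper i" "t' \<in> lower i"
    and eq: "h *\<^sub>R s + (1 - h) *\<^sub>R t = h *\<^sub>R s' + (1 - h) *\<^sub>R t'"
  shows "s = s'"
proof -
  have c: "h * coord e d s k + (1 - h) * coord e (d + 1) t k
      = h * coord e d s' k + (1 - h) * coord e (d + 1) t' k" for k
    unfolding coord_affine[symmetric] eq by simp
  have k: "coord e d s k = coord e d s' k" if k: "k \<le> DIM('a)" "k \<noteq> i" for k
  proof (cases "r i < r k")
    case True
    then show ?thesis using upper_coord(2)[OF st(1) k(1)] upper_coord(2)[OF st(3) k(1)] by simp
  next
    case False
    then have "r k < r i" using rank_eq[OF k(1) i] k(2) by linarith
    then show ?thesis using c[of k] lower_coord(2)[OF st(2) k(1)] lower_coord(2)[OF st(4) k(1)] h by simp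
  qed
  have "coord e d s i = d - (\<Sum>k\<in>{..DIM('a)} - {i}. coord e d s k)" for s
    using coord_sum[OF e, of d s] i by (simp add: sum.remove[of _ i])
  then have "coord e d s i = coord e d s' i" using k by simp
  then have "coord e d s k = coord e d s' k" if "k \<le> DIM('a)" for k using k that by (cases "k = i") auto
  then show ?thesis by (rule coord_eqI[OF e])
qed

lemma decomposition_unique:
  assumes ij: "i \<le> DIM('a)" "j \<le> DIM('a)" and h: "0 < h" "h < 1"
    and st: "s \<in> upper i" "t \<in> lower i" "s' \<in> upper j" "t' \<in> lower j"
    and eq: "h *\<^sub>R s + (1 - h) *\<^sub>R t = h *\<^sub>R s' + (1 - h) *\<^sub>R t'"
  shows "s = s'" "t = t'"
proof -
  consider "r i < r j" | "r j < r i" | "r i = r j" by linarith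
  then show "s = s'"
  proof cases
    case 1
    then show ?thesis using decomposition_unique_ordered[OF ij _ h st eq] by blast
  next
    case 2
    then show ?thesis
      using decomposition_unique_ordered[OF ij(2,1) _ h st(3,4,1,2) eq[symmetric]] by simp
  next
    case 3
    then have "i = j" using rank_eq ij by blast
    then show ?thesis using decomposition_unique_same[OF ij(1) h st(1,2) _ _ eq] st by blast
  qed
  with eq h show "t = t'" by simp
qed

text \<open>Add up the values of \<open>y\<close> in the order of ranks; \<open>i\<close> is the index at which the partial sums pass \<open>c\<close>.\<close>

lemma ex_cell_index:
  fixes y :: "nat \<Rightarrow> real"
  assumes y: "\<And>k. k \<le> DIM('a) \<Longrightarrow> 0 \<le> y k" and c: "0 \<le> c" "c \<le> (\<Sum>k\<le>DIM('a). y k)"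
  obtains i where "i \<le> DIM('a)" "(\<Sum>k\<in>{k. k \<le> DIM('a) \<and> r k < r i}. y k) \<le> c"
    "c \<le> (\<Sum>k\<in>{k. k \<le> DIM('a) \<and> r k < r i}. y k) + y i"
proof -
  define A where "A = {k. k \<le> DIM('a) \<and> c \<le> (\<Sum>l\<in>ranks_upto k. y l)}"
  define m where "m = (ARG_MAX r k. k \<in> {..DIM('a)})"
  have m: "m \<le> DIM('a)" "\<And>k. k \<le> DIM('a) \<Longrightarrow> r k \<le> r m"
  proof -
    have "\<forall>k. k \<in> {..DIM('a)} \<longrightarrow> r k < Suc (Max (r ` {..DIM('a)}))"
      by (auto simp: less_Suc_eq_le intro!: Max_ge)
    then have "m \<in> {..DIM('a)} \<and> (\<forall>k. k \<in> {..DIM('a)} \<longrightarrow> r k \<le> r m)"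
      unfolding m_def by (intro arg_max_nat_lemma[of _ 0]) auto
    then show "m \<le> DIM('a)" "\<And>k. k \<le> DIM('a) \<Longrightarrow> r k \<le> r m" by auto
  qed
  have "ranks_upto m = {..DIM('a)}" using m by (auto simp: ranks_upto_def)
  then have "m \<in> A" using m(1) c(2) by (simp add: A_def)
  then obtain i where i: "i \<in> A" "\<And>k. k \<in> A \<Longrightarrow> r i \<le> r k"
    using ex_has_least_nat[of "\<lambda>k. k \<in> A" m r] by blast
  let ?L = "{k. k \<le> DIM('a) \<and> r k < r i}"
  have iD: "i \<le> DIM('a)" using i(1) by (simp add: A_def)
  have "ranks_upto i = insert i ?L" using iD rank_eq by (auto simp: ranks_upto_def le_less)
  then have up: "(\<Sum>l\<in>ranks_upto i. y l) = y i + (\<Sum>k\<in>?L. y k)" by simp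
  have "(\<Sum>k\<in>?L. y k) \<le> c"
  proof (cases "?L = {}")
    case True
    then show ?thesis using c(1) by (simp only: sum.empty)
  next
    case False
    have fin: "finite ?L" by auto
    then have "Max (r ` ?L) \<in> r ` ?L" using False by (intro Max_in) auto
    then obtain p where p: "p \<in> ?L" "r p = Max (r ` ?L)" by auto
    have max: "r k \<le> r p" if "k \<in> ?L" for k unfolding p(2) using fin that by (intro Max_ge) auto
    have "ranks_upto p = ?L" using p(1) max by (auto simp: ranks_upto_def)
    moreover have "p \<notin> A" using i(2)[of p] p(1) by auto
    ultimately show ?thesis using p(1) by (simp add: A_def)
  qed
  moreover have "c \<le> (\<Sum>k\<in>?L. y k) + y i" using i(1) up by (simp add: A_def)
  ultimately show ?thesis using that iD by blast
qed

text \<open>With \<open>i\<close> chosen for the threshold \<open>d h\<close>, the coordinates of rank below \<open>r i\<close> belong to the upper component,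
  those of rank above \<open>r i\<close> to the lower one, and the coordinate \<open>i\<close> is split so that the upper part has
  sum \<open>d h\<close>.\<close>

lemma staircase_cover:
  assumes h: "0 \<le> h" "h \<le> 1" and x: "\<And>k. k \<le> DIM('a) \<Longrightarrow> 0 \<le> coord e (real (d + 1) - h) x k"
  shows "\<exists>i\<le>DIM('a). (x, h) \<in> level_join (upper i) (lower i)"
proof -
  define y where "y = coord e (real (d + 1) - h) x"
  have ysum: "(\<Sum>k\<le>DIM('a). y k) = real (d + 1) - h" unfolding y_def by (rule coord_sum[OF e])
  have "0 \<le> (1 - h) * real (d + 1)" using h by simp
  then have le: "d * h \<le> real (d + 1) - h" by (simp add: algebra_simps)
  obtain i where i: "i \<le> DIM('a)" "(\<Sum>k\<in>{k. k \<le> DIM('a) \<and> r k < r i}. y k) \<le> d * h"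
    "d * h \<le> (\<Sum>k\<in>{k. k \<le> DIM('a) \<and> r k < r i}. y k) + y i"
    using ex_cell_index[of y "d * h"] x h le ysum unfolding y_def by auto
  let ?L = "{k. k \<le> DIM('a) \<and> r k < r i}"
  define S where "S = (\<Sum>k\<in>?L. y k)"
  have SL: "S = (\<Sum>k\<le>DIM('a). if r k < r i then y k else 0)"
    unfolding S_def by (subst sum.inter_filter[symmetric]) auto
  define \<alpha> where "\<alpha> k = (if k = i then d * h - S else if r k < r i then y k else 0)" for k
  define \<beta> where "\<beta> k = y k - \<alpha> k" for k
  have y0: "0 \<le> y k" if "k \<le> DIM('a)" for k using x[OF that] by (simp add: y_def)
  have \<alpha>0: "0 \<le> \<alpha> k" if "k \<le> DIM('a)" for k using y0[OF that] i(2) by (simp add: \<alpha>_def S_def)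
  have \<beta>0: "0 \<le> \<beta> k" if "k \<le> DIM('a)" for k
    using y0[OF that] i(3) by (auto simp: \<beta>_def \<alpha>_def S_def)
  have \<alpha>sum: "(\<Sum>k\<le>DIM('a). \<alpha> k) = d * h"
  proof -
    have "(\<Sum>k\<le>DIM('a). \<alpha> k) = (\<Sum>k\<le>DIM('a). (if k = i then d * h - S else 0) + (if r k < r i then y k else 0))"
      by (intro sum.cong) (auto simp: \<alpha>_def)
    also have "\<dots> = d * h" using i(1) SL by (simp add: sum.distrib)
    finally show ?thesis .
  qed
  have \<beta>sum: "(\<Sum>k\<le>DIM('a). \<beta> k) = (1 - h) * (d + 1)"
    unfolding \<beta>_def by (simp add: sum_subtractf ysum \<alpha>sum algebra_simps)
  have \<alpha>z: "\<alpha> k = 0" if "k \<le> DIM('a)" "k \<notin> ranks_upto i" for k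
    using that i(1) by (auto simp: \<alpha>_def ranks_upto_def)
  have \<beta>z: "\<beta> k = 0" if "k \<le> DIM('a)" "k \<notin> ranks_from i" for k
    using that i(1) by (auto simp: \<beta>_def \<alpha>_def ranks_from_def)
  have mem: "(\<Sum>j\<le>DIM('a). c j *\<^sub>R e j) \<in> dilated_face e D I"
    if "(\<Sum>k\<le>DIM('a). c k) = D" "\<And>k. k \<le> DIM('a) \<Longrightarrow> 0 \<le> c k"
      "\<And>k. k \<le> DIM('a) \<Longrightarrow> k \<notin> I \<Longrightarrow> c k = 0" for c D I
    using that coord_combination[OF e that(1)] by (auto simp: dilated_face_def)
  have xy: "x = (\<Sum>j\<le>DIM('a). y j *\<^sub>R e j)" unfolding y_def by (simp add: coord_expansion[OF e])
  consider "h = 0" | "h = 1" | "0 < h" "h < 1" using h by linarith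
  then have "(x, h) \<in> level_join (upper i) (lower i)"
  proof cases
    case 1
    have "\<alpha> k = 0" if "k \<le> DIM('a)" for k
      using sum_nonneg_eq_0_iff[of "{..DIM('a)}" \<alpha>] \<alpha>0 \<alpha>sum 1 that by auto
    then have "x = (\<Sum>j\<le>DIM('a). \<beta> j *\<^sub>R e j)" unfolding xy by (intro sum.cong) (auto simp: \<beta>_def)
    also have "\<dots> \<in> lower i" unfolding lower_def using \<beta>sum \<beta>0 \<beta>z 1 by (intro mem) auto
    finally show ?thesis using 1 by (simp add: mem_level_join convex_upper convex_lower)
  next
    case 2
    have "\<beta> k = 0" if "k \<le> DIM('a)" for k
      using sum_nonneg_eq_0_iff[of "{..DIM('a)}" \<beta>] \<beta>0 \<beta>sum 2 that by auto
    then have "x = (\<Sum>j\<le>DIM('a). \<alpha> j *\<^sub>R e j)" unfolding xy by (intro sum.cong) (auto simp: \<beta>_def)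
    also have "\<dots> \<in> upper i" unfolding upper_def using \<alpha>sum \<alpha>0 \<alpha>z 2 by (intro mem) auto
    finally show ?thesis using 2 by (simp add: mem_level_join convex_upper convex_lower)
  next
    case 3
    define s where "s = (\<Sum>j\<le>DIM('a). (\<alpha> j / h) *\<^sub>R e j)"
    define t where "t = (\<Sum>j\<le>DIM('a). (\<beta> j / (1 - h)) *\<^sub>R e j)"
    have "s \<in> upper i" unfolding s_def upper_def using \<alpha>sum \<alpha>0 \<alpha>z 3
      by (intro mem) (auto simp: sum_divide_distrib[symmetric])
    moreover have "t \<in> lower i" unfolding t_def lower_def using \<beta>sum \<beta>0 \<beta>z 3
      by (intro mem) (auto simp: sum_divide_distrib[symmetric])
    moreover have "h *\<^sub>R s + (1 - h) *\<^sub>R t = x"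
    proof -
      have "h *\<^sub>R s + (1 - h) *\<^sub>R t = (\<Sum>j\<le>DIM('a). \<alpha> j *\<^sub>R e j) + (\<Sum>j\<le>DIM('a). \<beta> j *\<^sub>R e j)"
        unfolding s_def t_def scaleR_sum_right using 3 by simp
      also have "\<dots> = x" unfolding xy by (simp add: sum.distrib[symmetric] scaleR_add_left[symmetric] \<beta>_def)
      finally show ?thesis .
    qed
    ultimately show ?thesis using 3 by (auto simp: mem_level_join convex_upper convex_lower)
  qed
  then show ?thesis using i(1) by blast
qed

end


section \<open>Existence and uniqueness of the layered triangulation\<close>

subsection \<open>Translations and levels\<close>

lemma vertices_translation: "vertices ((+) a ` \<sigma>) = (+) a ` vertices \<sigma>"
  unfolding vertices_def using extreme_points_of_translation[of a \<sigma>] by simp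

lemma simplex_translation: "k simplex \<sigma> \<Longrightarrow> k simplex ((+) a ` \<sigma>)"
  unfolding simplex_def
  by (metis affine_dependent_translation_eq card_image convex_hull_translation inj_on_add)

lemma face_of_translation_image:
  assumes "F face_of (+) a ` \<sigma>"
  obtains F' where "F' face_of \<sigma>" "F = (+) a ` F'"
proof -
  have "F \<subseteq> (+) a ` \<sigma>" using assms by (rule face_of_imp_subset)
  then obtain F' where "F = (+) a ` F'" by (rule subset_imageE)
  then show ?thesis using that assms by simp
qed

lemma triangulates_translation:
  assumes K: "triangulates K P"
  shows "triangulates ((`) ((+) a) ` K) ((+) a ` P)"
  unfolding triangulates_def simplicial_complex_def
proof (intro conjI ballI allI impI)
  show "finite ((`) ((+) a) ` K)" using triangulates_finite[OF K] by simp
  show "\<exists>k. k simplex S" if "S \<in> (`) ((+) a) ` K" for S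
    using that triangulates_simplex[OF K] simplex_translation by blast
  show "F \<in> (`) ((+) a) ` K" if FS: "S \<in> (`) ((+) a) ` K \<and> F face_of S" for F S
  proof -
    obtain \<sigma> where s: "\<sigma> \<in> K" "S = (+) a ` \<sigma>" using FS by blast
    then obtain F' where "F' face_of \<sigma>" "F = (+) a ` F'"
      using FS face_of_translation_image by blast
    then show ?thesis using triangulates_face[OF K s(1)] by blast
  qed
  show "S \<inter> S' face_of S" if SS': "S \<in> (`) ((+) a) ` K \<and> S' \<in> (`) ((+) a) ` K" for S S'
  proof -
    obtain \<sigma> \<sigma>' where s: "\<sigma> \<in> K" "\<sigma>' \<in> K" "S = (+) a ` \<sigma>" "S' = (+) a ` \<sigma>'" using SS' by blast
    have "S \<inter> S' = (+) a ` (\<sigma> \<inter> \<sigma>')" unfolding s by (simp add: image_Int)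
    then show ?thesis using triangulates_Int(1)[OF K s(1,2)] s(3) by simp
  qed
  show "\<Union> ((`) ((+) a) ` K) = (+) a ` P" using K by (auto simp: triangulates_def)
qed

lemma unimodular_translation:
  assumes \<sigma>: "unimodular \<sigma>" and a: "a \<in> lattice_M"
  shows "unimodular ((+) a ` \<sigma>)"
  unfolding unimodular_def
proof
  show "vertices ((+) a ` \<sigma>) \<subseteq> lattice_M"
    using \<sigma> a by (auto simp: vertices_translation unimodular_def intro: lattice_M_add)
  show "extends_int (vertices ((+) a ` \<sigma>))"
    unfolding extends_int_def
  proof (intro allI impI)
    fix \<epsilon> :: "'a \<Rightarrow> real" assume e: "\<forall>x\<in>vertices ((+) a ` \<sigma>). \<epsilon> x \<in> \<int>"
    obtain u k where u: "u \<in> lattice_N" "k \<in> \<int>" "\<And>x. x \<in> vertices \<sigma> \<Longrightarrow> x \<bullet> u + k = \<epsilon> (a + x)"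
      by (rule extends_intE[of "vertices \<sigma>" "\<lambda>x. \<epsilon> (a + x)"])
        (use e \<sigma> in \<open>auto simp: unimodular_def vertices_translation\<close>)
    have "y \<bullet> u + (k - a \<bullet> u) = \<epsilon> y" if "y \<in> vertices ((+) a ` \<sigma>)" for y
      using that u(3) by (auto simp: vertices_translation inner_add_left)
    moreover have "k - a \<bullet> u \<in> \<int>" using u(1,2) a by (simp add: inner_lattice)
    ultimately show "\<exists>u\<in>lattice_N. \<exists>k\<in>\<int>. \<forall>y\<in>vertices ((+) a ` \<sigma>). y \<bullet> u + k = \<epsilon> y"
      using u(1) by blast
  qed
qed

lemma lattice_M_Pair: "(x, h) \<in> lattice_M \<longleftrightarrow> x \<in> lattice_M \<and> (h::real) \<in> \<int>"
  unfolding lattice_M_def Basis_prod_def by auto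

lemma lattice_N_Pair: "(x, h) \<in> lattice_N \<longleftrightarrow> x \<in> lattice_N \<and> (h::real) \<in> \<int>"
  by (simp add: lattice_N_eq lattice_M_Pair)

lemma image_level: "(\<lambda>x. (x, h)) ` \<sigma> = \<sigma> \<times> {h}"
  by auto

lemma embed_eq: "embed L = (\<lambda>\<sigma>. \<sigma> \<times> {0}) ` L"
  by (simp add: embed_def image_level)

lemma shift_up_eq: "shift_up K = (`) ((+) (0, 1)) ` K"
  by (simp add: shift_up_def add.commute)

lemma shift_level: "(+) (0, 1) ` (\<sigma> \<times> {h}) = (\<sigma> :: 'a::euclidean_space set) \<times> {h + 1 :: real}"
  by (auto simp: image_iff)

lemma top_face_eq: "top_face e d I = (convex hull ((\<lambda>j. real d *\<^sub>R e j) ` I)) \<times> {1}"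
proof -
  have "(\<lambda>j. (real d *\<^sub>R e j, 1::real)) ` I = ((\<lambda>j. real d *\<^sub>R e j) ` I) \<times> {1}" by auto
  then show ?thesis by (simp add: top_face_def convex_hull_Times)
qed

lemma bottom_face_eq: "bottom_face e d I = (convex hull ((\<lambda>j. real (d + 1) *\<^sub>R e j) ` I)) \<times> {0}"
proof -
  have "(\<lambda>j. (real (d + 1) *\<^sub>R e j, 0::real)) ` I = ((\<lambda>j. real (d + 1) *\<^sub>R e j) ` I) \<times> {0}" by auto
  then show ?thesis by (simp only: bottom_face_def convex_hull_Times) simp
qed

lemma dilated_face_face_of: "dilated_face e D I face_of dilated_face e D UNIV"
  unfolding face_of_def
proof (intro conjI ballI impI)
  show "dilated_face e D I \<subseteq> dilated_face e D UNIV" by (auto simp: dilated_face_def)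
  show "convex (dilated_face e D I)" by (rule convex_dilated_face)
  fix a b x
  assume ab: "a \<in> dilated_face e D UNIV" "b \<in> dilated_face e D UNIV"
    and x: "x \<in> dilated_face e D I" "x \<in> open_segment a b"
  obtain u where u: "0 < u" "u < 1" "x = (1 - u) *\<^sub>R a + u *\<^sub>R b" using x(2) by (auto simp: in_segment)
  have "coord e D a k = 0 \<and> coord e D b k = 0" if k: "k \<le> DIM('a)" "k \<notin> I" for k
  proof -
    have "(1 - u) * D + u * D = D" by (simp add: algebra_simps)
    then have "(1 - u) * coord e D a k + u * coord e D b k = 0"
      using coord_affine[of e "1 - u" D u D a b k] x(1) k u(3) by (simp add: dilated_face_def)
    moreover have "0 \<le> (1 - u) * coord e D a k" "0 \<le> u * coord e D b k"
      using ab k u by (auto simp: dilated_face_def)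
    ultimately show ?thesis using u by (simp add: add_nonneg_eq_0_iff)
  qed
  then show "a \<in> dilated_face e D I" "b \<in> dilated_face e D I" using ab by (auto simp: dilated_face_def)
qed

subsection \<open>Gluing integral affine functions\<close>

context staircase
begin

lemma ex_integral_form:
  assumes g: "\<And>k. k \<le> DIM('a) \<Longrightarrow> g k \<in> \<int>"
  obtains u where "u \<in> lattice_N" "\<And>k. k \<le> DIM('a) \<Longrightarrow> e k \<bullet> u = g k - g 0"
proof -
  define u where "u = (\<Sum>j\<le>DIM('a). (g j - g 0) *\<^sub>R e j)"
  have "e k \<bullet> u = g k - g 0" if "k \<le> DIM('a)" for k
  proof (cases "k = 0")
    case True
    then show ?thesis using e by (simp add: basis_enum_def)
  next
    case False
    then have k: "k \<in> {1..DIM('a)}" using that by auto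
    have "u \<bullet> e k = (\<Sum>j\<le>DIM('a). if j = k then g k - g 0 else 0)"
      unfolding u_def inner_sum_left by (intro sum.cong) (auto simp: basis_enum_inner[OF e _ k])
    then show ?thesis using that by (simp add: inner_commute)
  qed
  moreover have "e j \<in> lattice_N" if "j \<le> DIM('a)" for j
  proof (cases "j = 0")
    case True
    then show ?thesis using e by (simp add: basis_enum_def lattice_N_0)
  next
    case False
    then show ?thesis
      using that basis_enum_Basis[OF e, of j] lattice_M_Basis by (auto simp: lattice_N_eq)
  qed
  then have "u \<in> lattice_N" unfolding u_def using g by (intro lattice_N_sum lattice_N_scale) auto
  ultimately show ?thesis using that by blast
qed

lemma inner_eq_sum_coord: "x \<bullet> u = (\<Sum>k\<le>DIM('a). coord e D x k * (e k \<bullet> u))"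
proof -
  have "x \<bullet> u = (\<Sum>k\<le>DIM('a). coord e D x k *\<^sub>R e k) \<bullet> u" by (simp add: coord_expansion[OF e])
  then show ?thesis by (simp add: inner_sum_left)
qed

text \<open>The faces \<open>upper i\<close> and \<open>lower i\<close> span complementary directions that only share \<open>e\<^sub>i\<close>, so linear
  forms on them can be prescribed independently, and the last coordinate adjusts the constants.\<close>

lemma extends_int_level_join:
  assumes i: "i \<le> DIM('a)" and CD: "C \<subseteq> upper i" "D \<subseteq> lower i" "extends_int C" "extends_int D"
  shows "extends_int (C \<times> {1} \<union> D \<times> {0::real})"
  unfolding extends_int_def
proof (intro allI impI)
  fix \<epsilon> :: "'a \<times> real \<Rightarrow> real" assume \<epsilon>: "\<forall>a\<in>C \<times> {1} \<union> D \<times> {0}. \<epsilon> a \<in> \<int>"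
  obtain u1 k1 where u1: "u1 \<in> lattice_N" "k1 \<in> \<int>" "\<And>a. a \<in> C \<Longrightarrow> a \<bullet> u1 + k1 = \<epsilon> (a, 1)"
    by (rule extends_intE[OF CD(3), of "\<lambda>a. \<epsilon> (a, 1)"]) (use \<epsilon> in auto)
  obtain u2 k2 where u2: "u2 \<in> lattice_N" "k2 \<in> \<int>" "\<And>a. a \<in> D \<Longrightarrow> a \<bullet> u2 + k2 = \<epsilon> (a, 0)"
    by (rule extends_intE[OF CD(4), of "\<lambda>a. \<epsilon> (a, 0)"]) (use \<epsilon> in auto)
  have eM: "e k \<in> lattice_M" if "k \<le> DIM('a)" for k
    using that e basis_enum_Basis[OF e, of k] lattice_M_Basis
    by (cases "k = 0") (auto simp: basis_enum_def)
  define g where "g k = (if r k \<le> r i then e k \<bullet> u1 - e i \<bullet> u1 else e k \<bullet> u2 - e i \<bullet> u2)" for k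
  have gZ: "g k \<in> \<int>" if "k \<le> DIM('a)" for k
    using u1(1) u2(1) eM[OF that] eM[OF i] by (auto simp: g_def intro!: Ints_diff inner_lattice)
  obtain u where u: "u \<in> lattice_N" "\<And>k. k \<le> DIM('a) \<Longrightarrow> e k \<bullet> u = g k - g 0"
    using ex_integral_form[of g] gZ by blast
  define c1 where "c1 = d * (e i \<bullet> u1 + g 0)"
  define c2 where "c2 = real (d + 1) * (e i \<bullet> u2 + g 0)"
  have cZ: "c1 \<in> \<int>" "c2 \<in> \<int>"
    using u1(1) u2(1) eM[OF i] gZ[of 0] by (auto simp: c1_def c2_def intro!: Ints_mult Ints_add inner_lattice)
  have C: "a \<bullet> u = a \<bullet> u1 - c1" if "a \<in> C" for a
  proof -
    have "coord e d a k * (e k \<bullet> u) = coord e d a k * (e k \<bullet> u1 - (e i \<bullet> u1 + g 0))" if k: "k \<le> DIM('a)" for k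
      using upper_coord(2)[of a i k] \<open>a \<in> C\<close> CD(1) k by (cases "r k \<le> r i") (auto simp: u(2) g_def)
    then have "a \<bullet> u = (\<Sum>k\<le>DIM('a). coord e d a k * (e k \<bullet> u1 - (e i \<bullet> u1 + g 0)))"
      unfolding inner_eq_sum_coord[of a u d] by (intro sum.cong) auto
    also have "\<dots> = a \<bullet> u1 - (\<Sum>k\<le>DIM('a). coord e d a k) * (e i \<bullet> u1 + g 0)"
      unfolding inner_eq_sum_coord[of a u1 d] sum_distrib_right sum_subtractf[symmetric]
      by (intro sum.cong) (auto simp: algebra_simps)
    finally show ?thesis by (simp add: coord_sum[OF e] c1_def)
  qed
  have D: "a \<bullet> u = a \<bullet> u2 - c2" if "a \<in> D" for a
  proof -
    have "coord e (d + 1) a k * (e k \<bullet> u) = coord e (d + 1) a k * (e k \<bullet> u2 - (e i \<bullet> u2 + g 0))"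
      if k: "k \<le> DIM('a)" for k
    proof -
      consider "r k < r i" | "k = i" | "r i < r k" using rank_eq[OF k i] by linarith
      then show ?thesis
        using lower_coord(2)[of a i k] \<open>a \<in> D\<close> CD(2) k by cases (auto simp: u(2) g_def)
    qed
    then have "a \<bullet> u = (\<Sum>k\<le>DIM('a). coord e (d + 1) a k * (e k \<bullet> u2 - (e i \<bullet> u2 + g 0)))"
      unfolding inner_eq_sum_coord[of a u "d + 1"] by (intro sum.cong) auto
    also have "\<dots> = a \<bullet> u2 - (\<Sum>k\<le>DIM('a). coord e (d + 1) a k) * (e i \<bullet> u2 + g 0)"
      unfolding inner_eq_sum_coord[of a u2 "d + 1"] sum_distrib_right sum_subtractf[symmetric]
      by (intro sum.cong) (auto simp: algebra_simps)
    finally show ?thesis by (simp add: coord_sum[OF e] c2_def)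
  qed
  let ?u = "(u, (k1 + c1) - (k2 + c2))"
  have "?u \<in> lattice_N" using u(1) u1(2) u2(2) cZ by (simp add: lattice_N_Pair)
  moreover have "k2 + c2 \<in> \<int>" using u2(2) cZ by simp
  moreover have "a \<bullet> ?u + (k2 + c2) = \<epsilon> a" if "a \<in> C \<times> {1} \<union> D \<times> {0}" for a
    using that C[of "fst a"] D[of "fst a"] u1(3)[of "fst a"] u2(3)[of "fst a"]
    by (cases a) (auto simp: algebra_simps)
  ultimately show "\<exists>u\<in>lattice_N. \<exists>k\<in>\<int>. \<forall>a\<in>C \<times> {1} \<union> D \<times> {0}. a \<bullet> u + k = \<epsilon> a" by blast
qed

lemma upper_eq: "convex hull ((\<lambda>j. real d *\<^sub>R e j) ` ranks_upto i) = upper i"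
  and lower_eq: "convex hull ((\<lambda>j. real (d + 1) *\<^sub>R e j) ` ranks_from i) = lower i"
  unfolding upper_def lower_def
  by (rule convex_hull_dilated[OF e]; use d in \<open>auto simp: ranks_upto_def ranks_from_def\<close>)+

lemma std_simplex_dilated: "std_simplex d = dilated_face e d UNIV"
    "std_simplex (d + 1) = dilated_face e (real (d + 1)) UNIV"
  using std_simplex_coord(1)[OF e d] std_simplex_coord(1)[OF e, of "d + 1"]
  by (auto simp: dilated_face_def)

lemma upper_face: "upper i face_of std_simplex d"
  and lower_face: "lower i face_of std_simplex (d + 1)"
  unfolding upper_def lower_def std_simplex_dilated by (rule dilated_face_face_of)+

end

subsection \<open>The simplices of the layered triangulation\<close>

text \<open>\<open>A\<close> is the restriction of \<open>K\<close> to the bottom of its simplex, so that a slab is filled between \<open>A\<close> on its upper and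
  \<open>B\<close> on its lower side.\<close>

locale layers = staircase e r d for e :: "nat \<Rightarrow> 'a::euclidean_space" and r d +
  fixes K :: "('a \<times> real) set set" and A B :: "'a set set"
  assumes K: "triangulates K (std_simplex d)" and A: "triangulates A (std_simplex d)"
    and B: "triangulates B (std_simplex (d + 1))"
    and uniK: "\<And>\<sigma>. \<sigma> \<in> K \<Longrightarrow> unimodular \<sigma>" and uniA: "\<And>\<sigma>. \<sigma> \<in> A \<Longrightarrow> unimodular \<sigma>"
    and uniB: "\<And>\<sigma>. \<sigma> \<in> B \<Longrightarrow> unimodular \<sigma>"
    and bottom: "restriction K {p. snd p = 0} = embed A"
begin

definition joins where
  "joins = {level_join \<sigma> \<rho> | \<sigma> \<rho>. \<exists>i\<le>DIM('a). \<sigma> \<in> A \<and> \<sigma> \<subseteq> upper i \<and> \<rho> \<in> B \<and> \<rho> \<subseteq> lower i}"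

definition layered where "layered = shift_up K \<union> joins"

lemma convex_A: "\<sigma> \<in> A \<Longrightarrow> convex \<sigma>" and convex_B: "\<rho> \<in> B \<Longrightarrow> convex \<rho>"
  using triangulates_simplex[OF A] triangulates_simplex[OF B] convex_simplex by blast+

lemma shift_K: "triangulates (shift_up K) ((+) (0, 1) ` std_simplex d)"
  unfolding shift_up_eq by (rule triangulates_translation[OF K])

lemma shift_std_simplex:
  fixes x :: 'a and h :: real
  shows "(x, h) \<in> (+) (0, 1) ` std_simplex d \<longleftrightarrow> (x, h) \<in> std_simplex (d + 1) \<and> h \<ge> 1"
proof -
  have "(x, h) \<in> (+) (0, 1) ` std_simplex d \<longleftrightarrow> (x, h - 1) \<in> std_simplex d"
  proof
    assume "(x, h) \<in> (+) (0, 1) ` std_simplex d"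
    then obtain q where "q \<in> std_simplex d" "(x, h) = (0, 1) + q" by blast
    then show "(x, h - 1) \<in> std_simplex d" by (cases q) auto
  next
    assume "(x, h - 1) \<in> std_simplex d"
    then have "(0, 1) + (x, h - 1) \<in> (+) (0, 1) ` std_simplex d" by (rule imageI)
    then show "(x, h) \<in> (+) (0, 1) ` std_simplex d" by simp
  qed
  also have "\<dots> \<longleftrightarrow> 0 \<le> h - 1 \<and> (\<forall>k\<le>DIM('a). 0 \<le> coord e (real d - (h - 1)) x k)"
    by (rule std_simplex_slice(1)[OF e d])
  also have "real d - (h - 1) = real (d + 1) - h" by simp
  also have "0 \<le> h - 1 \<and> (\<forall>k\<le>DIM('a). 0 \<le> coord e (real (d + 1) - h) x k) \<longleftrightarrow>
      (x, h) \<in> std_simplex (d + 1) \<and> h \<ge> 1"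
    using std_simplex_slice(1)[OF e, of "d + 1" x h] by auto
  finally show ?thesis .
qed

lemma level_A: "\<sigma> \<in> A \<Longrightarrow> \<sigma> \<times> {1} \<in> shift_up K"
proof -
  assume "\<sigma> \<in> A"
  then have "\<sigma> \<times> {0} \<in> K" using bottom by (auto simp: embed_eq restriction_def)
  then have "(+) (0, 1) ` (\<sigma> \<times> {0}) \<in> shift_up K" unfolding shift_up_eq by blast
  then show ?thesis by (simp add: shift_level)
qed

lemma shift_K_mem: "\<omega> \<in> shift_up K \<Longrightarrow> p \<in> \<omega> \<Longrightarrow> p \<in> std_simplex (d + 1) \<and> snd p \<ge> 1"
  using triangulates_subset[OF shift_K, of \<omega>] shift_std_simplex[of "fst p" "snd p"]
  unfolding prod.collapse by blast

lemma shift_K_above: "\<omega> \<in> shift_up K \<Longrightarrow> p \<in> \<omega> \<Longrightarrow> snd p \<ge> 1"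
  using shift_K_mem by blast

lemma shift_K_level:
  assumes "\<omega> \<in> shift_up K" "\<And>p. p \<in> \<omega> \<Longrightarrow> snd p \<le> 1"
  obtains \<sigma> where "\<sigma> \<in> A" "\<omega> = \<sigma> \<times> {1}"
proof -
  obtain \<kappa> where \<kappa>: "\<kappa> \<in> K" "\<omega> = (+) (0, 1) ` \<kappa>" using assms(1) by (auto simp: shift_up_eq)
  have "snd p = 0" if "p \<in> \<kappa>" for p
    using shift_K_above[OF assms(1), of "(0, 1) + p"] assms(2)[of "(0, 1) + p"] that \<kappa>(2) by auto
  then have "\<kappa> \<in> embed A" unfolding bottom[symmetric] using \<kappa>(1) by (auto simp: restriction_def)
  then obtain \<sigma> where "\<sigma> \<in> A" "\<kappa> = \<sigma> \<times> {0}" by (auto simp: embed_eq)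
  then show ?thesis using that \<kappa>(2) by (simp add: shift_level)
qed

lemma joinsE:
  assumes "\<omega> \<in> joins"
  obtains \<sigma> \<rho> i where "i \<le> DIM('a)" "\<sigma> \<in> A" "\<sigma> \<subseteq> upper i" "\<rho> \<in> B" "\<rho> \<subseteq> lower i" "\<omega> = level_join \<sigma> \<rho>"
  using assms unfolding joins_def by blast

lemma joinsI: "i \<le> DIM('a) \<Longrightarrow> \<sigma> \<in> A \<Longrightarrow> \<sigma> \<subseteq> upper i \<Longrightarrow> \<rho> \<in> B \<Longrightarrow> \<rho> \<subseteq> lower i \<Longrightarrow> level_join \<sigma> \<rho> \<in> joins"
  unfolding joins_def by blast

lemma mem_join:
  assumes "\<sigma> \<in> A" "\<rho> \<in> B"
  shows "(x, h) \<in> level_join \<sigma> \<rho> \<longleftrightarrow> h = 1 \<and> x \<in> \<sigma> \<or> h = 0 \<and> x \<in> \<rho> \<or>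
    0 < h \<and> h < 1 \<and> (\<exists>s\<in>\<sigma>. \<exists>t\<in>\<rho>. x = h *\<^sub>R s + (1 - h) *\<^sub>R t)"
  using mem_level_join convex_A[OF assms(1)] convex_B[OF assms(2)] by blast

lemma join_simplex:
  assumes i: "i \<le> DIM('a)" and \<sigma>: "\<sigma> \<in> A" "\<sigma> \<subseteq> upper i" and \<rho>: "\<rho> \<in> B" "\<rho> \<subseteq> lower i"
  shows "vertices (level_join \<sigma> \<rho>) = vertices \<sigma> \<times> {1} \<union> vertices \<rho> \<times> {0}"
    "unimodular (level_join \<sigma> \<rho>)" "\<exists>k. k simplex level_join \<sigma> \<rho>"
proof -
  let ?V = "vertices \<sigma> \<times> {1} \<union> vertices \<rho> \<times> {0::real}"
  obtain k l where kl: "k simplex \<sigma>" "l simplex \<rho>"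
    using triangulates_simplex[OF A \<sigma>(1)] triangulates_simplex[OF B \<rho>(1)] by blast
  have ext: "extends_int ?V"
    using uniA[OF \<sigma>(1)] uniB[OF \<rho>(1)] vertices_subset[of \<sigma>] vertices_subset[of \<rho>] \<sigma>(2) \<rho>(2)
    by (intro extends_int_level_join[OF i]) (auto simp: unimodular_def)
  have "finite ?V" using kl simplex_vertices(2) by blast
  then have ind: "\<not> affine_dependent ?V" using ext by (rule extends_int_affine_independent)
  have hull: "level_join \<sigma> \<rho> = convex hull ?V"
    using level_join_hull[of "vertices \<sigma>" "vertices \<rho>"] simplex_vertices(3)[OF kl(1)]
      simplex_vertices(3)[OF kl(2)] by simp
  show V: "vertices (level_join \<sigma> \<rho>) = ?V" unfolding hull by (rule vertices_convex_hull[OF ind])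
  show "unimodular (level_join \<sigma> \<rho>)"
    unfolding unimodular_def V using ext uniA[OF \<sigma>(1)] uniB[OF \<rho>(1)]
    by (auto simp: unimodular_def lattice_M_Pair)
  have "(int (card ?V) - 1) simplex level_join \<sigma> \<rho>" unfolding hull simplex_def using ind by auto
  then show "\<exists>k. k simplex level_join \<sigma> \<rho>" by blast
qed

lemma join_face:
  assumes i: "i \<le> DIM('a)" and \<sigma>: "\<sigma> \<in> A" "\<sigma> \<subseteq> upper i" and \<rho>: "\<rho> \<in> B" "\<rho> \<subseteq> lower i"
    and F: "\<sigma>' face_of \<sigma>" "\<rho>' face_of \<rho>"
  shows "level_join \<sigma>' \<rho>' face_of level_join \<sigma> \<rho>"
proof -
  have \<sigma>': "\<sigma>' \<in> A" "\<sigma>' \<subseteq> upper i"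
    using triangulates_face[OF A \<sigma>(1) F(1)] face_of_imp_subset[OF F(1)] \<sigma>(2) by auto
  have \<rho>': "\<rho>' \<in> B" "\<rho>' \<subseteq> lower i"
    using triangulates_face[OF B \<rho>(1) F(2)] face_of_imp_subset[OF F(2)] \<rho>(2) by auto
  note J = join_simplex[OF i \<sigma> \<rho>] and J' = join_simplex[OF i \<sigma>' \<rho>']
  obtain k l where kl: "k simplex level_join \<sigma> \<rho>" "l simplex level_join \<sigma>' \<rho>'" using J(3) J'(3) by blast
  have "vertices \<sigma>' \<subseteq> vertices \<sigma>" "vertices \<rho>' \<subseteq> vertices \<rho>"
    using vertices_face_eq[OF F(1)] vertices_face_eq[OF F(2)] by auto
  then show ?thesis unfolding simplex_face_iff_vertices[OF kl] J(1) J'(1) by blast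
qed

lemma join_faceE:
  assumes i: "i \<le> DIM('a)" and \<sigma>: "\<sigma> \<in> A" "\<sigma> \<subseteq> upper i" and \<rho>: "\<rho> \<in> B" "\<rho> \<subseteq> lower i"
    and F: "F face_of level_join \<sigma> \<rho>"
  shows "F \<in> joins"
proof -
  note J = join_simplex[OF i \<sigma> \<rho>]
  obtain k l m where kl: "k simplex \<sigma>" "l simplex \<rho>" "m simplex level_join \<sigma> \<rho>"
    using triangulates_simplex[OF A \<sigma>(1)] triangulates_simplex[OF B \<rho>(1)] J(3) by blast
  obtain c where c: "c \<subseteq> vertices \<sigma> \<times> {1} \<union> vertices \<rho> \<times> {0}" "F = convex hull c"
    using F simplex_face_iff[OF kl(3)] J(1) by auto
  define C where "C = {x. (x, 1) \<in> c}"
  define D where "D = {x. (x, 0) \<in> c}"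
  have CD: "C \<subseteq> vertices \<sigma>" "D \<subseteq> vertices \<rho>" using c(1) by (auto simp: C_def D_def)
  have "c = C \<times> {1} \<union> D \<times> {0}" using c(1) by (auto simp: C_def D_def)
  then have FJ: "F = level_join (convex hull C) (convex hull D)" using c(2) by (simp add: level_join_hull)
  have f: "convex hull C face_of \<sigma>" "convex hull D face_of \<rho>"
    using CD simplex_face_iff[OF kl(1)] simplex_face_iff[OF kl(2)] by blast+
  show ?thesis unfolding FJ
    using triangulates_face[OF A \<sigma>(1) f(1)] triangulates_face[OF B \<rho>(1) f(2)]
      face_of_imp_subset[OF f(1)] face_of_imp_subset[OF f(2)] \<sigma>(2) \<rho>(2)
    by (intro joinsI[OF i]) auto
qed

text \<open>Points between the levels decompose uniquely, across all cells.\<close>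

lemma join_Int:
  assumes ij: "i \<le> DIM('a)" "j \<le> DIM('a)"
    and \<sigma>: "\<sigma> \<in> A" "\<sigma> \<subseteq> upper i" and \<rho>: "\<rho> \<in> B" "\<rho> \<subseteq> lower i"
    and \<sigma>': "\<sigma>' \<in> A" "\<sigma>' \<subseteq> upper j" and \<rho>': "\<rho>' \<in> B" "\<rho>' \<subseteq> lower j"
  shows "level_join \<sigma> \<rho> \<inter> level_join \<sigma>' \<rho>' = level_join (\<sigma> \<inter> \<sigma>') (\<rho> \<inter> \<rho>')"
proof (intro subset_antisym subsetI)
  have AB: "\<sigma> \<inter> \<sigma>' \<in> A" "\<rho> \<inter> \<rho>' \<in> B" using triangulates_Int A B \<sigma> \<rho> \<sigma>' \<rho>' by blast+
  fix p assume p: "p \<in> level_join \<sigma> \<rho> \<inter> level_join \<sigma>' \<rho>'"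
  obtain x h where xh: "p = (x, h)" by (cases p)
  have m: "(x, h) \<in> level_join \<sigma> \<rho>" "(x, h) \<in> level_join \<sigma>' \<rho>'" using p xh by auto
  consider "h = 1" | "h = 0" | "0 < h" "h < 1" using m(1) mem_join[OF \<sigma>(1) \<rho>(1)] by auto
  then show "p \<in> level_join (\<sigma> \<inter> \<sigma>') (\<rho> \<inter> \<rho>')"
  proof cases
    case 3
    obtain s t where st: "s \<in> \<sigma>" "t \<in> \<rho>" "x = h *\<^sub>R s + (1 - h) *\<^sub>R t"
      using m(1) 3 mem_join[OF \<sigma>(1) \<rho>(1)] by auto
    obtain s' t' where st': "s' \<in> \<sigma>'" "t' \<in> \<rho>'" "x = h *\<^sub>R s' + (1 - h) *\<^sub>R t'"
      using m(2) 3 mem_join[OF \<sigma>'(1) \<rho>'(1)] by auto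
    have "s = s'" "t = t'"
      using decomposition_unique[OF ij 3, of s t s' t'] st st' \<sigma>(2) \<rho>(2) \<sigma>'(2) \<rho>'(2) by auto
    then show ?thesis using st st' 3 xh mem_join[OF AB, of x h] by auto
  qed (use m xh mem_join[OF AB, of x h] mem_join[OF \<sigma>(1) \<rho>(1), of x h]
      mem_join[OF \<sigma>'(1) \<rho>'(1), of x h] in auto)
next
  fix p assume "p \<in> level_join (\<sigma> \<inter> \<sigma>') (\<rho> \<inter> \<rho>')"
  then show "p \<in> level_join \<sigma> \<rho> \<inter> level_join \<sigma>' \<rho>'"
    using level_join_mono[of "\<sigma> \<inter> \<sigma>'" \<sigma> "\<rho> \<inter> \<rho>'" \<rho>] level_join_mono[of "\<sigma> \<inter> \<sigma>'" \<sigma>' "\<rho> \<inter> \<rho>'" \<rho>'] by auto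
qed

lemma join_above:
  assumes "\<sigma> \<in> A" "\<rho> \<in> B"
  shows "level_join \<sigma> \<rho> \<inter> {p. snd p \<ge> 1} = \<sigma> \<times> {1}"
  using mem_join[OF assms] by auto

lemma empty_A: "{} \<in> A" and empty_B: "{} \<in> B"
proof -
  have "0 \<in> (std_simplex d :: 'a set)" "0 \<in> (std_simplex (d + 1) :: 'a set)"
    using std_simplex_iff(1)[OF d, of "0 :: 'a"] std_simplex_iff(1)[of "d + 1" "0 :: 'a"] by auto
  then have "0 \<in> \<Union>A" "0 \<in> \<Union>B" using A B by (simp_all only: triangulates_def)
  then obtain \<sigma> \<rho> where "\<sigma> \<in> A" "\<rho> \<in> B" by blast
  then show "{} \<in> A" "{} \<in> B" using triangulates_face[OF A] triangulates_face[OF B] empty_face_of by blast+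
qed

lemma level_Int_shift:
  assumes \<omega>: "\<omega> \<in> shift_up K" and i: "i \<le> DIM('a)" and \<sigma>: "\<sigma> \<in> A" "\<sigma> \<subseteq> upper i"
    and \<rho>: "\<rho> \<in> B" "\<rho> \<subseteq> lower i"
  shows "\<omega> \<inter> level_join \<sigma> \<rho> face_of \<omega>" "\<omega> \<inter> level_join \<sigma> \<rho> face_of level_join \<sigma> \<rho>"
proof -
  have eq: "\<omega> \<inter> level_join \<sigma> \<rho> = \<omega> \<inter> \<sigma> \<times> {1}"
    using join_above[OF \<sigma>(1) \<rho>(1)] shift_K_above[OF \<omega>] by auto
  note I = triangulates_Int[OF shift_K \<omega> level_A[OF \<sigma>(1)]]
  show "\<omega> \<inter> level_join \<sigma> \<rho> face_of \<omega>" unfolding eq by (rule I(1))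
  have "\<sigma> face_of \<sigma>" using convex_A[OF \<sigma>(1)] by (rule face_of_refl)
  then have "level_join \<sigma> {} face_of level_join \<sigma> \<rho>"
    using join_face[OF i \<sigma> \<rho>, of \<sigma> "{}"] empty_face_of by blast
  then have "\<sigma> \<times> {1} face_of level_join \<sigma> \<rho>" using convex_A[OF \<sigma>(1)] by simp
  then show "\<omega> \<inter> level_join \<sigma> \<rho> face_of level_join \<sigma> \<rho>"
    unfolding eq using I(2) face_of_trans by blast
qed

lemma finite_joins: "finite joins"
proof -
  have "joins \<subseteq> (\<lambda>(\<sigma>, \<rho>). level_join \<sigma> \<rho>) ` (A \<times> B)" by (auto simp: joins_def)
  then show ?thesis using triangulates_finite[OF A] triangulates_finite[OF B] finite_subset by blast
qed

lemma layered_subset: "\<omega> \<in> layered \<Longrightarrow> \<omega> \<subseteq> std_simplex (d + 1)"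
proof -
  assume "\<omega> \<in> layered"
  then show ?thesis
    unfolding layered_def
  proof
    assume "\<omega> \<in> shift_up K"
    then show ?thesis using shift_K_mem by blast
  next
    assume "\<omega> \<in> joins"
    then obtain \<sigma> \<rho> where \<omega>: "\<sigma> \<in> A" "\<rho> \<in> B" "\<omega> = level_join \<sigma> \<rho>" by (auto simp: joins_def)
    have "(x, 1 :: real) \<in> std_simplex (d + 1)" if "x \<in> std_simplex d" for x :: 'a
      using that std_simplex_coord(1)[OF e d, of x] std_simplex_slice(1)[OF e, of "d + 1" x 1]
      by simp
    then have "\<sigma> \<times> {1::real} \<subseteq> std_simplex (d + 1)" using triangulates_subset[OF A \<omega>(1)] by auto
    moreover have "\<rho> \<times> {0::real} \<subseteq> std_simplex (d + 1)"
      using triangulates_subset[OF B \<omega>(2)] std_simplex_coord(1)[OF e, of "d + 1"]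
        std_simplex_slice(1)[OF e, of "d + 1"] by auto
    ultimately show ?thesis
      unfolding \<omega>(3) level_join_def by (intro hull_minimal) (auto simp: std_simplex_def)
  qed
qed

lemma layered_cover: "std_simplex (d + 1) \<subseteq> \<Union>layered"
proof
  fix p :: "'a \<times> real" assume p: "p \<in> std_simplex (d + 1)"
  obtain x h where xh: "p = (x, h)" by (cases p)
  show "p \<in> \<Union>layered"
  proof (cases "h \<ge> 1")
    case True
    then have "p \<in> \<Union>(shift_up K)" using p xh shift_std_simplex[of x h] shift_K by (simp add: triangulates_def)
    then show ?thesis by (auto simp: layered_def)
  next
    case False
    have h: "0 \<le> h" "h \<le> 1" "\<And>k. k \<le> DIM('a) \<Longrightarrow> 0 \<le> coord e (real (d + 1) - h) x k"
      using p xh False std_simplex_slice(1)[OF e, of "d + 1" x h] by auto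
    obtain i where i: "i \<le> DIM('a)" "(x, h) \<in> level_join (upper i) (lower i)"
      using staircase_cover[OF h] by blast
    consider "h = 0" "x \<in> lower i" | s t where "0 < h" "h < 1" "s \<in> upper i" "t \<in> lower i" "x = h *\<^sub>R s + (1 - h) *\<^sub>R t"
      using i(2) False mem_level_join[OF convex_upper convex_lower] by auto
    then show ?thesis
    proof cases
      case 1
      obtain \<rho> where \<rho>: "\<rho> \<in> B" "x \<in> \<rho>" "\<rho> \<subseteq> lower i" using triangulates_face_cover[OF B lower_face 1(2)] by blast
      then have "level_join {} \<rho> \<in> joins" using empty_A by (intro joinsI[OF i(1)]) auto
      moreover have "p \<in> level_join {} \<rho>" using \<rho> 1 xh convex_B[OF \<rho>(1)] by simp
      ultimately show ?thesis by (auto simp: layered_def)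
    next
      case 2
      obtain \<sigma> where \<sigma>: "\<sigma> \<in> A" "s \<in> \<sigma>" "\<sigma> \<subseteq> upper i" using triangulates_face_cover[OF A upper_face 2(3)] by blast
      obtain \<rho> where \<rho>: "\<rho> \<in> B" "t \<in> \<rho>" "\<rho> \<subseteq> lower i" using triangulates_face_cover[OF B lower_face 2(4)] by blast
      have "level_join \<sigma> \<rho> \<in> joins" using \<sigma> \<rho> by (intro joinsI[OF i(1)])
      moreover have "p \<in> level_join \<sigma> \<rho>" using \<sigma> \<rho> 2 xh mem_join[OF \<sigma>(1) \<rho>(1)] by blast
      ultimately show ?thesis by (auto simp: layered_def)
    qed
  qed
qed

theorem layered_triangulates: "triangulates layered (std_simplex (d + 1))"
  unfolding triangulates_def simplicial_complex_def
proof (intro conjI ballI allI impI)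
  show "finite layered" using triangulates_finite[OF shift_K] finite_joins by (simp add: layered_def)
  show "\<exists>k. k simplex S" if "S \<in> layered" for S
    using that triangulates_simplex[OF shift_K] join_simplex(3) by (auto simp: layered_def elim!: joinsE)
  show "F \<in> layered" if "S \<in> layered \<and> F face_of S" for F S
    using that triangulates_face[OF shift_K] join_faceE by (auto simp: layered_def elim!: joinsE)
  show "S \<inter> S' face_of S" if SS': "S \<in> layered \<and> S' \<in> layered" for S S'
  proof -
    consider "S \<in> shift_up K" "S' \<in> shift_up K" | "S \<in> shift_up K" "S' \<in> joins"
      | "S \<in> joins" "S' \<in> shift_up K" | "S \<in> joins" "S' \<in> joins"
      using SS' by (auto simp: layered_def)
    then show ?thesis
    proof cases
      case 1
      then show ?thesis by (rule triangulates_Int(1)[OF shift_K])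
    next
      case 2
      then show ?thesis using level_Int_shift(1) by (auto elim!: joinsE)
    next
      case 3
      then have "S' \<inter> S face_of S" using level_Int_shift(2) by (auto elim!: joinsE)
      then show ?thesis by (simp add: Int_commute)
    next
      case 4
      obtain i \<sigma> \<rho> where S: "i \<le> DIM('a)" "\<sigma> \<in> A" "\<sigma> \<subseteq> upper i" "\<rho> \<in> B" "\<rho> \<subseteq> lower i" "S = level_join \<sigma> \<rho>"
        using 4(1) by (rule joinsE)
      obtain j \<sigma>' \<rho>' where S': "j \<le> DIM('a)" "\<sigma>' \<in> A" "\<sigma>' \<subseteq> upper j" "\<rho>' \<in> B" "\<rho>' \<subseteq> lower j" "S' = level_join \<sigma>' \<rho>'"
        using 4(2) by (rule joinsE)
      have "S \<inter> S' = level_join (\<sigma> \<inter> \<sigma>') (\<rho> \<inter> \<rho>')"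
        unfolding S(6) S'(6) by (rule join_Int[OF S(1) S'(1) S(2-5) S'(2-5)])
      moreover have "\<sigma> \<inter> \<sigma>' face_of \<sigma>" "\<rho> \<inter> \<rho>' face_of \<rho>"
        using triangulates_Int(1) A B S S' by blast+
      ultimately show ?thesis unfolding S(6) using join_face[OF S(1-5)] by simp
    qed
  qed
  show "\<Union>layered = std_simplex (d + 1)" using layered_subset layered_cover by blast
qed

lemma layered_unimodular: "\<omega> \<in> layered \<Longrightarrow> unimodular \<omega>"
proof -
  have "(0, 1) \<in> (lattice_M :: ('a \<times> real) set)" by (simp add: lattice_M_Pair)
  then show "unimodular \<omega>" if "\<omega> \<in> layered"
    using that uniK unimodular_translation join_simplex(2)
    by (auto simp: layered_def shift_up_eq elim!: joinsE)
qed

lemma layered_bottom: "restriction layered {p. snd p = 0} = embed B"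
proof (intro subset_antisym subsetI)
  fix \<omega> assume \<omega>: "\<omega> \<in> restriction layered {p. snd p = 0}"
  then have z: "snd p = 0" if "p \<in> \<omega>" for p using that by (auto simp: restriction_def)
  have "\<omega> \<in> layered" using \<omega> by (simp add: restriction_def)
  then show "\<omega> \<in> embed B"
    unfolding layered_def
  proof
    assume "\<omega> \<in> shift_up K"
    then have "\<omega> = {}" using z shift_K_above by fastforce
    then show ?thesis using empty_B by (auto simp: embed_eq)
  next
    assume "\<omega> \<in> joins"
    then obtain i \<sigma> \<rho> where S: "\<sigma> \<in> A" "\<rho> \<in> B" "\<omega> = level_join \<sigma> \<rho>" by (rule joinsE)
    have "\<sigma> = {}"
    proof -
      have False if "x \<in> \<sigma>" for x
        using z[of "(x, 1)"] that S mem_join[OF S(1,2), of x 1] by auto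
      then show ?thesis by blast
    qed
    then show ?thesis using S convex_B by (auto simp: embed_eq)
  qed
next
  fix \<omega> assume "\<omega> \<in> embed B"
  then obtain \<rho> where \<rho>: "\<rho> \<in> B" "\<omega> = \<rho> \<times> {0}" by (auto simp: embed_eq)
  obtain i where i: "i \<le> DIM('a)" "\<And>k. k \<le> DIM('a) \<Longrightarrow> r i \<le> r k"
    using ex_has_least_nat[of "\<lambda>k. k \<le> DIM('a)" 0 r] by blast
  have "lower i = std_simplex (d + 1)"
    unfolding std_simplex_dilated lower_def using i by (auto simp: dilated_face_def ranks_from_def)
  then have "level_join {} \<rho> \<in> joins"
    using \<rho>(1) triangulates_subset[OF B] empty_A by (intro joinsI[OF i(1)]) auto
  then show "\<omega> \<in> restriction layered {p. snd p = 0}"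
    using \<rho> convex_B by (auto simp: layered_def restriction_def)
qed

subsection \<open>Characterisation by restrictions\<close>

lemma top_face_rank: "top_face e d (ranks_upto i) = upper i \<times> {1}"
  and bottom_face_rank: "bottom_face e d (ranks_from i) = lower i \<times> {0}"
  unfolding top_face_eq bottom_face_eq upper_eq lower_eq by (rule refl)+

lemma level_Times_subset: "\<sigma> \<times> {h} \<subseteq> \<tau> \<times> {h} \<longleftrightarrow> \<sigma> \<subseteq> \<tau>"
  by auto

lemma join_restrictions:
  "join (restriction (shift_up K) (upper i \<times> {1})) (restriction (embed B) (lower i \<times> {0})) =
   {level_join \<sigma> \<rho> | \<sigma> \<rho>. \<sigma> \<in> A \<and> \<sigma> \<subseteq> upper i \<and> \<rho> \<in> B \<and> \<rho> \<subseteq> lower i}"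
proof -
  have 1: "restriction (shift_up K) (upper i \<times> {1}) = (\<lambda>\<sigma>. \<sigma> \<times> {1}) ` {\<sigma>\<in>A. \<sigma> \<subseteq> upper i}"
  proof (intro subset_antisym subsetI)
    fix \<omega> assume "\<omega> \<in> restriction (shift_up K) (upper i \<times> {1})"
    then have \<omega>: "\<omega> \<in> shift_up K" "\<omega> \<subseteq> upper i \<times> {1}" by (auto simp: restriction_def)
    have "snd p \<le> 1" if "p \<in> \<omega>" for p using \<omega>(2) that by auto
    then obtain \<sigma> where "\<sigma> \<in> A" "\<omega> = \<sigma> \<times> {1}" using shift_K_level[OF \<omega>(1)] by blast
    then show "\<omega> \<in> (\<lambda>\<sigma>. \<sigma> \<times> {1}) ` {\<sigma>\<in>A. \<sigma> \<subseteq> upper i}" using \<omega>(2) level_Times_subset by blast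
  qed (auto simp: restriction_def level_A)
  have 2: "restriction (embed B) (lower i \<times> {0}) = (\<lambda>\<rho>. \<rho> \<times> {0}) ` {\<rho>\<in>B. \<rho> \<subseteq> lower i}"
    unfolding restriction_def embed_eq by (auto simp: level_Times_subset)
  show ?thesis
  proof (intro subset_antisym subsetI)
    fix \<omega> assume "\<omega> \<in> join (restriction (shift_up K) (upper i \<times> {1})) (restriction (embed B) (lower i \<times> {0}))"
    then obtain a b where "a \<in> restriction (shift_up K) (upper i \<times> {1})"
      "b \<in> restriction (embed B) (lower i \<times> {0})" "\<omega> = convex hull (a \<union> b)"
      unfolding join_def by blast
    then show "\<omega> \<in> {level_join \<sigma> \<rho> | \<sigma> \<rho>. \<sigma> \<in> A \<and> \<sigma> \<subseteq> upper i \<and> \<rho> \<in> B \<and> \<rho> \<subseteq> lower i}"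
      unfolding 1 2 level_join_def by blast
  next
    fix \<omega> assume "\<omega> \<in> {level_join \<sigma> \<rho> | \<sigma> \<rho>. \<sigma> \<in> A \<and> \<sigma> \<subseteq> upper i \<and> \<rho> \<in> B \<and> \<rho> \<subseteq> lower i}"
    then obtain \<sigma> \<rho> where S: "\<sigma> \<in> A" "\<sigma> \<subseteq> upper i" "\<rho> \<in> B" "\<rho> \<subseteq> lower i"
      "\<omega> = convex hull (\<sigma> \<times> {1} \<union> \<rho> \<times> {0})" unfolding level_join_def by blast
    then have "\<sigma> \<times> {1} \<in> restriction (shift_up K) (upper i \<times> {1})"
      "\<rho> \<times> {0} \<in> restriction (embed B) (lower i \<times> {0})" unfolding 1 2 by blast+
    then show "\<omega> \<in> join (restriction (shift_up K) (upper i \<times> {1})) (restriction (embed B) (lower i \<times> {0}))"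
      unfolding join_def using S(5) by blast
  qed
qed

lemma layered_is_layered:
  assumes IJ: "\<And>i. i \<le> DIM('a) \<Longrightarrow> I i = ranks_upto i" "\<And>i. i \<le> DIM('a) \<Longrightarrow> J i = ranks_from i"
  shows "is_layered e d I J K B layered"
  unfolding is_layered_def
proof (intro conjI allI impI)
  show "triangulates layered (std_simplex (d + 1))" by (rule layered_triangulates)
  show "restriction layered {x. 1 \<le> snd x} = shift_up K"
  proof (intro subset_antisym subsetI)
    fix \<omega> assume "\<omega> \<in> restriction layered {x. 1 \<le> snd x}"
    then have \<omega>: "\<omega> \<in> layered" "\<omega> \<subseteq> {x. 1 \<le> snd x}" by (auto simp: restriction_def)
    from \<omega>(1) show "\<omega> \<in> shift_up K"
      unfolding layered_def
    proof
      assume "\<omega> \<in> joins"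
      then obtain i \<sigma> \<rho> where S: "\<sigma> \<in> A" "\<rho> \<in> B" "\<omega> = level_join \<sigma> \<rho>" by (rule joinsE)
      then have "\<omega> = \<sigma> \<times> {1}" using join_above[OF S(1,2)] \<omega>(2) by auto
      then show ?thesis using level_A[OF S(1)] by simp
    qed
  next
    fix \<omega> assume "\<omega> \<in> shift_up K"
    then show "\<omega> \<in> restriction layered {x. 1 \<le> snd x}"
      using shift_K_above by (auto simp: restriction_def layered_def)
  qed
  fix i assume i: "i \<le> DIM('a)"
  have cell: "convex hull (top_face e d (I i) \<union> bottom_face e d (J i)) = level_join (upper i) (lower i)"
    unfolding IJ[OF i] top_face_rank bottom_face_rank level_join_def by (rule refl)
  show "restriction layered (convex hull (top_face e d (I i) \<union> bottom_face e d (J i))) =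
      join (restriction (shift_up K) (top_face e d (I i))) (restriction (embed B) (bottom_face e d (J i)))"
    unfolding cell unfolding IJ[OF i] top_face_rank bottom_face_rank join_restrictions
  proof (intro subset_antisym subsetI)
    fix \<omega> assume "\<omega> \<in> restriction layered (level_join (upper i) (lower i))"
    then have \<omega>: "\<omega> \<in> layered" "\<omega> \<subseteq> level_join (upper i) (lower i)" by (auto simp: restriction_def)
    note mem = mem_level_join[OF convex_upper convex_lower]
    from \<omega>(1) show "\<omega> \<in> {level_join \<sigma> \<rho> | \<sigma> \<rho>. \<sigma> \<in> A \<and> \<sigma> \<subseteq> upper i \<and> \<rho> \<in> B \<and> \<rho> \<subseteq> lower i}"
      unfolding layered_def
    proof
      assume s: "\<omega> \<in> shift_up K"
      have "snd p \<le> 1" if "p \<in> \<omega>" for p using \<omega>(2) that mem by (cases p) force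
      then obtain \<sigma> where \<sigma>: "\<sigma> \<in> A" "\<omega> = \<sigma> \<times> {1}" using shift_K_level[OF s] by blast
      then have "\<sigma> \<subseteq> upper i" using \<omega>(2) mem by auto
      moreover have "\<omega> = level_join \<sigma> {}" using \<sigma> convex_A by simp
      ultimately show ?thesis using \<sigma>(1) empty_B by blast
    next
      assume "\<omega> \<in> joins"
      then obtain j \<sigma> \<rho> where S: "\<sigma> \<in> A" "\<rho> \<in> B" "\<omega> = level_join \<sigma> \<rho>" by (rule joinsE)
      have "x \<in> upper i" if "x \<in> \<sigma>" for x
        using \<omega>(2) S(3) mem_join[OF S(1,2), of x 1] mem[of x 1] that by auto
      moreover have "x \<in> lower i" if "x \<in> \<rho>" for x
        using \<omega>(2) S(3) mem_join[OF S(1,2), of x 0] mem[of x 0] that by auto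
      ultimately show ?thesis using S by blast
    qed
  next
    fix \<omega> assume "\<omega> \<in> {level_join \<sigma> \<rho> | \<sigma> \<rho>. \<sigma> \<in> A \<and> \<sigma> \<subseteq> upper i \<and> \<rho> \<in> B \<and> \<rho> \<subseteq> lower i}"
    then obtain \<sigma> \<rho> where S: "\<sigma> \<in> A" "\<sigma> \<subseteq> upper i" "\<rho> \<in> B" "\<rho> \<subseteq> lower i" "\<omega> = level_join \<sigma> \<rho>" by blast
    then show "\<omega> \<in> restriction layered (level_join (upper i) (lower i))"
      using joinsI[OF i S(1-4)] level_join_mono[OF S(2,4)] by (simp add: restriction_def layered_def)
  qed
qed

theorem the_layered:
  assumes IJ: "\<And>i. i \<le> DIM('a) \<Longrightarrow> I i = ranks_upto i" "\<And>i. i \<le> DIM('a) \<Longrightarrow> J i = ranks_from i"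
  shows "(THE T. is_layered e d I J K B T) = layered"
proof (rule the_equality)
  show "is_layered e d I J K B layered" using IJ by (rule layered_is_layered)
  fix T assume T: "is_layered e d I J K B T"
  have "layered \<subseteq> T"
    unfolding layered_def
  proof (intro Un_least subsetI)
    fix \<omega> assume "\<omega> \<in> shift_up K"
    then show "\<omega> \<in> T" using T by (auto simp: is_layered_def restriction_def)
  next
    fix \<omega> assume "\<omega> \<in> joins"
    then obtain i \<sigma> \<rho> where S: "i \<le> DIM('a)" "\<sigma> \<in> A" "\<sigma> \<subseteq> upper i" "\<rho> \<in> B" "\<rho> \<subseteq> lower i" "\<omega> = level_join \<sigma> \<rho>"
      by (rule joinsE)
    have eq: "restriction T (convex hull (top_face e d (I i) \<union> bottom_face e d (J i))) =
        join (restriction (shift_up K) (upper i \<times> {1})) (restriction (embed B) (lower i \<times> {0}))"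
      using T S(1) unfolding is_layered_def IJ[OF S(1), symmetric] top_face_rank[symmetric] bottom_face_rank[symmetric]
      by blast
    have "\<omega> \<in> {level_join \<sigma> \<rho> | \<sigma> \<rho>. \<sigma> \<in> A \<and> \<sigma> \<subseteq> upper i \<and> \<rho> \<in> B \<and> \<rho> \<subseteq> lower i}"
      using S(2-6) by blast
    then have "\<omega> \<in> restriction T (convex hull (top_face e d (I i) \<union> bottom_face e d (J i)))"
      by (simp only: eq join_restrictions)
    then show "\<omega> \<in> T" by (simp add: restriction_def)
  qed
  moreover have "(0 :: 'a \<times> real) \<in> std_simplex (d + 1)"
    using std_simplex_iff(1)[of "d + 1" "0 :: 'a \<times> real"] by simp
  ultimately show "T = layered"
    using T by (intro triangulation_eq_of_cover[OF _ layered_triangulates]) (auto simp: is_layered_def)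
qed

end


section \<open>Parity conditions on layered triangulations\<close>

subsection \<open>Transport of even affine functions\<close>

lemma even_affine_translation:
  assumes "even_affine V v w" "a \<in> lattice_M"
  shows "even_affine ((+) a ` V) (a + v) (a + w)"
proof -
  obtain u k where u: "u \<in> lattice_N" "k \<in> \<int>"
    "\<And>x. x \<in> V \<Longrightarrow> (x \<bullet> u + k - of_bool (x = v) - of_bool (x = w)) / 2 \<in> \<int>"
    using assms(1) unfolding even_affine_def by blast
  have "k - a \<bullet> u \<in> \<int>" using u assms(2) by (simp add: inner_lattice)
  moreover have "(y \<bullet> u + (k - a \<bullet> u) - of_bool (y = a + v) - of_bool (y = a + w)) / 2 \<in> \<int>"
    if y: "y \<in> (+) a ` V" for y
  proof -
    obtain x where x: "x \<in> V" "y = a + x" using y by blast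
    have "y \<bullet> u + (k - a \<bullet> u) - of_bool (y = a + v) - of_bool (y = a + w)
        = x \<bullet> u + k - of_bool (x = v) - of_bool (x = w)"
      using x(2) by (simp add: inner_add_left)
    then show ?thesis using u(3)[OF x(1)] by (simp only:)
  qed
  ultimately show ?thesis unfolding even_affine_def using u(1) by blast
qed

lemma even_affine_cone:
  assumes "even_affine V v w" "b \<in> lattice_M" "(h = 1 \<and> h' = 0) \<or> (h = 0 \<and> h' = 1)"
  shows "even_affine (insert (b, h') (V \<times> {h})) (v, h) (w, h :: real)"
proof -
  obtain u k where u: "u \<in> lattice_N" "k \<in> \<int>"
    "\<And>x. x \<in> V \<Longrightarrow> (x \<bullet> u + k - of_bool (x = v) - of_bool (x = w)) / 2 \<in> \<int>"
    using assms(1) unfolding even_affine_def by blast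
  \<comment> \<open>The form vanishes at the apex and agrees with the given one on the base.\<close>
  define k' where "k' = (if h = 1 then - (b \<bullet> u) else k)"
  define \<gamma> where "\<gamma> = (if h = 1 then k + b \<bullet> u else - (b \<bullet> u) - k)"
  have bu: "b \<bullet> u \<in> \<int>" using u(1) assms(2) by (simp add: inner_lattice)
  then have "k' \<in> \<int>" "\<gamma> \<in> \<int>" using u(2) by (auto simp: k'_def \<gamma>_def)
  then have "(u, \<gamma>) \<in> lattice_N" using u(1) by (simp add: lattice_N_Pair)
  moreover have "(y \<bullet> (u, \<gamma>) + k' - of_bool (y = (v, h)) - of_bool (y = (w, h))) / 2 \<in> \<int>"
    if "y \<in> insert (b, h') (V \<times> {h})" for y
    using that u(3)[of "fst y"] assms(3) by (cases y) (auto simp: k'_def \<gamma>_def)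
  ultimately show ?thesis unfolding even_affine_def using \<open>k' \<in> \<int>\<close> by blast
qed

lemma even_affine_level:
  assumes "even_affine W (v, h) (w, h :: real)" "V \<times> {h} \<subseteq> W" "h \<in> \<int>"
  shows "even_affine V v w"
proof -
  obtain u \<gamma> k where u: "(u, \<gamma>) \<in> lattice_N" "k \<in> \<int>"
    "\<And>y. y \<in> W \<Longrightarrow> (y \<bullet> (u, \<gamma>) + k - of_bool (y = (v, h)) - of_bool (y = (w, h))) / 2 \<in> \<int>"
    using assms(1) unfolding even_affine_def by (metis surj_pair)
  have uN: "u \<in> lattice_N" "h * \<gamma> + k \<in> \<int>" using u(1,2) assms(3) by (auto simp: lattice_N_Pair)
  moreover have "(x \<bullet> u + (h * \<gamma> + k) - of_bool (x = v) - of_bool (x = w)) / 2 \<in> \<int>" if "x \<in> V" for x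
    using u(3)[of "(x, h)"] assms(2) that by (auto simp: add.assoc)
  ultimately show ?thesis unfolding even_affine_def by blast
qed

text \<open>Here \<open>a\<close> and \<open>b\<close> are the apices over a facet in \<open>V\<close>.  An integral affine function that is zero at \<open>a\<close>
  is even at \<open>b = 2 q - a\<close>.\<close>

lemma even_affine_opposite_apices:
  assumes V: "extends_int (insert a V)" and ab: "a + b = 2 *\<^sub>R q" "q \<in> lattice_M"
    and ne: "v \<notin> {a, b}" "w \<notin> {a, b}"
  shows "even_affine (insert a (insert b V)) v w"
proof -
  obtain u k where u: "u \<in> lattice_N" "k \<in> \<int>"
    "\<And>x. x \<in> insert a V \<Longrightarrow> x \<bullet> u + k = of_bool (x = v) + of_bool (x = w)"
    by (rule extends_intE[OF V, of "\<lambda>x. of_bool (x = v) + of_bool (x = w)"]) auto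
  have "a \<bullet> u + k = 0" using u(3)[of a] ne by auto
  moreover have "a \<bullet> u + b \<bullet> u = 2 * (q \<bullet> u)" using ab(1) by (metis inner_add_left inner_scaleR_left)
  ultimately have "(b \<bullet> u + k) / 2 = q \<bullet> u + k" by simp
  moreover have "q \<bullet> u + k \<in> \<int>" using u(1,2) ab(2) by (simp add: inner_lattice)
  ultimately have "(b \<bullet> u + k) / 2 \<in> \<int>" by (simp only:)
  then have "(x \<bullet> u + k - of_bool (x = v) - of_bool (x = w)) / 2 \<in> \<int>" if "x \<in> insert a (insert b V)" for x
    using that u(3)[of x] ne by auto
  then show ?thesis unfolding even_affine_def using u(1,2) by blast
qed

lemma parity_uniform_mono: "parity_uniform G K \<Longrightarrow> G' \<subseteq> G \<Longrightarrow> parity_uniform G' K"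
  unfolding parity_uniform_def by blast

subsection \<open>Facets of the layered triangulation\<close>

text \<open>A point of the dilated simplex belongs to this set if it lies on no facet, except possibly the bottom
  one.  Unlike interior points, such points are still available on the interface to the next slab.\<close>

definition off_sides :: "(nat \<Rightarrow> 'a::euclidean_space) \<Rightarrow> nat \<Rightarrow> ('a \<times> real) set" where
  "off_sides e d = {p. \<forall>k\<le>DIM('a). 0 < coord e (real d - snd p) (fst p) k}"

text \<open>All facets of \<open>K\<close> that rest on the bottom have the same opposite vertex \<open>a\<close>.\<close>

definition bottom_apex :: "('a::euclidean_space \<times> real) set set \<Rightarrow> 'a \<times> real \<Rightarrow> bool" where
  "bottom_apex K a \<longleftrightarrow> snd a = 1 \<and> (\<forall>\<tau>\<in>K. card (vertices \<tau>) = DIM('a) + 2 \<longrightarrow>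
     DIM('a) + 1 \<le> card {p\<in>vertices \<tau>. snd p = 0} \<longrightarrow>
     vertices \<tau> = insert a {p\<in>vertices \<tau>. snd p = 0})"

context staircase
begin

lemma card_ranks:
  assumes "i \<le> DIM('a)"
  shows "card (ranks_upto i) + card (ranks_from i) = DIM('a) + 2"
proof -
  have "ranks_upto i \<union> ranks_from i = {..DIM('a)}" "ranks_upto i \<inter> ranks_from i = {i}"
    using assms rank_eq by (auto simp: ranks_upto_def ranks_from_def)
  moreover have "finite (ranks_upto i)" "finite (ranks_from i)" by (auto simp: ranks_upto_def ranks_from_def)
  ultimately show ?thesis using card_Un_Int[of "ranks_upto i" "ranks_from i"] by simp
qed

lemma ranks_upto_all:
  assumes i: "i \<le> DIM('a)" and all: "ranks_upto i = {..DIM('a)}"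
  shows "lower i = {real (d + 1) *\<^sub>R e i}" "upper i = std_simplex d"
proof -
  have "card (ranks_from i) = 1" using card_ranks[OF i] all by simp
  moreover have "i \<in> ranks_from i" using i by (simp add: ranks_from_def)
  ultimately have "ranks_from i = {i}" by (auto simp: card_1_singleton_iff)
  then show "lower i = {real (d + 1) *\<^sub>R e i}" using lower_eq[of i] by simp
  show "upper i = std_simplex d"
    unfolding upper_def std_simplex_dilated all by (auto simp: dilated_face_def)
qed

lemma ranks_from_all:
  assumes i: "i \<le> DIM('a)" and all: "ranks_from i = {..DIM('a)}"
  shows "upper i = {real d *\<^sub>R e i}" "lower i = std_simplex (d + 1)"
proof -
  have "card (ranks_upto i) = 1" using card_ranks[OF i] all by simp
  moreover have "i \<in> ranks_upto i" using i by (simp add: ranks_upto_def)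
  ultimately have "ranks_upto i = {i}" by (auto simp: card_1_singleton_iff)
  then show "upper i = {real d *\<^sub>R e i}" using upper_eq[of i] by simp
  show "lower i = std_simplex (d + 1)"
    unfolding lower_def std_simplex_dilated all by (auto simp: dilated_face_def)
qed

lemma ranks_upto_all_unique:
  assumes "i \<le> DIM('a)" "j \<le> DIM('a)" "ranks_upto i = {..DIM('a)}" "ranks_upto j = {..DIM('a)}"
  shows "i = j"
proof -
  have "j \<in> ranks_upto i" "i \<in> ranks_upto j" using assms by auto
  then show ?thesis using rank_eq assms by (auto simp: ranks_upto_def)
qed

lemma ranks_from_all_unique:
  assumes "i \<le> DIM('a)" "j \<le> DIM('a)" "ranks_from i = {..DIM('a)}" "ranks_from j = {..DIM('a)}"
  shows "i = j"
proof -
  have "j \<in> ranks_from i" "i \<in> ranks_from j" using assms by auto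
  then show ?thesis using rank_eq assms by (auto simp: ranks_from_def)
qed

lemma subset_atMost_all: "S \<subseteq> {..DIM('a)} \<Longrightarrow> card S \<ge> DIM('a) + 1 \<Longrightarrow> S = {..DIM('a)}"
  by (intro card_seteq) auto

lemma ranks_subset: "ranks_upto i \<subseteq> {..DIM('a)}" "ranks_from i \<subseteq> {..DIM('a)}"
  by (auto simp: ranks_upto_def ranks_from_def)

lemma positive_upper: "x \<in> upper i \<Longrightarrow> \<forall>k\<le>DIM('a). 0 < coord e (real d) x k \<Longrightarrow> ranks_upto i = {..DIM('a)}"
  by (force simp: upper_def dilated_face_def ranks_upto_def)

lemma positive_lower: "x \<in> lower i \<Longrightarrow> \<forall>k\<le>DIM('a). 0 < coord e (real (d + 1)) x k \<Longrightarrow> ranks_from i = {..DIM('a)}"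
  by (force simp: lower_def dilated_face_def ranks_from_def)

lemma dilated_vertex_not_positive:
  assumes "i \<le> DIM('a)" "\<forall>k\<le>DIM('a). 0 < coord e D (D *\<^sub>R e i) k"
  shows False
proof -
  define k where "k = (if i = 0 then 1 else 0 :: nat)"
  have "k \<le> DIM('a)" "k \<noteq> i" using DIM_positive[where 'a = 'a] by (auto simp: k_def Suc_le_eq)
  then show False using assms dilated_vertex[OF e assms(1), of k D] by auto
qed

lemma dilated_vertex_lattice: "i \<le> DIM('a) \<Longrightarrow> real m *\<^sub>R e i \<in> lattice_M"
  using e basis_enum_Basis[OF e, of i] lattice_M_Basis
  by (cases "i = 0") (auto simp: basis_enum_def intro!: lattice_M_scale)

end

lemma singleton_vertices:
  assumes "vertices \<sigma> \<subseteq> {x}" "card (vertices \<sigma>) = 1"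
  shows "vertices \<sigma> = {x}"
  using assms by (metis card_1_singletonE singleton_insert_inj_eq subset_singletonD insert_not_empty)

lemma card_affine_independent_le:
  fixes \<sigma> :: "'a::euclidean_space set"
  assumes "k simplex \<sigma>" "\<sigma> \<subseteq> convex hull V" "finite V"
  shows "card (vertices \<sigma>) \<le> card V"
proof -
  have "aff_dim \<sigma> \<le> aff_dim V" using aff_dim_subset[OF assms(2)] by (simp add: aff_dim_convex_hull)
  also have "\<dots> \<le> int (card V) - 1" using assms(3) by (rule aff_dim_le_card)
  finally show ?thesis using simplex_card[OF assms(1)] by simp
qed

context layers
begin

lemma card_upper:
  assumes "\<sigma> \<in> A" "\<sigma> \<subseteq> upper i"
  shows "card (vertices \<sigma>) \<le> card (ranks_upto i)"
proof -
  obtain k where k: "k simplex \<sigma>" using triangulates_simplex[OF A assms(1)] by blast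
  have fin: "finite (ranks_upto i)" by (rule finite_subset[OF ranks_subset(1)]) simp
  have "card (vertices \<sigma>) \<le> card ((\<lambda>j. real d *\<^sub>R e j) ` ranks_upto i)"
    using assms(2) fin by (intro card_affine_independent_le[OF k]) (auto simp: upper_eq)
  also have "\<dots> \<le> card (ranks_upto i)" using fin by (rule card_image_le)
  finally show ?thesis .
qed

lemma card_lower:
  assumes "\<rho> \<in> B" "\<rho> \<subseteq> lower i"
  shows "card (vertices \<rho>) \<le> card (ranks_from i)"
proof -
  obtain k where k: "k simplex \<rho>" using triangulates_simplex[OF B assms(1)] by blast
  have fin: "finite (ranks_from i)" by (rule finite_subset[OF ranks_subset(2)]) simp
  have "card (vertices \<rho>) \<le> card ((\<lambda>j. real (d + 1) *\<^sub>R e j) ` ranks_from i)"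
    using assms(2) fin lower_eq[of i] by (intro card_affine_independent_le[OF k]) auto
  also have "\<dots> \<le> card (ranks_from i)" using fin by (rule card_image_le)
  finally show ?thesis .
qed

lemma finite_vertices_A: "\<sigma> \<in> A \<Longrightarrow> finite (vertices \<sigma>)"
  and finite_vertices_B: "\<rho> \<in> B \<Longrightarrow> finite (vertices \<rho>)"
  using triangulates_simplex[OF A] triangulates_simplex[OF B] simplex_vertices(2) by blast+

lemma join_facetE:
  assumes "\<omega> \<in> joins" "card (vertices \<omega>) = DIM('a) + 2"
  obtains \<sigma> \<rho> i where "i \<le> DIM('a)" "\<sigma> \<in> A" "\<sigma> \<subseteq> upper i" "\<rho> \<in> B" "\<rho> \<subseteq> lower i"
    "vertices \<omega> = vertices \<sigma> \<times> {1} \<union> vertices \<rho> \<times> {0}"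
    "card (vertices \<sigma>) = card (ranks_upto i)" "card (vertices \<rho>) = card (ranks_from i)"
proof -
  obtain \<sigma> \<rho> i where S: "i \<le> DIM('a)" "\<sigma> \<in> A" "\<sigma> \<subseteq> upper i" "\<rho> \<in> B" "\<rho> \<subseteq> lower i" "\<omega> = level_join \<sigma> \<rho>"
    using assms(1) by (rule joinsE)
  have V: "vertices \<omega> = vertices \<sigma> \<times> {1} \<union> vertices \<rho> \<times> {0}"
    unfolding S(6) by (rule join_simplex(1)[OF S(1-5)])
  have "card (vertices \<omega>) = card (vertices \<sigma> \<times> {1::real}) + card (vertices \<rho> \<times> {0::real})"
    unfolding V using finite_vertices_A[OF S(2)] finite_vertices_B[OF S(4)]
    by (intro card_Un_disjoint) auto
  then have "card (vertices \<sigma>) + card (vertices \<rho>) = DIM('a) + 2"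
    using assms(2) by (simp add: card_cartesian_product)
  then have "card (vertices \<sigma>) = card (ranks_upto i)" "card (vertices \<rho>) = card (ranks_from i)"
    using card_upper[OF S(2,3)] card_lower[OF S(4,5)] card_ranks[OF S(1)] by linarith+
  then show ?thesis by (rule that[OF S(1-5) V])
qed

lemma facet_over_whole_upper:
  assumes "i \<le> DIM('a)" "ranks_upto i = {..DIM('a)}" "\<rho> \<subseteq> lower i" "card (vertices \<rho>) = card (ranks_from i)"
  shows "vertices \<rho> = {real (d + 1) *\<^sub>R e i}"
proof (rule singleton_vertices)
  show "vertices \<rho> \<subseteq> {real (d + 1) *\<^sub>R e i}"
    using vertices_subset[of \<rho>] assms(3) ranks_upto_all(1)[OF assms(1,2)] by blast
  show "card (vertices \<rho>) = 1" using assms(4) card_ranks[OF assms(1)] assms(2) by simp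
qed

lemma facet_over_whole_lower:
  assumes "i \<le> DIM('a)" "ranks_from i = {..DIM('a)}" "\<sigma> \<subseteq> upper i" "card (vertices \<sigma>) = card (ranks_upto i)"
  shows "vertices \<sigma> = {real d *\<^sub>R e i}"
proof (rule singleton_vertices)
  show "vertices \<sigma> \<subseteq> {real d *\<^sub>R e i}"
    using vertices_subset[of \<sigma>] assms(3) ranks_from_all(1)[OF assms(1,2)] by blast
  show "card (vertices \<sigma>) = 1" using assms(4) card_ranks[OF assms(1)] assms(2) by simp
qed

text \<open>A facet whose bottom has dimension \<open>n\<close> lies in the cell over the whole lower simplex, and the upper part of
  this cell is a single point.\<close>

lemma layered_bottom_apex:
  assumes lo: "lo \<le> DIM('a)" "ranks_from lo = {..DIM('a)}"
  shows "bottom_apex layered (real d *\<^sub>R e lo, 1)"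
  unfolding bottom_apex_def
proof (intro conjI ballI impI)
  fix \<tau> assume \<tau>: "\<tau> \<in> layered" "card (vertices \<tau>) = DIM('a) + 2"
    and card: "DIM('a) + 1 \<le> card {p\<in>vertices \<tau>. snd p = 0}"
  have "\<tau> \<in> joins"
  proof (rule ccontr)
    assume "\<tau> \<notin> joins"
    then have "\<tau> \<in> shift_up K" using \<tau>(1) by (simp add: layered_def)
    then have "snd p \<ge> 1" if "p \<in> vertices \<tau>" for p
      using that vertices_subset[of \<tau>] shift_K_above by blast
    then have "{p\<in>vertices \<tau>. snd p = 0} = {}" by force
    then show False using card by (simp only: card.empty)
  qed
  then obtain \<sigma> \<rho> i where S: "i \<le> DIM('a)" "\<sigma> \<in> A" "\<sigma> \<subseteq> upper i" "\<rho> \<in> B" "\<rho> \<subseteq> lower i"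
    "vertices \<tau> = vertices \<sigma> \<times> {1} \<union> vertices \<rho> \<times> {0}"
    "card (vertices \<sigma>) = card (ranks_upto i)" "card (vertices \<rho>) = card (ranks_from i)"
    using \<tau>(2) by (rule join_facetE)
  have low: "{p\<in>vertices \<tau>. snd p = 0} = vertices \<rho> \<times> {0}" unfolding S(6) by auto
  then have "card (ranks_from i) \<ge> DIM('a) + 1" using card S(8) by (simp add: card_cartesian_product)
  then have all: "ranks_from i = {..DIM('a)}" using subset_atMost_all ranks_subset by blast
  then have "i = lo" using ranks_from_all_unique S(1) lo by blast
  then have "vertices \<sigma> = {real d *\<^sub>R e lo}"
    using facet_over_whole_lower[OF S(1) all S(3,7)] by simp
  then show "vertices \<tau> = insert (real d *\<^sub>R e lo, 1) {p\<in>vertices \<tau>. snd p = 0}"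
    unfolding low unfolding S(6) by auto
qed auto

text \<open>A facet on the interface between \<open>K\<close> and the slab has its two apices at mirrored lattice points.\<close>

lemma even_affine_interface:
  assumes hi: "hi \<le> DIM('a)" "ranks_upto hi = {..DIM('a)}"
    and a: "bottom_apex K a" and q: "a + (0, 1) + (real (d + 1) *\<^sub>R e hi, 0) = 2 *\<^sub>R q" "q \<in> lattice_M"
    and \<tau>1: "\<tau>1 \<in> shift_up K" "card (vertices \<tau>1) = DIM('a) + 2"
    and \<tau>2: "\<tau>2 \<in> joins" "card (vertices \<tau>2) = DIM('a) + 2"
    and card: "card (vertices \<tau>1 \<inter> vertices \<tau>2) = DIM('a) + 1"
    and vw: "{v, w} \<subseteq> vertices \<tau>1 \<inter> vertices \<tau>2"
  shows "even_affine (vertices \<tau>1 \<union> vertices \<tau>2) v w"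
proof -
  obtain \<sigma> \<rho> i where S: "i \<le> DIM('a)" "\<sigma> \<in> A" "\<sigma> \<subseteq> upper i" "\<rho> \<in> B" "\<rho> \<subseteq> lower i"
    "vertices \<tau>2 = vertices \<sigma> \<times> {1} \<union> vertices \<rho> \<times> {0}"
    "card (vertices \<sigma>) = card (ranks_upto i)" "card (vertices \<rho>) = card (ranks_from i)"
    using \<tau>2 by (rule join_facetE)
  have above: "snd p \<ge> 1" if "p \<in> vertices \<tau>1" for p
    using that vertices_subset[of \<tau>1] shift_K_above[OF \<tau>1(1)] by blast
  then have sub: "vertices \<tau>1 \<inter> vertices \<tau>2 \<subseteq> vertices \<sigma> \<times> {1}" unfolding S(6) by force
  have fin: "finite (vertices \<sigma> \<times> {1::real})" using finite_vertices_A[OF S(2)] by simp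
  have "DIM('a) + 1 \<le> card (vertices \<sigma> \<times> {1::real})" using card_mono[OF fin sub] card by simp
  then have \<sigma>_ge: "DIM('a) + 1 \<le> card (vertices \<sigma>)" by (simp add: card_cartesian_product)
  then have all: "ranks_upto i = {..DIM('a)}"
    using S(7) subset_atMost_all ranks_subset by simp
  then have i: "i = hi" using ranks_upto_all_unique S(1) hi by blast
  have \<rho>: "vertices \<rho> = {real (d + 1) *\<^sub>R e hi}" using facet_over_whole_upper[OF S(1) all S(5,8)] i by simp
  have \<sigma>_card: "card (vertices \<sigma>) = DIM('a) + 1" using S(7) all by simp
  then have int: "vertices \<tau>1 \<inter> vertices \<tau>2 = vertices \<sigma> \<times> {1}"
    using card by (intro card_subset_eq[OF fin sub]) (simp add: card_cartesian_product)
  obtain \<kappa> where \<kappa>: "\<kappa> \<in> K" "\<tau>1 = (+) (0, 1) ` \<kappa>" using \<tau>1(1) by (auto simp: shift_up_eq)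
  have V1: "vertices \<tau>1 = (+) (0, 1) ` vertices \<kappa>" unfolding \<kappa>(2) by (rule vertices_translation)
  have card_\<kappa>: "card (vertices \<kappa>) = DIM('a) + 2" using \<tau>1(2) unfolding V1 by (simp add: card_image)
  have fin_\<kappa>: "finite (vertices \<kappa>)" using card_\<kappa> by (intro card_ge_0_finite) simp
  have base: "vertices \<sigma> \<times> {0} \<subseteq> {p\<in>vertices \<kappa>. snd p = 0}"
  proof
    fix p assume p: "p \<in> vertices \<sigma> \<times> {0::real}"
    then have "(fst p, 1) \<in> vertices \<tau>1" using int by auto
    then obtain p' where p': "p' \<in> vertices \<kappa>" "(fst p, 1) = (0, 1) + p'" unfolding V1 by blast
    then have "p' = p" using p by (cases p'; cases p) auto
    then show "p \<in> {p\<in>vertices \<kappa>. snd p = 0}" using p p' by auto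
  qed
  have fin0: "finite {p\<in>vertices \<kappa>. snd p = 0}" using fin_\<kappa> by simp
  have "DIM('a) + 1 \<le> card {p\<in>vertices \<kappa>. snd p = 0}"
    using card_mono[OF fin0 base] \<sigma>_card by (simp add: card_cartesian_product)
  then have ins: "vertices \<kappa> = insert a {p\<in>vertices \<kappa>. snd p = 0}" and a1: "snd a = 1"
    using a \<kappa>(1) card_\<kappa> by (auto simp: bottom_apex_def)
  have "card (vertices \<kappa>) = Suc (card {p\<in>vertices \<kappa>. snd p = 0})"
    by (subst ins) (use fin0 a1 in simp)
  then have "{p\<in>vertices \<kappa>. snd p = 0} = vertices \<sigma> \<times> {0}"
    using card_\<kappa> \<sigma>_card by (intro card_subset_eq[symmetric, OF fin0 base]) (simp add: card_cartesian_product)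
  then have V\<kappa>: "vertices \<kappa> = insert a (vertices \<sigma> \<times> {0})" using ins by simp
  have V1': "vertices \<tau>1 = insert (a + (0, 1)) (vertices \<sigma> \<times> {1})"
    unfolding V1 V\<kappa> image_insert shift_level by (simp add: add.commute)
  have V2': "vertices \<tau>2 = insert (real (d + 1) *\<^sub>R e hi, 0) (vertices \<sigma> \<times> {1})"
    unfolding S(6) \<rho> by auto
  have "unimodular \<tau>1" using layered_unimodular \<tau>1(1) by (simp add: layered_def)
  then have "extends_int (insert (a + (0, 1)) (vertices \<sigma> \<times> {1}))" by (simp add: unimodular_def V1')
  moreover have "v \<notin> {a + (0, 1), (real (d + 1) *\<^sub>R e hi, 0)}" "w \<notin> {a + (0, 1), (real (d + 1) *\<^sub>R e hi, 0)}"
  proof -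
    have "snd v = 1" "snd w = 1" using vw unfolding int by auto
    then show "v \<notin> {a + (0, 1), (real (d + 1) *\<^sub>R e hi, 0)}" "w \<notin> {a + (0, 1), (real (d + 1) *\<^sub>R e hi, 0)}"
      using a1 by auto
  qed
  ultimately have "even_affine (insert (a + (0, 1)) (insert (real (d + 1) *\<^sub>R e hi, 0) (vertices \<sigma> \<times> {1}))) v w"
    using q by (intro even_affine_opposite_apices)
  moreover have "insert (a + (0, 1)) (insert (real (d + 1) *\<^sub>R e hi, 0) (vertices \<sigma> \<times> {1})) = vertices \<tau>1 \<union> vertices \<tau>2"
    unfolding V1' V2' by blast
  ultimately show ?thesis by simp
qed

text \<open>The only cell whose upper part has a point with positive coordinates is the one over the whole upper
  simplex, and its lower part is a single point.  So near a vertex at level \<open>1\<close> off the sides, the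
  triangulation of the slab is a cone over \<open>A\<close>; likewise it is a cone over \<open>B\<close> near such a vertex at level \<open>0\<close>.\<close>

lemma even_affine_slab:
  assumes parA: "parity_uniform (interior (std_simplex d)) A"
    and parB: "parity_uniform (interior (std_simplex (d + 1))) B"
    and \<tau>1: "\<tau>1 \<in> joins" "card (vertices \<tau>1) = DIM('a) + 2"
    and \<tau>2: "\<tau>2 \<in> joins" "card (vertices \<tau>2) = DIM('a) + 2"
    and card: "card (vertices \<tau>1 \<inter> vertices \<tau>2) = DIM('a) + 1"
    and vw: "{v, w} \<subseteq> vertices \<tau>1 \<inter> vertices \<tau>2 \<inter> off_sides e (d + 1)"
  shows "even_affine (vertices \<tau>1 \<union> vertices \<tau>2) v w"
proof -
  obtain \<sigma>1 \<rho>1 i where S: "i \<le> DIM('a)" "\<sigma>1 \<in> A" "\<sigma>1 \<subseteq> upper i" "\<rho>1 \<in> B" "\<rho>1 \<subseteq> lower i"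
    "vertices \<tau>1 = vertices \<sigma>1 \<times> {1} \<union> vertices \<rho>1 \<times> {0}"
    "card (vertices \<sigma>1) = card (ranks_upto i)" "card (vertices \<rho>1) = card (ranks_from i)"
    using \<tau>1 by (rule join_facetE)
  obtain \<sigma>2 \<rho>2 j where S': "j \<le> DIM('a)" "\<sigma>2 \<in> A" "\<sigma>2 \<subseteq> upper j" "\<rho>2 \<in> B" "\<rho>2 \<subseteq> lower j"
    "vertices \<tau>2 = vertices \<sigma>2 \<times> {1} \<union> vertices \<rho>2 \<times> {0}"
    "card (vertices \<sigma>2) = card (ranks_upto j)" "card (vertices \<rho>2) = card (ranks_from j)"
    using \<tau>2 by (rule join_facetE)
  have off: "\<forall>k\<le>DIM('a). 0 < coord e (real (d + 1) - h) x k" if "(x, h) \<in> {v, w}" for x h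
    using that vw by (auto simp: off_sides_def)
  have off1: "\<forall>k\<le>DIM('a). 0 < coord e (real d) x k" if "(x, 1) \<in> {v, w}" for x
    using off[OF that] by simp
  have off0: "\<forall>k\<le>DIM('a). 0 < coord e (real (d + 1)) x k" if "(x, 0) \<in> {v, w}" for x
    using off[OF that] by simp
  obtain v' h where v: "v = (v', h)" by (cases v)
  obtain w' h' where w: "w = (w', h')" by (cases w)
  have vV: "(v', h) \<in> vertices \<tau>1" "(v', h) \<in> vertices \<tau>2" "(w', h') \<in> vertices \<tau>1" "(w', h') \<in> vertices \<tau>2"
    using vw v w by auto
  have "h = 1 \<or> h = 0" using vV(1) S(6) by auto
  then show ?thesis
  proof
    assume h: "h = 1"
    have v': "v' \<in> vertices \<sigma>1" "v' \<in> vertices \<sigma>2" using vV h S(6) S'(6) by auto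
    have all: "ranks_upto i = {..DIM('a)}" "ranks_upto j = {..DIM('a)}"
      using positive_upper off1[of v'] v h v' vertices_subset[of \<sigma>1] vertices_subset[of \<sigma>2] S(3) S'(3) by blast+
    then have ij: "j = i" using ranks_upto_all_unique S(1) S'(1) by blast
    let ?b = "real (d + 1) *\<^sub>R e i"
    have \<rho>: "vertices \<rho>1 = {?b}" "vertices \<rho>2 = {?b}"
      using facet_over_whole_upper[OF S(1) all(1) S(5,8)] facet_over_whole_upper[OF S'(1) all(2) S'(5,8)] ij
      by auto
    have "h' = 1"
    proof (rule ccontr)
      assume "h' \<noteq> 1"
      then have "(w', 0) \<in> {v, w}" "w' = ?b" using vV(3) S(6) \<rho>(1) w by auto
      then show False using off0 dilated_vertex_not_positive[OF S(1)] by blast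
    qed
    then have w': "w' \<in> vertices \<sigma>1" "w' \<in> vertices \<sigma>2" using vV S(6) S'(6) by auto
    have "vertices \<tau>1 \<inter> vertices \<tau>2 = insert (?b, 0) ((vertices \<sigma>1 \<inter> vertices \<sigma>2) \<times> {1})"
      unfolding S(6) S'(6) \<rho> by auto
    moreover have "card (insert (?b, 0::real) ((vertices \<sigma>1 \<inter> vertices \<sigma>2) \<times> {1})) = Suc (card (vertices \<sigma>1 \<inter> vertices \<sigma>2))"
      using finite_vertices_A[OF S(2)] by (subst card_insert_disjoint) (auto simp: card_cartesian_product)
    ultimately have "card (vertices \<sigma>1 \<inter> vertices \<sigma>2) = DIM('a)" using card by simp
    moreover have "card (vertices \<sigma>1) = DIM('a) + 1" "card (vertices \<sigma>2) = DIM('a) + 1"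
      using S(7) S'(7) all by auto
    moreover have "v' \<in> interior (std_simplex d)" "w' \<in> interior (std_simplex d)"
      using off1 v w h \<open>h' = 1\<close> by (auto simp: std_simplex_coord(2)[OF e d])
    ultimately have "even_affine (vertices \<sigma>1 \<union> vertices \<sigma>2) v' w'"
      using parA S(2) S'(2) v' w' unfolding parity_uniform_def by blast
    then have "even_affine (insert (?b, 0 :: real) ((vertices \<sigma>1 \<union> vertices \<sigma>2) \<times> {1})) (v', 1) (w', 1)"
      by (rule even_affine_cone[OF _ dilated_vertex_lattice[OF S(1)]]) simp
    moreover have "insert (?b, 0) ((vertices \<sigma>1 \<union> vertices \<sigma>2) \<times> {1}) = vertices \<tau>1 \<union> vertices \<tau>2"
      unfolding S(6) S'(6) \<rho> by auto
    ultimately show ?thesis using v w h \<open>h' = 1\<close> by simp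
  next
    assume h: "h = 0"
    have v': "v' \<in> vertices \<rho>1" "v' \<in> vertices \<rho>2" using vV h S(6) S'(6) by auto
    have all: "ranks_from i = {..DIM('a)}" "ranks_from j = {..DIM('a)}"
      using positive_lower off0[of v'] v h v' vertices_subset[of \<rho>1] vertices_subset[of \<rho>2] S(5) S'(5) by blast+
    then have ij: "j = i" using ranks_from_all_unique S(1) S'(1) by blast
    let ?a = "real d *\<^sub>R e i"
    have \<sigma>: "vertices \<sigma>1 = {?a}" "vertices \<sigma>2 = {?a}"
      using facet_over_whole_lower[OF S(1) all(1) S(3,7)] facet_over_whole_lower[OF S'(1) all(2) S'(3,7)] ij
      by auto
    have "h' = 0"
    proof (rule ccontr)
      assume "h' \<noteq> 0"
      then have "(w', 1) \<in> {v, w}" "w' = ?a" using vV(3) S(6) \<sigma>(1) w by auto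
      then show False using off1 dilated_vertex_not_positive[OF S(1)] by blast
    qed
    then have w': "w' \<in> vertices \<rho>1" "w' \<in> vertices \<rho>2" using vV S(6) S'(6) by auto
    have "vertices \<tau>1 \<inter> vertices \<tau>2 = insert (?a, 1) ((vertices \<rho>1 \<inter> vertices \<rho>2) \<times> {0})"
      unfolding S(6) S'(6) \<sigma> by auto
    moreover have "card (insert (?a, 1::real) ((vertices \<rho>1 \<inter> vertices \<rho>2) \<times> {0})) = Suc (card (vertices \<rho>1 \<inter> vertices \<rho>2))"
      using finite_vertices_B[OF S(4)] by (subst card_insert_disjoint) (auto simp: card_cartesian_product)
    ultimately have "card (vertices \<rho>1 \<inter> vertices \<rho>2) = DIM('a)" using card by simp
    moreover have "card (vertices \<rho>1) = DIM('a) + 1" "card (vertices \<rho>2) = DIM('a) + 1"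
      using S(8) S'(8) all by auto
    moreover have "v' \<in> interior (std_simplex (d + 1))" "w' \<in> interior (std_simplex (d + 1))"
      using off0 v w h \<open>h' = 0\<close> std_simplex_coord(2)[OF e, of "d + 1"] by auto
    ultimately have "even_affine (vertices \<rho>1 \<union> vertices \<rho>2) v' w'"
      using parB S(4) S'(4) v' w' unfolding parity_uniform_def by blast
    then have "even_affine (insert (?a, 1 :: real) ((vertices \<rho>1 \<union> vertices \<rho>2) \<times> {0})) (v', 0) (w', 0)"
      by (rule even_affine_cone[OF _ dilated_vertex_lattice[OF S(1)]]) simp
    moreover have "insert (?a, 1) ((vertices \<rho>1 \<union> vertices \<rho>2) \<times> {0}) = vertices \<tau>1 \<union> vertices \<tau>2"
      unfolding S(6) S'(6) \<sigma> by auto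
    ultimately show ?thesis using v w h \<open>h' = 0\<close> by simp
  qed
qed

lemma even_affine_above:
  assumes parK: "parity_uniform (off_sides e d) K"
    and \<tau>: "\<tau>1 \<in> shift_up K" "card (vertices \<tau>1) = DIM('a) + 2" "\<tau>2 \<in> shift_up K" "card (vertices \<tau>2) = DIM('a) + 2"
    and card: "card (vertices \<tau>1 \<inter> vertices \<tau>2) = DIM('a) + 1"
    and vw: "{v, w} \<subseteq> vertices \<tau>1 \<inter> vertices \<tau>2 \<inter> off_sides e (d + 1)"
  shows "even_affine (vertices \<tau>1 \<union> vertices \<tau>2) v w"
proof -
  let ?s = "(+) (0 :: 'a, 1 :: real)"
  obtain \<kappa>1 \<kappa>2 where \<kappa>: "\<kappa>1 \<in> K" "\<tau>1 = ?s ` \<kappa>1" "\<kappa>2 \<in> K" "\<tau>2 = ?s ` \<kappa>2"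
    using \<tau> by (auto simp: shift_up_eq)
  have V: "vertices \<tau>1 = ?s ` vertices \<kappa>1" "vertices \<tau>2 = ?s ` vertices \<kappa>2"
    unfolding \<kappa>(2,4) by (rule vertices_translation)+
  have I: "vertices \<tau>1 \<inter> vertices \<tau>2 = ?s ` (vertices \<kappa>1 \<inter> vertices \<kappa>2)"
    unfolding V by (simp add: image_Int)
  then obtain v' w' where v': "v' \<in> vertices \<kappa>1 \<inter> vertices \<kappa>2" "v = ?s v'"
    and w': "w' \<in> vertices \<kappa>1 \<inter> vertices \<kappa>2" "w = ?s w'" using vw by blast
  have "p \<in> off_sides e d" if "?s p \<in> off_sides e (d + 1)" for p
    using that by (simp add: off_sides_def)
  then have "{v', w'} \<subseteq> vertices \<kappa>1 \<inter> vertices \<kappa>2 \<inter> off_sides e d" using vw v' w' by auto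
  moreover have "card (vertices \<kappa>1) = DIM('a \<times> real) + 1" "card (vertices \<kappa>2) = DIM('a \<times> real) + 1"
    "card (vertices \<kappa>1 \<inter> vertices \<kappa>2) = DIM('a \<times> real)"
    using \<tau> card unfolding I unfolding V by (simp_all add: card_image)
  ultimately have "even_affine (vertices \<kappa>1 \<union> vertices \<kappa>2) v' w'"
    using parK \<kappa>(1,3) unfolding parity_uniform_def by blast
  then have "even_affine (?s ` (vertices \<kappa>1 \<union> vertices \<kappa>2)) (?s v') (?s w')"
    by (rule even_affine_translation) (simp add: lattice_M_Pair)
  then show ?thesis unfolding V v'(2) w'(2) image_Un .
qed

text \<open>Two adjacent facets lie above the slab, on both sides of its upper boundary, or in the slab.\<close>

theorem layered_parity_uniform:
  assumes parK: "parity_uniform (off_sides e d) K"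
    and parA: "parity_uniform (interior (std_simplex d)) A"
    and parB: "parity_uniform (interior (std_simplex (d + 1))) B"
    and hi: "hi \<le> DIM('a)" "ranks_upto hi = {..DIM('a)}"
    and a: "bottom_apex K a" and q: "a + (0, 1) + (real (d + 1) *\<^sub>R e hi, 0) = 2 *\<^sub>R q" "q \<in> lattice_M"
  shows "parity_uniform (off_sides e (d + 1)) layered"
  unfolding parity_uniform_def
proof (intro ballI allI impI)
  fix \<tau>1 \<tau>2 v w
  assume t: "\<tau>1 \<in> layered" "\<tau>2 \<in> layered" "card (vertices \<tau>1) = DIM('a \<times> real) + 1"
    "card (vertices \<tau>2) = DIM('a \<times> real) + 1" "card (vertices \<tau>1 \<inter> vertices \<tau>2) = DIM('a \<times> real)"
    and vw: "{v, w} \<subseteq> vertices \<tau>1 \<inter> vertices \<tau>2 \<inter> off_sides e (d + 1)"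
  have c: "card (vertices \<tau>1) = DIM('a) + 2" "card (vertices \<tau>2) = DIM('a) + 2"
    "card (vertices \<tau>1 \<inter> vertices \<tau>2) = DIM('a) + 1" "card (vertices \<tau>2 \<inter> vertices \<tau>1) = DIM('a) + 1"
    using t(3-5) by (simp_all add: Int_commute)
  consider "\<tau>1 \<in> shift_up K" "\<tau>2 \<in> shift_up K" | "\<tau>1 \<in> shift_up K" "\<tau>2 \<in> joins"
    | "\<tau>1 \<in> joins" "\<tau>2 \<in> shift_up K" | "\<tau>1 \<in> joins" "\<tau>2 \<in> joins"
    using t(1,2) by (auto simp: layered_def)
  then show "even_affine (vertices \<tau>1 \<union> vertices \<tau>2) v w"
  proof cases
    case 1
    then show ?thesis using even_affine_above[OF parK _ c(1) _ c(2,3) vw] by blast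
  next
    case 2
    then show ?thesis using even_affine_interface[OF hi a q _ c(1) _ c(2,3), of v w] vw by blast
  next
    case 3
    then have "even_affine (vertices \<tau>2 \<union> vertices \<tau>1) v w"
      using even_affine_interface[OF hi a q _ c(2) _ c(1,4), of v w] vw by blast
    then show ?thesis by (simp add: Un_commute)
  next
    case 4
    then show ?thesis using even_affine_slab[OF parA parB _ c(1) _ c(2,3) vw] by blast
  qed
qed

text \<open>The upper triangulation of the slab appears as the link of the opposite lower vertex.\<close>

theorem parity_uniform_of_layered:
  assumes par: "parity_uniform (interior (std_simplex (d + 1))) layered"
    and hi: "hi \<le> DIM('a)" "ranks_upto hi = {..DIM('a)}"
  shows "parity_uniform (interior (std_simplex d)) A"
  unfolding parity_uniform_def
proof (intro ballI allI impI)
  fix \<sigma>1 \<sigma>2 v w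
  assume s: "\<sigma>1 \<in> A" "\<sigma>2 \<in> A" "card (vertices \<sigma>1) = DIM('a) + 1" "card (vertices \<sigma>2) = DIM('a) + 1"
    "card (vertices \<sigma>1 \<inter> vertices \<sigma>2) = DIM('a)"
    and vw: "{v, w} \<subseteq> vertices \<sigma>1 \<inter> vertices \<sigma>2 \<inter> interior (std_simplex d)"
  let ?b = "real (d + 1) *\<^sub>R e hi"
  have low: "lower hi = {?b}" and up: "upper hi = std_simplex d" using ranks_upto_all[OF hi] by auto
  have b: "{?b} \<in> B"
  proof -
    have "?b \<in> lower hi" using low by simp
    then obtain \<rho> where "\<rho> \<in> B" "?b \<in> \<rho>" "\<rho> \<subseteq> lower hi" using triangulates_face_cover[OF B lower_face] by blast
    then have "\<rho> = {?b}" using low by blast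
    then show ?thesis using \<open>\<rho> \<in> B\<close> by simp
  qed
  have Vb: "vertices {?b} = {?b}" using vertices_convex_hull[of "{?b}"] by simp
  have J: "level_join \<sigma> {?b} \<in> layered" "vertices (level_join \<sigma> {?b}) = insert (?b, 0) (vertices \<sigma> \<times> {1})"
    if "\<sigma> \<in> A" for \<sigma>
  proof -
    have sub: "\<sigma> \<subseteq> upper hi" "{?b} \<subseteq> lower hi" using triangulates_subset[OF A that] up low by auto
    show "level_join \<sigma> {?b} \<in> layered" using joinsI[OF hi(1) that sub(1) b sub(2)] by (simp add: layered_def)
    show "vertices (level_join \<sigma> {?b}) = insert (?b, 0) (vertices \<sigma> \<times> {1})"
      using join_simplex(1)[OF hi(1) that sub(1) b sub(2)] unfolding Vb by auto
  qed
  have card: "card (insert (?b, 0::real) (S \<times> {1})) = Suc (card S)" if "finite S" for S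
    using that by (subst card_insert_disjoint) (auto simp: card_cartesian_product)
  have I: "insert (?b, 0) (vertices \<sigma>1 \<times> {1}) \<inter> insert (?b, 0) (vertices \<sigma>2 \<times> {1})
      = insert (?b, 0::real) ((vertices \<sigma>1 \<inter> vertices \<sigma>2) \<times> {1})" by auto
  have fin: "finite (vertices \<sigma>1)" "finite (vertices \<sigma>2)" "finite (vertices \<sigma>1 \<inter> vertices \<sigma>2)"
    using finite_vertices_A s by auto
  have "(x, 1 :: real) \<in> interior (std_simplex (d + 1))" if "x \<in> interior (std_simplex d)" for x :: 'a
    using that std_simplex_coord(2)[OF e d, of x] std_simplex_slice(2)[OF e, of "d + 1" x 1] by simp
  then have "{(v, 1), (w, 1)} \<subseteq> vertices (level_join \<sigma>1 {?b}) \<inter> vertices (level_join \<sigma>2 {?b}) \<inter> interior (std_simplex (d + 1))"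
    using vw J(2)[OF s(1)] J(2)[OF s(2)] by auto
  moreover have "card (vertices (level_join \<sigma>1 {?b})) = DIM('a \<times> real) + 1"
    "card (vertices (level_join \<sigma>2 {?b})) = DIM('a \<times> real) + 1"
    "card (vertices (level_join \<sigma>1 {?b}) \<inter> vertices (level_join \<sigma>2 {?b})) = DIM('a \<times> real)"
    unfolding J(2)[OF s(1)] J(2)[OF s(2)] I using card fin s by simp_all
  ultimately have "even_affine (vertices (level_join \<sigma>1 {?b}) \<union> vertices (level_join \<sigma>2 {?b})) (v, 1) (w, 1)"
    using par J(1)[OF s(1)] J(1)[OF s(2)] unfolding parity_uniform_def by blast
  then show "even_affine (vertices \<sigma>1 \<union> vertices \<sigma>2) v w"
  proof (rule even_affine_level)
    show "(vertices \<sigma>1 \<union> vertices \<sigma>2) \<times> {1} \<subseteq> vertices (level_join \<sigma>1 {?b}) \<union> vertices (level_join \<sigma>2 {?b})"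
      unfolding J(2)[OF s(1)] J(2)[OF s(2)] by blast
  qed simp
qed

end


section \<open>The alternating sums\<close>

subsection \<open>Dilated standard simplices as complexes\<close>

lemma simplex_std_simplex:
  assumes "d \<ge> 1"
  shows "int DIM('a) simplex (std_simplex d :: 'a::euclidean_space set)"
proof -
  let ?V = "insert 0 ((\<lambda>b. real d *\<^sub>R b) ` (Basis :: 'a set))"
  obtain x :: 'a where "x \<in> interior (convex hull (insert 0 Basis))"
    using interior_std_simplex_nonempty by blast
  then have "real d *\<^sub>R x \<in> interior (std_simplex d)"
    using assms unfolding std_simplex_iff(2)[OF assms] interior_std_simplex
    by (auto simp flip: sum_distrib_left)
  then have "interior (std_simplex d :: 'a set) \<noteq> {}" by blast
  then have "aff_dim (std_simplex d :: 'a set) = DIM('a)" by (rule aff_dim_nonempty_interior)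
  then have dim: "aff_dim ?V = DIM('a)" by (simp add: std_simplex_def aff_dim_convex_hull)
  have "card ?V \<le> Suc (card ((\<lambda>b. real d *\<^sub>R b) ` (Basis :: 'a set)))" by (rule card_insert_le_m1) auto
  also have "\<dots> \<le> DIM('a) + 1" using card_image_le[of "Basis :: 'a set"] by simp
  finally have "card ?V \<le> DIM('a) + 1" .
  moreover have "aff_dim ?V \<le> int (card ?V) - 1" by (rule aff_dim_le_card) simp
  ultimately have card: "int (card ?V) = int DIM('a) + 1" using dim by linarith
  then have "\<not> affine_dependent ?V" using dim by (simp add: affine_independent_iff_card)
  with card show ?thesis unfolding simplex_def std_simplex_def by blast
qed

lemma triangulates_faces:
  assumes "k simplex P"
  shows "triangulates {F. F face_of P} P"
  unfolding triangulates_def simplicial_complex_def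
proof (intro conjI ballI allI impI)
  show "finite {F. F face_of P}" using assms by (rule finite_simplex_faces)
  show "\<exists>n. n simplex S" if "S \<in> {F. F face_of P}" for S using that simplex_face[OF assms] by blast
  show "F \<in> {F. F face_of P}" if "S \<in> {F. F face_of P} \<and> F face_of S" for F S
    using that face_of_trans by blast
  show "S \<inter> S' face_of S" if "S \<in> {F. F face_of P} \<and> S' \<in> {F. F face_of P}" for S S'
  proof (rule face_of_subset)
    show "S \<inter> S' face_of P" using that by (simp add: face_of_Int)
    show "S \<subseteq> P" using that by (simp add: face_of_imp_subset)
  qed simp
  have "P face_of P" using convex_simplex[OF assms] by (rule face_of_refl)
  then show "\<Union>{F. F face_of P} = P" using face_of_imp_subset by blast
qed

lemma extends_int_standard: "extends_int (insert 0 (Basis :: 'a::euclidean_space set))"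
  unfolding extends_int_def
proof (intro allI impI)
  fix \<epsilon> :: "'a \<Rightarrow> real" assume \<epsilon>: "\<forall>a\<in>insert 0 Basis. \<epsilon> a \<in> \<int>"
  define u where "u = (\<Sum>b\<in>Basis. (\<epsilon> b - \<epsilon> 0) *\<^sub>R b)"
  have u: "b \<bullet> u = \<epsilon> b - \<epsilon> 0" if "b \<in> Basis" for b
    using that unfolding u_def by (simp add: inner_sum_right inner_Basis if_distrib cong: if_cong)
  have "u \<in> lattice_N" using u \<epsilon> by (auto simp: lattice_N_iff inner_commute[of u])
  moreover have "\<forall>a\<in>insert 0 Basis. a \<bullet> u + \<epsilon> 0 = \<epsilon> a" using u by auto
  ultimately show "\<exists>u\<in>lattice_N. \<exists>k\<in>\<int>. \<forall>a\<in>insert 0 Basis. a \<bullet> u + k = \<epsilon> a" using \<epsilon> by blast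
qed

lemma vertices_std_simplex_1: "vertices (std_simplex 1 :: 'a::euclidean_space set) = insert 0 Basis"
proof -
  have V: "(std_simplex 1 :: 'a set) = convex hull (insert 0 Basis)" by (simp add: std_simplex_def)
  have "\<not> affine_dependent (insert 0 (Basis :: 'a set))"
    using extends_int_standard by (intro extends_int_affine_independent) auto
  then show ?thesis unfolding V by (rule vertices_convex_hull)
qed

text \<open>The only lattice points of the standard simplex are its vertices, so that it has no other
  triangulation into lattice simplices.\<close>

lemma lattice_triangulation_std_simplex_1:
  fixes A :: "'a::euclidean_space set set"
  assumes A: "triangulates A (std_simplex 1)" and lat: "\<And>\<sigma>. \<sigma> \<in> A \<Longrightarrow> vertices \<sigma> \<subseteq> lattice_M"
  shows "A = {F. F face_of std_simplex 1}"
proof -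
  let ?P = "std_simplex 1 :: 'a set"
  have P: "int DIM('a) simplex ?P" by (rule simplex_std_simplex) simp
  have latP: "x \<in> insert 0 Basis" if "x \<in> lattice_M" "x \<in> ?P" for x :: 'a
  proof (cases "x = 0")
    case False
    have x: "\<forall>b\<in>Basis. 0 \<le> x \<bullet> b" "(\<Sum>b\<in>Basis. x \<bullet> b) \<le> 1"
      using that(2) by (auto simp: std_simplex_iff)
    obtain b where b: "b \<in> Basis" "x \<bullet> b \<noteq> 0" using False euclidean_all_zero_iff by blast
    have "x \<bullet> b \<in> \<int>" using that(1) b(1) by (simp add: lattice_M_def)
    then obtain m where "x \<bullet> b = of_int m" by (elim Ints_cases)
    then have "x \<bullet> b \<ge> 1" using b x(1) by (smt (verit) of_int_0_less_iff of_int_1_le_iff int_one_le_iff_zero_less)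
    have sum: "(\<Sum>c\<in>Basis. x \<bullet> c) = x \<bullet> b + (\<Sum>c\<in>Basis - {b}. x \<bullet> c)" using b(1) by (simp add: sum.remove)
    have nonneg: "0 \<le> (\<Sum>c\<in>Basis - {b}. x \<bullet> c)" using x(1) by (intro sum_nonneg) auto
    have "(\<Sum>c\<in>Basis - {b}. x \<bullet> c) = 0" "x \<bullet> b = 1" using sum nonneg x(2) \<open>x \<bullet> b \<ge> 1\<close> by linarith+
    then have "x \<bullet> c = b \<bullet> c" if "c \<in> Basis" for c
      using that b(1) x(1) sum_nonneg_eq_0_iff[of "Basis - {b}" "\<lambda>c. x \<bullet> c"] by (cases "c = b") (auto simp: inner_Basis)
    then have "x = b" by (rule euclidean_eqI)
    then show ?thesis using b(1) by simp
  qed simp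
  have "interior ?P \<noteq> {}"
  proof -
    have P_eq: "?P = convex hull (insert 0 Basis)" by (simp add: std_simplex_def)
    obtain y :: 'a where "y \<in> interior (convex hull (insert 0 Basis))"
      using interior_std_simplex_nonempty by blast
    then show ?thesis unfolding P_eq by blast
  qed
  then obtain x where x: "x \<in> interior ?P" by blast
  then have "x \<in> \<Union>A" using A interior_subset by (auto simp: triangulates_def)
  then obtain \<sigma> where \<sigma>: "\<sigma> \<in> A" "x \<in> \<sigma>" by blast
  obtain k where k: "k simplex \<sigma>" using triangulates_simplex[OF A \<sigma>(1)] by blast
  have "vertices \<sigma> \<subseteq> vertices ?P"
    unfolding vertices_std_simplex_1
    using latP lat[OF \<sigma>(1)] vertices_subset[of \<sigma>] triangulates_subset[OF A \<sigma>(1)] by blast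
  then have "\<sigma> face_of ?P" using simplex_face_iff_vertices[OF P k] by simp
  then have "\<sigma> = ?P" using face_of_disjoint_interior[of \<sigma> ?P] x \<sigma>(2) by blast
  then have "{F. F face_of ?P} \<subseteq> A" using triangulates_face[OF A] \<sigma>(1) by blast
  moreover have "?P \<noteq> {}" using x interior_subset by blast
  ultimately show ?thesis by (intro triangulation_eq_of_cover[OF A triangulates_faces[OF P]])
qed

subsection \<open>Induction along the slabs\<close>

definition slab_rank :: "nat \<Rightarrow> nat \<Rightarrow> nat \<Rightarrow> nat" where
  "slab_rank n d k = (if even d then k else n - k)"

text \<open>The index of least rank; the index of greatest rank for \<open>d\<close> is the one of least rank for \<open>d - 1\<close>.\<close>

definition lowest :: "nat \<Rightarrow> nat \<Rightarrow> nat" where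
  "lowest n d = (if even d then 0 else n)"

lemma IV_Suc:
  fixes e :: "nat \<Rightarrow> 'a::euclidean_space"
  assumes "d \<ge> 1"
  shows "IV e L (Suc d) = (if even d then plus_triang e d (IV e L d) (L (Suc d))
      else minus_triang e d (IV e L d) (L (Suc d)))"
  using assms by (cases d) auto

text \<open>The opposite vertex of the facets of \<open>IV\<^sub>d(L)\<close> that rest on the bottom.  The vertex below the same base in the
  next slab is \<open>d + 1\<close> times the same \<open>e\<^sub>i\<close>, and the midpoint of both is the lattice point \<open>d e\<^sub>i\<close>.\<close>

definition apex :: "(nat \<Rightarrow> 'a::euclidean_space) \<Rightarrow> nat \<Rightarrow> 'a \<times> real" where
  "apex e d = ((real d - 1) *\<^sub>R e (lowest DIM('a) (d - 1)), 1)"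

locale alternating =
  fixes e :: "nat \<Rightarrow> 'a::euclidean_space" and L :: "nat \<Rightarrow> 'a set set"
  assumes e: "basis_enum e"
    and L: "\<And>d. d \<ge> 1 \<Longrightarrow> primitive_triangulation (L d) (std_simplex d)"
begin

lemma L_triangulates: "d \<ge> 1 \<Longrightarrow> triangulates (L d) (std_simplex d)"
  using L by (auto simp: primitive_triangulation_def)

lemma L_unimodular: "d \<ge> 1 \<Longrightarrow> \<sigma> \<in> L d \<Longrightarrow> unimodular \<sigma>"
  using L primitive_triangulation_unimodular by blast

text \<open>The properties of \<open>IV\<^sub>d(L)\<close> on which the next slab depends.\<close>

definition good_complex :: "nat \<Rightarrow> ('a \<times> real) set set \<Rightarrow> bool" where
  "good_complex d K \<longleftrightarrow> triangulates K (std_simplex d) \<and> (\<forall>\<sigma>\<in>K. unimodular \<sigma>) \<and>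
     restriction K {p. snd p = 0} = embed (L d) \<and> bottom_apex K (apex e d)"

lemma layers:
  assumes "d \<ge> 1" "good_complex d K"
  shows "layers e (slab_rank DIM('a) d) d K (L d) (L (Suc d))"
proof unfold_locales
  show "inj_on (slab_rank DIM('a) d) {..DIM('a)}" by (auto simp: slab_rank_def inj_on_def)
qed (use assms e L_triangulates[of d] L_triangulates[of "Suc d"] L_unimodular in \<open>auto simp: good_complex_def\<close>)

lemma good_IV_1: "good_complex 1 (IV e L 1)"
proof -
  let ?P = "std_simplex 1 :: ('a \<times> real) set"
  have P: "int DIM('a \<times> real) simplex ?P" by (rule simplex_std_simplex) simp
  have Q: "int DIM('a) simplex (std_simplex 1 :: 'a set)" by (rule simplex_std_simplex) simp
  have IV: "IV e L 1 = {F. F face_of ?P}" by simp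
  have L1: "L 1 = {F. F face_of std_simplex 1}"
    using L_triangulates[of 1] L_unimodular[of 1]
    by (intro lattice_triangulation_std_simplex_1) (auto simp: unimodular_def)
  have V: "vertices ?P = insert (0, 1) ((insert 0 Basis) \<times> {0})"
    unfolding vertices_std_simplex_1 Basis_prod_def zero_prod_def by auto
  have "unimodular ?P"
    unfolding unimodular_def vertices_std_simplex_1
    using extends_int_standard lattice_M_Basis by auto
  then have "\<forall>\<sigma>\<in>IV e L 1. unimodular \<sigma>" unfolding IV using unimodular_face by blast
  moreover have "restriction (IV e L 1) {p. snd p = 0} = embed (L 1)"
  proof (intro subset_antisym subsetI)
    fix F assume "F \<in> restriction (IV e L 1) {p. snd p = 0}"
    then have F: "F face_of ?P" "F \<subseteq> {p. snd p = 0}" unfolding IV by (auto simp: restriction_def)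
    then obtain c where c: "c \<subseteq> vertices ?P" "F = convex hull c" using simplex_face_iff[OF P] by blast
    have "c \<subseteq> {p. snd p = 0}" using F(2) hull_subset[of c convex] unfolding c(2) by blast
    then have "c \<subseteq> (insert 0 Basis) \<times> {0}" using c(1) unfolding V by auto
    note sub = this
    define C where "C = {x. (x, 0) \<in> c}"
    have C: "c = C \<times> {0}" "C \<subseteq> insert 0 Basis" unfolding C_def using sub by auto
    then have "F = (convex hull C) \<times> {0}" using c(2) by (simp add: convex_hull_Times)
    moreover have "convex hull C face_of std_simplex 1"
      using C(2) simplex_face_iff[OF Q] unfolding vertices_std_simplex_1 by blast
    ultimately show "F \<in> embed (L 1)" unfolding L1 embed_eq by blast
  next
    fix F assume "F \<in> embed (L 1)"
    then obtain G where G: "G face_of std_simplex 1" "F = G \<times> {0}" unfolding L1 embed_eq by blast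
    then obtain C where C: "C \<subseteq> insert 0 Basis" "G = convex hull C"
      using simplex_face_iff[OF Q] unfolding vertices_std_simplex_1 by blast
    have "F = convex hull (C \<times> {0})" using G(2) C(2) by (simp add: convex_hull_Times)
    moreover have "C \<times> {0} \<subseteq> vertices ?P" using C(1) unfolding V by auto
    ultimately have "F face_of ?P" using simplex_face_iff[OF P] by blast
    then show "F \<in> restriction (IV e L 1) {p. snd p = 0}" unfolding IV restriction_def using G(2) by auto
  qed
  moreover have "bottom_apex (IV e L 1) (apex e 1)"
    unfolding bottom_apex_def
  proof (intro conjI ballI impI)
    show "snd (apex e 1) = 1" by (simp add: apex_def)
    fix \<tau> assume \<tau>: "\<tau> \<in> IV e L 1" "card (vertices \<tau>) = DIM('a) + 2"
    have fin: "finite (vertices ?P)" and card: "card (vertices ?P) = DIM('a) + 2"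
      using simplex_vertices(2,4)[OF P] by auto
    have "vertices \<tau> \<subseteq> vertices ?P" using \<tau>(1) unfolding IV by (auto simp: vertices_face_eq)
    then have "vertices \<tau> = vertices ?P" using fin card \<tau>(2) by (intro card_subset_eq) auto
    then show "vertices \<tau> = insert (apex e 1) {p\<in>vertices \<tau>. snd p = 0}"
      unfolding V by (auto simp: apex_def)
  qed
  ultimately show ?thesis using triangulates_faces[OF P] unfolding good_complex_def IV by blast
qed

lemma IV_Suc_layered:
  assumes d: "d \<ge> 1" and K: "good_complex d (IV e L d)"
  shows "IV e L (Suc d) = layers.layered e (slab_rank DIM('a) d) d (IV e L d) (L d) (L (Suc d))"
proof -
  interpret layers e "slab_rank DIM('a) d" d "IV e L d" "L d" "L (Suc d)" by (rule layers[OF d K])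
  show ?thesis
  proof (cases "even d")
    case True
    have "(THE T. is_layered e d (\<lambda>i. {0..i}) (\<lambda>i. {i..DIM('a)}) (IV e L d) (L (Suc d)) T) = layered"
      by (rule the_layered) (use True in \<open>auto simp: ranks_upto_def ranks_from_def slab_rank_def\<close>)
    then show ?thesis using True IV_Suc[OF d, of e L] by (simp add: plus_triang_def)
  next
    case False
    have "(THE T. is_layered e d (\<lambda>i. {i..DIM('a)}) (\<lambda>i. {0..i}) (IV e L d) (L (Suc d)) T) = layered"
      by (rule the_layered) (use False in \<open>auto simp: ranks_upto_def ranks_from_def slab_rank_def\<close>)
    then show ?thesis using False IV_Suc[OF d, of e L] by (simp add: minus_triang_def)
  qed
qed

lemma ranks_lowest:
  assumes "d \<ge> 1"
  shows "{k. k \<le> DIM('a) \<and> slab_rank DIM('a) d (lowest DIM('a) d) \<le> slab_rank DIM('a) d k} = {..DIM('a)}"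
    "{k. k \<le> DIM('a) \<and> slab_rank DIM('a) d k \<le> slab_rank DIM('a) d (lowest DIM('a) (d - 1))} = {..DIM('a)}"
  using assms by (auto simp: slab_rank_def lowest_def)

lemma lowest_le: "lowest DIM('a) d \<le> DIM('a)"
  by (simp add: lowest_def)

lemma good_IV: "d \<ge> 1 \<Longrightarrow> good_complex d (IV e L d)"
proof (induction d rule: dec_induct)
  case base
  show ?case by (rule good_IV_1)
next
  case (step d)
  interpret layers e "slab_rank DIM('a) d" d "IV e L d" "L d" "L (Suc d)" by (rule layers[OF step(1,3)])
  have "bottom_apex layered (real d *\<^sub>R e (lowest DIM('a) d), 1)"
    using ranks_lowest(1)[OF step(1)] by (intro layered_bottom_apex lowest_le) (simp add: ranks_from_def)
  moreover have "apex e (Suc d) = (real d *\<^sub>R e (lowest DIM('a) d), 1)" by (simp add: apex_def)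
  ultimately show ?case
    using layered_triangulates layered_unimodular layered_bottom
    unfolding good_complex_def IV_Suc_layered[OF step(1,3)] by simp
qed

lemma IV_parity_uniform:
  assumes par: "\<And>d. d \<ge> 1 \<Longrightarrow> parity_uniform (interior (std_simplex d)) (L d)"
  shows "d \<ge> 1 \<Longrightarrow> parity_uniform (off_sides e d) (IV e L d)"
proof (induction d rule: dec_induct)
  case base
  show ?case
    unfolding parity_uniform_def
  proof (intro ballI allI impI)
    fix \<tau>1 \<tau>2 :: "('a \<times> real) set" and v w
    assume \<tau>: "\<tau>1 \<in> IV e L 1" "\<tau>2 \<in> IV e L 1" "card (vertices \<tau>1) = DIM('a \<times> real) + 1"
      "card (vertices \<tau>2) = DIM('a \<times> real) + 1" "card (vertices \<tau>1 \<inter> vertices \<tau>2) = DIM('a \<times> real)"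
    have P: "int DIM('a \<times> real) simplex (std_simplex 1 :: ('a \<times> real) set)" by (rule simplex_std_simplex) simp
    have eq: "vertices \<tau> = vertices (std_simplex 1)"
      if "\<tau> \<in> IV e L 1" "card (vertices \<tau>) = DIM('a \<times> real) + 1" for \<tau>
      using that simplex_vertices(2,4)[OF P] by (intro card_subset_eq) (auto simp: vertices_face_eq)
    have "vertices \<tau>1 = vertices \<tau>2" unfolding eq[OF \<tau>(1,3)] eq[OF \<tau>(2,4)] ..
    then show "even_affine (vertices \<tau>1 \<union> vertices \<tau>2) v w" using \<tau>(3,5) by simp
  qed
next
  case (step d)
  interpret layers e "slab_rank DIM('a) d" d "IV e L d" "L d" "L (Suc d)" by (rule layers[OF step(1) good_IV[OF step(1)]])
  let ?hi = "lowest DIM('a) (d - 1)"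
  have hi: "ranks_upto ?hi = {..DIM('a)}" using ranks_lowest(2)[OF step(1)] by (simp add: ranks_upto_def)
  have a: "bottom_apex (IV e L d) (apex e d)" using good_IV[OF step(1)] by (simp add: good_complex_def)
  have q: "apex e d + (0, 1) + (real (d + 1) *\<^sub>R e ?hi, 0) = 2 *\<^sub>R (real d *\<^sub>R e ?hi, 1)"
    by (simp add: apex_def scaleR_add_left[symmetric])
  have "(real d *\<^sub>R e ?hi, 1 :: real) \<in> lattice_M" using dilated_vertex_lattice[OF lowest_le] by (simp add: lattice_M_Pair)
  then have "parity_uniform (off_sides e (d + 1)) layered"
    using layered_parity_uniform[OF step(3) par[OF step(1)] _ lowest_le hi a q] par[of "d + 1"] by simp
  then show ?case unfolding IV_Suc_layered[OF step(1) good_IV[OF step(1)]] by simp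
qed

lemma parity_uniform_of_IV:
  assumes d: "d \<ge> 1" and par: "parity_uniform (interior (std_simplex (Suc d))) (IV e L (Suc d))"
  shows "parity_uniform (interior (std_simplex d)) (L d)"
proof -
  interpret layers e "slab_rank DIM('a) d" d "IV e L d" "L d" "L (Suc d)" by (rule layers[OF d good_IV[OF d]])
  have "ranks_upto (lowest DIM('a) (d - 1)) = {..DIM('a)}" using ranks_lowest(2)[OF d] by (simp add: ranks_upto_def)
  moreover have "parity_uniform (interior (std_simplex (d + 1))) layered"
    using par unfolding IV_Suc_layered[OF d good_IV[OF d]] by simp
  ultimately show ?thesis using parity_uniform_of_layered lowest_le by blast
qed

lemma rho_uniform_L: "d \<ge> 1 \<Longrightarrow> rho_uniform (std_simplex d) (L d) \<longleftrightarrow> parity_uniform (interior (std_simplex d)) (L d)"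
proof -
  assume d: "d \<ge> 1"
  interpret unimodular_triangulation "std_simplex d" "L d"
    using simplex_std_simplex[OF d] L_triangulates[OF d] L_unimodular[OF d] by unfold_locales
  show ?thesis by (rule rho_uniform_iff)
qed

lemma rho_uniform_IV:
  "d \<ge> 1 \<Longrightarrow> rho_uniform (std_simplex d) (IV e L d) \<longleftrightarrow> parity_uniform (interior (std_simplex d)) (IV e L d)"
proof -
  assume d: "d \<ge> 1"
  interpret unimodular_triangulation "std_simplex d" "IV e L d"
    using simplex_std_simplex[OF d, where 'a = "'a \<times> real"] good_IV[OF d] by unfold_locales (auto simp: good_complex_def)
  show ?thesis by (rule rho_uniform_iff)
qed

lemma interior_off_sides:
  assumes "d \<ge> 1"
  shows "interior (std_simplex d) \<subseteq> off_sides e d"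
  using std_simplex_slice(2)[OF e assms] by (auto simp: off_sides_def)

end

theorem proposition6p3:
  fixes e :: "nat \<Rightarrow> 'a::euclidean_space"
    and L :: "nat \<Rightarrow> 'a set set"
  assumes "basis_enum e"
    and "\<And>d. d \<ge> 1 \<Longrightarrow> primitive_triangulation (L d) (std_simplex d)"
  shows "(\<forall>d\<ge>1. rho_uniform (std_simplex d) (L d)) \<longleftrightarrow>
         (\<forall>d\<ge>1. rho_uniform (std_simplex d) (IV e L d))"
proof -
  interpret alternating e L using assms by unfold_locales
  show ?thesis
  proof
    assume "\<forall>d\<ge>1. rho_uniform (std_simplex d) (L d)"
    then have "parity_uniform (off_sides e d) (IV e L d)" if "d \<ge> 1" for d
      using IV_parity_uniform[OF _ that] rho_uniform_L by blast
    then show "\<forall>d\<ge>1. rho_uniform (std_simplex d) (IV e L d)"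
      using rho_uniform_IV parity_uniform_mono interior_off_sides by blast
  next
    assume "\<forall>d\<ge>1. rho_uniform (std_simplex d) (IV e L d)"
    then have "parity_uniform (interior (std_simplex (Suc d))) (IV e L (Suc d))" for d
      using rho_uniform_IV by simp
    then show "\<forall>d\<ge>1. rho_uniform (std_simplex d) (L d)"
      using rho_uniform_L parity_uniform_of_IV by blast
  qed
qed

end
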